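(* Let $(\Gamma,v)$ be an infinite one-ended cactus rooted at $v$, and let $\{H_n\}_{n\ge1}$ be an exhaustion of $(\Gamma,v)$ by finite subgraphs containing $v$ such that the internal boundary of each $H_n$ consists of a unique vertex $p^{(n)}$, which is set to be the unique dissipative vertex of $H_n$. Let $\mathcal{CP}_v=\mathcal{C}_1\mathcal{C}_2\dots$ be the infinite block-path in $\Gamma$ starting at $v$ and let $\mathcal{CP}^n_v=\mathcal{C}_1\dots\mathcal{C}_{r_n}$ be the finite block-path in $H_n$ joining $v$ to $p^{(n)}$. Suppose that $\sum_{j=1,\,|\mathcal{C}_j|>2}^{r_n}\frac1{|\mathcal{C}_j|}$ converges as $r_n\to\infty$; that there exists $c>0$ such that, for any $i$ sufficiently large, $\mathrm{Diam}(D(p_i))\le c|\mathcal{C}_i|$; and that $\lim_{i\to\infty}\frac{\log d_{i-1}}{\log d_i}=1$. Suppose that $\Gamma$ has polynomial growth and that its degree of growth $\alpha$ is given by $$\alpha=\lim_{i\to\infty}\frac{\log d_i}{\log \mathrm{Diam}(D(p_i))}.$$ Then the critical exponent $\delta$ of the Abelian sandpile model on $\{H_n\}$ approximating $(\Gamma,v)$ is related to the growth degree $\alpha$ of $\Gamma$ by $\delta=2/\alpha$.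
   Context: **Graphs.** Graphs are connected, locally finite, possibly with loops and multiple edges (a loop contributes 2 to the degree). A block is a maximal 2-connected subgraph; a cactus is a separable graph (one having a cut vertex), possibly with loops, all of whose blocks are cycles (possibly of length 2) or single edges. $|\mathcal{C}|$ denotes the number of vertices of a block. A block-path is a sequence of distinct blocks with consecutive blocks intersecting; the block-path joining two vertices is the unique one of minimal length whose first and last blocks contain them. In an infinite one-ended cactus $(\Gamma,v)$ there is a unique infinite block-path $\mathcal{CP}_v=\mathcal{C}_1\mathcal{C}_2\dots$ starting at $v$ (i.e. $v\in\mathcal{C}_1$, $v\notin\mathcal{C}_2$). For $i\ge1$, $p_i$ is the cut vertex between $\mathcal{C}_i$ and $\mathcal{C}_{i+1}$; $D(p_i)$ is the subgraph consisting of the union of all finite connected components of $\Gamma\setminus\{p_i\}$ together with $p_i$; $d_i$ is its number of vertices. The internal boundary of a subgraph $H\subset\Gamma$ is the set of vertices of $H$ having a neighbour in $\Gamma\setminus H$. $\Gamma$ has polynomial growth of degree $\alpha$ if $\alpha=\limsup_{r\to\infty}\frac{\log|B_\Gamma(v,r)|}{\log r}$ is finite. **Sandpile model.** Let $H$ be a finite connected graph with a nonempty set $P$ of dissipative vertices and $V_0=V(H)\setminus P$. A configuration is $\eta:V_0\to\mathbb{N}$; it is stable if $\eta(w)<\deg(w)$ for all $w\in V_0$. Firing $w\in V_0$ with $\eta(w)\ge\deg(w)$ sends one chip along each edge incident to $w$; chips reaching $P$ disappear. Stabilization by finitely many firings always occurs, and the result and number of firings of each vertex are independent of the order. Recurrent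 configurations are the recurrent states of the Markov chain on stable configurations that adds a chip at a random vertex of $V_0$ (every vertex having positive probability) and stabilizes; equivalently, stable $c$ such that there is no nonempty $U\subset V_0$ with $c(w)<\deg_{H[U]}(w)$ for all $w\in U$. $\mathcal{R}_H$ is the set of recurrent configurations; $Mav_H(c,v)$, the mass of the avalanche, is the number of distinct vertices fired while stabilizing $c+\delta_v$. $\mu_n$ is the uniform distribution on $\mathcal{R}_{H_n}$. **Critical exponent.** The model on $\{H_n\}$ is critical with critical exponent $\delta>0$ if there are $C_1,C_2>0$ such that for all $\epsilon>0$ there is $M_\epsilon\ge1$ with $C_1M^{-\delta-\epsilon}\le\lim_{n\to\infty}\mathbb{P}_{\mu_n}(Mav_{H_n}(\cdot,v)=M)\le C_2M^{-\delta+\epsilon}$ for all $M>M_\epsilon$ that can be realized as the mass of an avalanche. *)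

theory Defs
  imports "HOL-Probability.Probability"
begin

section \<open>Undirected graphs with loops and multiple edges\<close>

text \<open>\<open>ends e\<close> is the set of endpoints of the edge \<open>e\<close>, a singleton if \<open>e\<close> is a loop.\<close>

record ('v, 'e) mgraph =
  verts :: "'v set"
  edges :: "'e set"
  ends :: "'e \<Rightarrow> 'v set"

definition wf_mgraph :: "('v, 'e) mgraph \<Rightarrow> bool" where
  "wf_mgraph G \<longleftrightarrow> (\<forall>e\<in>edges G. ends G e \<subseteq> verts G \<and> card (ends G e) \<in> {1, 2})"

definition locally_finite :: "('v, 'e) mgraph \<Rightarrow> bool" where
  "locally_finite G \<longleftrightarrow> (\<forall>x\<in>verts G. finite {e \<in> edges G. x \<in> ends G e})"

definition finite_mgraph :: "('v, 'e) mgraph \<Rightarrow> bool" where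
  "finite_mgraph G \<longleftrightarrow> finite (verts G) \<and> finite (edges G)"

definition degree :: "('v, 'e) mgraph \<Rightarrow> 'v \<Rightarrow> nat" where
  "degree G x = card {e \<in> edges G. x \<in> ends G e} + card {e \<in> edges G. ends G e = {x}}"

definition adjacent :: "('v, 'e) mgraph \<Rightarrow> 'v \<Rightarrow> 'v \<Rightarrow> bool" where
  "adjacent G x y \<longleftrightarrow> (\<exists>e\<in>edges G. ends G e = {x, y})"

text \<open>The whole incidence map is kept, not only its restriction to the edges of the subgraph, so
  that a subgraph is determined by its vertices and edges.\<close>

definition subgraph :: "('v, 'e) mgraph \<Rightarrow> ('v, 'e) mgraph \<Rightarrow> bool" where
  "subgraph H G \<longleftrightarrow>
     wf_mgraph H \<and> verts H \<subseteq> verts G \<and> edges H \<subseteq> edges G \<and> ends H = ends G"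

definition induced :: "('v, 'e) mgraph \<Rightarrow> 'v set \<Rightarrow> ('v, 'e) mgraph" where
  "induced G U = \<lparr>verts = verts G \<inter> U, edges = {e \<in> edges G. ends G e \<subseteq> U}, ends = ends G\<rparr>"

definition delete_verts :: "('v, 'e) mgraph \<Rightarrow> 'v set \<Rightarrow> ('v, 'e) mgraph" where
  "delete_verts G K = induced G (verts G - K)"

definition delete_loops :: "('v, 'e) mgraph \<Rightarrow> ('v, 'e) mgraph" where
  "delete_loops G = G\<lparr>edges := {e \<in> edges G. card (ends G e) = 2}\<rparr>"

definition connected_mgraph :: "('v, 'e) mgraph \<Rightarrow> bool" where
  "connected_mgraph G \<longleftrightarrow> (\<forall>x\<in>verts G. \<forall>y\<in>verts G. (adjacent G)\<^sup>*\<^sup>* x y)"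

definition conn_components :: "('v, 'e) mgraph \<Rightarrow> 'v set set" where
  "conn_components G = (\<lambda>x. {y \<in> verts G. (adjacent G)\<^sup>*\<^sup>* x y}) ` verts G"

definition one_ended :: "('v, 'e) mgraph \<Rightarrow> bool" where
  "one_ended G \<longleftrightarrow> (\<forall>K. finite K \<and> K \<subseteq> verts G \<longrightarrow>
     (\<exists>!A. A \<in> conn_components (delete_verts G K) \<and> infinite A))"

definition gdist :: "('v, 'e) mgraph \<Rightarrow> 'v \<Rightarrow> 'v \<Rightarrow> nat" where
  "gdist G x y = (LEAST n. (adjacent G ^^ n) x y)"

definition gball :: "('v, 'e) mgraph \<Rightarrow> 'v \<Rightarrow> nat \<Rightarrow> 'v set" where
  "gball G x r = {y \<in> verts G. gdist G x y \<le> r}"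

definition gdiam :: "('v, 'e) mgraph \<Rightarrow> nat" where
  "gdiam G = Max ((\<lambda>(x, y). gdist G x y) ` (verts G \<times> verts G))"

definition growth_degree :: "('v, 'e) mgraph \<Rightarrow> 'v \<Rightarrow> ereal" where
  "growth_degree G v = limsup (\<lambda>r. ereal (ln (real (card (gball G v r))) / ln (real r)))"

definition internal_boundary :: "('v, 'e) mgraph \<Rightarrow> ('v, 'e) mgraph \<Rightarrow> 'v set" where
  "internal_boundary G H = {x \<in> verts H. \<exists>y\<in>verts G - verts H. adjacent G x y}"

definition exhaustion :: "('v, 'e) mgraph \<Rightarrow> (nat \<Rightarrow> ('v, 'e) mgraph) \<Rightarrow> bool" where
  "exhaustion G H \<longleftrightarrow>
     (\<forall>n. subgraph (H n) G \<and> finite_mgraph (H n) \<and> connected_mgraph (H n)) \<and>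
     (\<forall>n. subgraph (H n) (H (Suc n))) \<and>
     (\<Union>n. verts (H n)) = verts G \<and> (\<Union>n. edges (H n)) = edges G"


section \<open>Blocks, cacti and block-paths\<close>

definition cut_vertex :: "('v, 'e) mgraph \<Rightarrow> 'v \<Rightarrow> bool" where
  "cut_vertex G x \<longleftrightarrow> x \<in> verts G \<and> \<not> connected_mgraph (delete_verts G {x})"

text \<open>As usual for blocks, the graph consisting of two vertices and at least one edge between them
  counts as 2-connected.\<close>

definition two_connected :: "('v, 'e) mgraph \<Rightarrow> bool" where
  "two_connected G \<longleftrightarrow>
     connected_mgraph G \<and> (\<exists>x\<in>verts G. \<exists>y\<in>verts G. x \<noteq> y) \<and> (\<nexists>x. cut_vertex G x)"

text \<open>Loops do not affect 2-connectedness, so they are removed before blocks are formed; otherwise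
  a cycle with a loop attached to it would be a block that is not a cycle. Counting a loop
  as a block of its own would change neither the blocks on at least two vertices nor the shortest
  block-paths between distinct vertices.\<close>

definition block :: "('v, 'e) mgraph \<Rightarrow> ('v, 'e) mgraph \<Rightarrow> bool" where
  "block G B \<longleftrightarrow> subgraph B (delete_loops G) \<and> two_connected B \<and>
     (\<forall>B'. subgraph B' (delete_loops G) \<and> two_connected B' \<and> subgraph B B' \<longrightarrow> B' = B)"

definition is_cycle :: "('v, 'e) mgraph \<Rightarrow> bool" where
  "is_cycle B \<longleftrightarrow> (\<exists>k f g. k \<ge> 2 \<and> bij_betw f {..<k} (verts B) \<and> bij_betw g {..<k} (edges B) \<and>
     (\<forall>i<k. ends B (g i) = {f i, f (Suc i mod k)}))"

definition is_single_edge :: "('v, 'e) mgraph \<Rightarrow> bool" where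
  "is_single_edge B \<longleftrightarrow>
     (\<exists>x y e. x \<noteq> y \<and> verts B = {x, y} \<and> edges B = {e} \<and> ends B e = {x, y})"

definition cactus :: "('v, 'e) mgraph \<Rightarrow> bool" where
  "cactus G \<longleftrightarrow> (\<exists>x. cut_vertex G x) \<and> (\<forall>B. block G B \<longrightarrow> is_cycle B \<or> is_single_edge B)"

definition block_path :: "('v, 'e) mgraph \<Rightarrow> ('v, 'e) mgraph list \<Rightarrow> bool" where
  "block_path G Bs \<longleftrightarrow> distinct Bs \<and> (\<forall>B\<in>set Bs. block G B) \<and>
     successively (\<lambda>B B'. verts B \<inter> verts B' \<noteq> {}) Bs"

definition connects ::
    "('v, 'e) mgraph \<Rightarrow> 'v \<Rightarrow> 'v \<Rightarrow> ('v, 'e) mgraph list \<Rightarrow> bool" where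
  "connects G x y Bs \<longleftrightarrow>
     block_path G Bs \<and> Bs \<noteq> [] \<and> x \<in> verts (hd Bs) \<and> y \<in> verts (last Bs)"

definition block_path_joining ::
    "('v, 'e) mgraph \<Rightarrow> 'v \<Rightarrow> 'v \<Rightarrow> ('v, 'e) mgraph list \<Rightarrow> bool" where
  "block_path_joining G x y Bs \<longleftrightarrow>
     connects G x y Bs \<and> (\<forall>Bs'. connects G x y Bs' \<longrightarrow> length Bs \<le> length Bs')"

text \<open>Infinite block-paths \<open>C 1, C 2, \<dots>\<close> are indexed from 1; \<open>C 0\<close> is irrelevant. The last
  condition says that the initial segments have minimal length. Without it uniqueness fails:
  when \<open>C 1\<close> and \<open>C 2\<close> meet a third block in a common vertex,
  that block could be inserted between them.\<close>

definition infinite_block_path ::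
    "('v, 'e) mgraph \<Rightarrow> 'v \<Rightarrow> (nat \<Rightarrow> ('v, 'e) mgraph) \<Rightarrow> bool" where
  "infinite_block_path G v C \<longleftrightarrow>
     inj_on C {1..} \<and> (\<forall>i\<ge>1. block G (C i)) \<and>
     (\<forall>i\<ge>1. verts (C i) \<inter> verts (C (Suc i)) \<noteq> {}) \<and>
     v \<in> verts (C 1) \<and> v \<notin> verts (C 2) \<and>
     (\<forall>i\<ge>1. \<forall>x \<in> verts (C i) \<inter> verts (C (Suc i)).
        block_path_joining G v x (map C [1..<Suc i]))"

text \<open>This is the subgraph \<open>D(x)\<close>; being induced, it contains the edges joining \<open>x\<close> to the
  finite components.\<close>

definition finite_part :: "('v, 'e) mgraph \<Rightarrow> 'v \<Rightarrow> ('v, 'e) mgraph" where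
  "finite_part G x =
     induced G (insert x (\<Union>{A \<in> conn_components (delete_verts G {x}). finite A}))"


section \<open>The Abelian sandpile model\<close>

text \<open>\<open>P\<close> is the set of dissipative vertices of \<open>H\<close>. A configuration is a function that vanishes
  outside \<open>active H P\<close>.\<close>

definition active :: "('v, 'e) mgraph \<Rightarrow> 'v set \<Rightarrow> 'v set" where
  "active H P = verts H - P"

definition stable :: "('v, 'e) mgraph \<Rightarrow> 'v set \<Rightarrow> ('v \<Rightarrow> nat) \<Rightarrow> bool" where
  "stable H P \<eta> \<longleftrightarrow> (\<forall>w\<in>active H P. \<eta> w < degree H w)"

definition stable_configs :: "('v, 'e) mgraph \<Rightarrow> 'v set \<Rightarrow> ('v \<Rightarrow> nat) set" where
  "stable_configs H P = {\<eta>. stable H P \<eta> \<and> (\<forall>x. x \<notin> active H P \<longrightarrow> \<eta> x = 0)}"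

text \<open>The number of chips that \<open>x\<close> receives when \<open>w\<close> is fired; a loop at \<open>w\<close> returns the two
  chips that it takes from \<open>w\<close>.\<close>

definition chips :: "('v, 'e) mgraph \<Rightarrow> 'v \<Rightarrow> 'v \<Rightarrow> nat" where
  "chips H w x = (if x = w then 2 else 1) * card {e \<in> edges H. ends H e = {w, x}}"

definition fire :: "('v, 'e) mgraph \<Rightarrow> 'v set \<Rightarrow> 'v \<Rightarrow> ('v \<Rightarrow> nat) \<Rightarrow> ('v \<Rightarrow> nat)" where
  "fire H P w \<eta> = (\<lambda>x. if x \<in> active H P
     then (\<eta> x - (if x = w then degree H w else 0)) + chips H w x else 0)"

primrec fire_list ::
    "('v, 'e) mgraph \<Rightarrow> 'v set \<Rightarrow> 'v list \<Rightarrow> ('v \<Rightarrow> nat) \<Rightarrow> ('v \<Rightarrow> nat)" where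
  "fire_list H P [] \<eta> = \<eta>"
| "fire_list H P (w # ws) \<eta> = fire_list H P ws (fire H P w \<eta>)"

primrec legal :: "('v, 'e) mgraph \<Rightarrow> 'v set \<Rightarrow> 'v list \<Rightarrow> ('v \<Rightarrow> nat) \<Rightarrow> bool" where
  "legal H P [] \<eta> \<longleftrightarrow> True"
| "legal H P (w # ws) \<eta> \<longleftrightarrow>
     w \<in> active H P \<and> degree H w \<le> \<eta> w \<and> legal H P ws (fire H P w \<eta>)"

text \<open>The choice is harmless: a stabilizing sequence exists, and the resulting configuration and
  the number of firings of each vertex do not depend on it.\<close>

definition firing_sequence ::
    "('v, 'e) mgraph \<Rightarrow> 'v set \<Rightarrow> ('v \<Rightarrow> nat) \<Rightarrow> 'v list" where
  "firing_sequence H P \<eta> = (SOME ws. legal H P ws \<eta> \<and> stable H P (fire_list H P ws \<eta>))"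

definition stabilize :: "('v, 'e) mgraph \<Rightarrow> 'v set \<Rightarrow> ('v \<Rightarrow> nat) \<Rightarrow> ('v \<Rightarrow> nat)" where
  "stabilize H P \<eta> = fire_list H P (firing_sequence H P \<eta>) \<eta>"

definition add_chip :: "'v \<Rightarrow> ('v \<Rightarrow> nat) \<Rightarrow> ('v \<Rightarrow> nat)" where
  "add_chip w \<eta> = \<eta>(w := Suc (\<eta> w))"

definition Mav :: "('v, 'e) mgraph \<Rightarrow> 'v set \<Rightarrow> ('v \<Rightarrow> nat) \<Rightarrow> 'v \<Rightarrow> nat" where
  "Mav H P c v = card (set (firing_sequence H P (add_chip v c)))"

text \<open>\<open>hit_within K y n x\<close> is the probability that the Markov chain with kernel \<open>K\<close>,
  started in \<open>x\<close>, visits \<open>y\<close> at one of the times \<open>1, \<dots>, n\<close>.\<close>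

primrec hit_within :: "('s \<Rightarrow> 's pmf) \<Rightarrow> 's \<Rightarrow> nat \<Rightarrow> 's \<Rightarrow> real" where
  "hit_within K y 0 x = 0"
| "hit_within K y (Suc n) x =
     measure_pmf.expectation (K x) (\<lambda>z. if z = y then 1 else hit_within K y n z)"

definition recurrent_state :: "('s \<Rightarrow> 's pmf) \<Rightarrow> 's \<Rightarrow> bool" where
  "recurrent_state K y \<longleftrightarrow> (\<lambda>n. hit_within K y n y) \<longlonglongrightarrow> 1"

definition sandpile_chain ::
    "('v, 'e) mgraph \<Rightarrow> 'v set \<Rightarrow> 'v pmf \<Rightarrow> ('v \<Rightarrow> nat) \<Rightarrow> ('v \<Rightarrow> nat) pmf" where
  "sandpile_chain H P q c = map_pmf (\<lambda>w. stabilize H P (add_chip w c)) q"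

text \<open>The state space is finite, so recurrence does not depend on the
  distribution \<open>q\<close> of the added chip, as long as its support is the set of all non-dissipative
  vertices.\<close>

definition recurrent_configs :: "('v, 'e) mgraph \<Rightarrow> 'v set \<Rightarrow> ('v \<Rightarrow> nat) set" where
  "recurrent_configs H P = {c \<in> stable_configs H P.
     \<forall>q. set_pmf q = active H P \<longrightarrow> recurrent_state (sandpile_chain H P q) c}"

definition avalanche_prob :: "('v, 'e) mgraph \<Rightarrow> 'v set \<Rightarrow> 'v \<Rightarrow> nat \<Rightarrow> real" where
  "avalanche_prob H P v M =
     measure_pmf.prob (pmf_of_set (recurrent_configs H P)) {c. Mav H P c v = M}"

text \<open>A mass counts as realizable if it occurs in \<open>H n\<close> for arbitrarily large \<open>n\<close>. Occurrence in a
  single \<open>H n\<close> would be too weak a requirement: all non-dissipative vertices of \<open>H n\<close> may fire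
  merely because the single boundary vertex is dissipative, and this mass can have probability 0
  in all larger graphs.\<close>

definition realizable ::
    "(nat \<Rightarrow> ('v, 'e) mgraph) \<Rightarrow> (nat \<Rightarrow> 'v set) \<Rightarrow> 'v \<Rightarrow> nat \<Rightarrow> bool" where
  "realizable H P v M \<longleftrightarrow>
     (\<exists>\<^sub>F n in sequentially. \<exists>c\<in>recurrent_configs (H n) (P n). Mav (H n) (P n) c v = M)"

definition critical_with_exponent ::
    "(nat \<Rightarrow> ('v, 'e) mgraph) \<Rightarrow> (nat \<Rightarrow> 'v set) \<Rightarrow> 'v \<Rightarrow> real \<Rightarrow> bool" where
  "critical_with_exponent H P v \<delta> \<longleftrightarrow> \<delta> > 0 \<and>
     (\<exists>C1>0. \<exists>C2>0. \<forall>\<epsilon>>0. \<exists>M\<epsilon>\<ge>1. \<forall>M::nat. real M > M\<epsilon> \<and> realizable H P v M \<longrightarrow>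
        (\<exists>L. (\<lambda>n. avalanche_prob (H n) (P n) v M) \<longlonglongrightarrow> L \<and>
          C1 * real M powr (- \<delta> - \<epsilon>) \<le> L \<and> L \<le> C2 * real M powr (- \<delta> + \<epsilon>)))"

end

theory Submission
  imports Defs
begin

text \<open>
  A stable configuration is recurrent iff it has no forbidden subconfiguration, so a cycle block
  \<open>C j\<close> of the block-path carries, independently of the rest of the configuration, a uniformly
  distributed position: that of the only vertex of the cycle lacking two chips, or none. The
  odometer of an avalanche is the only integer function that leads from the configuration with the
  additional chip to a recurrent one, hence avalanches can be computed cycle by cycle. One that
  fires \<open>q i\<close> but not \<open>q (i + 1)\<close> needs the zero of \<open>C (i + 2)\<close> at \<open>q (i + 1)\<close>, and its mass
  determines the position of the zero of \<open>C (i + 1)\<close> up to two possibilities. Such a mass therefore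
  has probability at most \<open>2 / (|C (i + 1)| |C (i + 2)|)\<close>. Conversely, if a single chip leaves
  \<open>D (q i)\<close>, then a single chip leaves \<open>D (q (i + 1))\<close> with probability at least
  \<open>1 - 2 / |C (i + 1)|\<close>; convergence of the sum of the \<open>1 / |C j|\<close> makes the upper bound sharp up
  to a constant. Since \<open>|C j|\<close> is comparable to the diameter of \<open>D (q j)\<close>, it is \<open>d j\<close> to the
  power \<open>1 / \<alpha> + o(1)\<close>, and the mass lies between \<open>d i\<close> and \<open>d (i + 1)\<close>.
\<close>

section \<open>Forbidden subconfigurations\<close>

definition allowed :: "('v \<Rightarrow> 'v \<Rightarrow> nat) \<Rightarrow> 'v set \<Rightarrow> ('v \<Rightarrow> nat) \<Rightarrow> bool" where
  "allowed A T c \<longleftrightarrow> (\<forall>U\<subseteq>T. U \<noteq> {} \<longrightarrow> (\<exists>w\<in>U. (\<Sum>y\<in>U. A w y) \<le> c w))"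

lemma allowedD: "allowed A T c \<Longrightarrow> U \<subseteq> T \<Longrightarrow> U \<noteq> {} \<Longrightarrow> \<exists>w\<in>U. (\<Sum>y\<in>U. A w y) \<le> c w"
  by (auto simp: allowed_def)

lemma allowed_subset: "allowed A T c \<Longrightarrow> T' \<subseteq> T \<Longrightarrow> allowed A T' c"
  unfolding allowed_def by blast

lemma allowed_mono:
  assumes "allowed A T c" "\<And>x. x \<in> T \<Longrightarrow> c x \<le> c' x"
  shows "allowed A T c'"
  using assms unfolding allowed_def by (meson order_trans subsetD)

lemma allowed_cong:
  assumes "\<And>x. x \<in> T \<Longrightarrow> c x = c' x" "\<And>x y. x \<in> T \<Longrightarrow> y \<in> T \<Longrightarrow> A x y = A' x y"
  shows "allowed A T c \<longleftrightarrow> allowed A' T c'"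
proof -
  have "(\<Sum>y\<in>U. A w y) = (\<Sum>y\<in>U. A' w y)" if "U \<subseteq> T" "w \<in> U" for U w
    using that assms(2) by (intro sum.cong) auto
  moreover have "c w = c' w" if "U \<subseteq> T" "w \<in> U" for U w using that assms(1) by auto
  ultimately show ?thesis unfolding allowed_def by (smt (verit, best))
qed

text \<open>The set where \<open>h\<close> is maximal would be a forbidden subconfiguration of \<open>c'\<close>.\<close>

lemma harmonic_upper_bound:
  fixes h :: "'v \<Rightarrow> int"
  assumes fin: "finite V" and TV: "T \<subseteq> V"
    and st: "\<And>x. x \<in> T \<Longrightarrow> c x < (\<Sum>y\<in>V. A x y)"
    and al: "allowed A T c'"
    and eq: "\<And>x. x \<in> T \<Longrightarrow> int (c' x) = int (c x) + (\<Sum>y\<in>V. int (A x y) * (h y - h x))"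
    and bd: "\<And>x y. x \<in> T \<Longrightarrow> y \<in> V - T \<Longrightarrow> A x y > 0 \<Longrightarrow> h y \<le> K"
    and x: "x \<in> T"
  shows "h x \<le> K"
proof (rule ccontr)
  assume "\<not> h x \<le> K"
  have finT: "finite T" using fin TV finite_subset by blast
  define M where "M = Max (h ` T)"
  have M: "h y \<le> M" if "y \<in> T" for y using that finT by (auto simp: M_def)
  have MK: "M > K" using M[OF x] \<open>\<not> h x \<le> K\<close> by linarith
  define U where "U = {y \<in> T. h y = M}"
  have "M \<in> h ` T" unfolding M_def using finT x by (intro Max_in) auto
  hence "U \<noteq> {}" by (auto simp: U_def)
  moreover have UT: "U \<subseteq> T" by (auto simp: U_def)
  ultimately obtain w where w: "w \<in> U" "(\<Sum>y\<in>U. A w y) \<le> c' w"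
    using allowedD[OF al] by blast
  have wT: "w \<in> T" "h w = M" using w by (auto simp: U_def)
  have "(\<Sum>y\<in>V. int (A w y) * (h y - h w)) \<le> (\<Sum>y\<in>V. - (if y \<in> U then 0 else int (A w y)))"
  proof (rule sum_mono)
    fix y assume y: "y \<in> V"
    show "int (A w y) * (h y - h w) \<le> - (if y \<in> U then 0 else int (A w y))"
    proof (cases "y \<in> U \<or> A w y = 0")
      case True thus ?thesis using wT by (auto simp: U_def)
    next
      case False
      have "h y \<le> M - 1"
      proof (cases "y \<in> T")
        case True thus ?thesis using M[of y] False by (auto simp: U_def)
      next
        case F: False thus ?thesis using bd[OF wT(1), of y] y False MK by auto
      qed
      hence "int (A w y) * (h y - h w) \<le> int (A w y) * (- 1)"
        using wT by (intro mult_left_mono) auto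
      thus ?thesis using False by simp
    qed
  qed
  also have "\<dots> = - ((\<Sum>y\<in>V. int (A w y)) - (\<Sum>y\<in>U. int (A w y)))"
  proof -
    have "(\<Sum>y\<in>V. if y \<in> U then 0 else int (A w y)) = (\<Sum>y\<in>V - U. int (A w y))"
      by (intro sum.mono_neutral_cong_right) (use fin in auto)
    also have "\<dots> = (\<Sum>y\<in>V. int (A w y)) - (\<Sum>y\<in>U. int (A w y))"
      using fin UT TV by (intro sum_diff) auto
    finally show ?thesis by (simp add: sum_negf)
  qed
  finally have "int (c' w) < (\<Sum>y\<in>U. int (A w y))"
    using eq[OF wT(1)] st[OF wT(1)] by (simp flip: of_nat_sum)
  thus False using w(2) by (simp flip: of_nat_sum)
qed

lemma harmonic_const:
  fixes h :: "'v \<Rightarrow> int"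
  assumes fin: "finite V" and TV: "T \<subseteq> V"
    and st: "\<And>x. x \<in> T \<Longrightarrow> c x < (\<Sum>y\<in>V. A x y)" "\<And>x. x \<in> T \<Longrightarrow> c' x < (\<Sum>y\<in>V. A x y)"
    and al: "allowed A T c" "allowed A T c'"
    and eq: "\<And>x. x \<in> T \<Longrightarrow> int (c' x) = int (c x) + (\<Sum>y\<in>V. int (A x y) * (h y - h x))"
    and bd: "\<And>x y. x \<in> T \<Longrightarrow> y \<in> V - T \<Longrightarrow> A x y > 0 \<Longrightarrow> h y = K"
    and x: "x \<in> T"
  shows "h x = K"
proof (rule antisym)
  show "h x \<le> K"
    by (rule harmonic_upper_bound[OF fin TV st(1) al(2) eq _ x]) (use bd in auto)
  have eq': "int (c x) = int (c' x) + (\<Sum>y\<in>V. int (A x y) * ((- h y) - (- h x)))" if "x \<in> T" for x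
  proof -
    have "(\<Sum>y\<in>V. int (A x y) * ((- h y) - (- h x))) = - (\<Sum>y\<in>V. int (A x y) * (h y - h x))"
      unfolding sum_negf[symmetric] by (intro sum.cong) (auto simp: algebra_simps)
    thus ?thesis using eq[OF that] by simp
  qed
  have "- h x \<le> - K"
    by (rule harmonic_upper_bound[of V T c' A c "\<lambda>x. - h x", OF fin TV st(2) al(1) eq' _ x]) (use bd in auto)
  thus "K \<le> h x" by simp
qed

text \<open>\<open>T1\<close> communicates with \<open>T2\<close> only through \<open>q\<close>. In \<open>T2\<close> the whole of \<open>T1\<close> counts as part of
  every subset, so the condition on \<open>T2\<close> does not involve the values of \<open>c\<close> on \<open>T1\<close>.\<close>

lemma allowed_split:
  assumes fin: "finite T1" "finite T2"
    and sym: "\<And>x y. A x y = A y x"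
    and cut: "\<And>x y. x \<in> T1 \<Longrightarrow> y \<in> T2 \<Longrightarrow> A x y > 0 \<Longrightarrow> y = q"
    and st: "\<And>x. q \<in> T2 \<Longrightarrow> x \<in> T1 \<Longrightarrow> c x < (\<Sum>y\<in>insert q T1. A x y)"
  shows "allowed A (T1 \<union> T2) c \<longleftrightarrow> allowed A T1 c \<and>
     (\<forall>U\<subseteq>T2. U \<noteq> {} \<longrightarrow> (\<exists>w\<in>U. (\<Sum>y\<in>U \<union> T1. A w y) \<le> c w))" (is "?L \<longleftrightarrow> _ \<and> ?R")
proof (intro iffI conjI allI impI)
  assume L: ?L
  thus "allowed A T1 c" by (rule allowed_subset) auto
  fix U assume U: "U \<subseteq> T2" "U \<noteq> {}"
  have finU: "finite U" using U fin finite_subset by blast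
  show "\<exists>w\<in>U. (\<Sum>y\<in>U \<union> T1. A w y) \<le> c w"
  proof (cases "q \<in> U")
    case True
    obtain w where w: "w \<in> U \<union> T1" "(\<Sum>y\<in>U \<union> T1. A w y) \<le> c w"
      using allowedD[OF L, of "U \<union> T1"] U by blast
    have "w \<notin> T1"
    proof
      assume "w \<in> T1"
      hence "c w < (\<Sum>y\<in>insert q T1. A w y)" using st U True by auto
      also have "\<dots> \<le> (\<Sum>y\<in>U \<union> T1. A w y)" using True finU fin by (intro sum_mono2) auto
      finally show False using w by simp
    qed
    thus ?thesis using w by auto
  next
    case False
    obtain w where w: "w \<in> U" "(\<Sum>y\<in>U. A w y) \<le> c w" using allowedD[OF L, of U] U by blast
    have "A w y = 0" if "y \<in> T1" for y
      using cut[OF that, of w] sym[of w y] w U False that by (metis gr0I subsetD)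
    hence "(\<Sum>y\<in>U \<union> T1. A w y) = (\<Sum>y\<in>U. A w y)"
      using finU fin by (intro sum.mono_neutral_right) auto
    thus ?thesis using w by (intro bexI[of _ w]) auto
  qed
next
  assume R: "allowed A T1 c \<and> ?R"
  show ?L unfolding allowed_def
  proof (intro allI impI)
    fix U assume U: "U \<subseteq> T1 \<union> T2" "U \<noteq> {}"
    have finU: "finite U" using U fin finite_subset by blast
    show "\<exists>w\<in>U. (\<Sum>y\<in>U. A w y) \<le> c w"
    proof (cases "U \<inter> T2 = {}")
      case True
      hence "U \<subseteq> T1" using U by auto
      thus ?thesis using allowedD[of A T1 c U] R U by blast
    next
      case False
      then obtain w where w: "w \<in> U \<inter> T2" "(\<Sum>y\<in>(U \<inter> T2) \<union> T1. A w y) \<le> c w"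
        using R[THEN conjunct2, rule_format, of "U \<inter> T2"] by auto
      have "(\<Sum>y\<in>U. A w y) \<le> (\<Sum>y\<in>(U \<inter> T2) \<union> T1. A w y)"
        using U finU fin by (intro sum_mono2) auto
      thus ?thesis using w by (intro bexI[of _ w]) auto
    qed
  qed
qed

lemma allowed_glue:
  assumes fin: "finite T1" "finite T2"
    and sym: "\<And>x y. A x y = A y x"
    and cut: "\<And>x y. x \<in> T1 \<Longrightarrow> y \<in> T2 \<Longrightarrow> A x y > 0 \<Longrightarrow> y = q"
    and st: "\<And>x. q \<in> T2 \<Longrightarrow> x \<in> T1 \<Longrightarrow> c x < (\<Sum>y\<in>insert q T1. A x y)"
      "\<And>x. q \<in> T2 \<Longrightarrow> x \<in> T1 \<Longrightarrow> c' x < (\<Sum>y\<in>insert q T1. A x y)"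
    and al: "allowed A (T1 \<union> T2) c" "allowed A T1 c'"
    and eq: "\<And>x. x \<in> T2 \<Longrightarrow> c' x = c x"
  shows "allowed A (T1 \<union> T2) c'"
proof -
  have s: "allowed A (T1 \<union> T2) c \<longleftrightarrow> allowed A T1 c \<and>
     (\<forall>U\<subseteq>T2. U \<noteq> {} \<longrightarrow> (\<exists>w\<in>U. (\<Sum>y\<in>U \<union> T1. A w y) \<le> c w))"
    by (rule allowed_split[where q = q]) (fact fin sym cut st)+
  have s': "allowed A (T1 \<union> T2) c' \<longleftrightarrow> allowed A T1 c' \<and>
     (\<forall>U\<subseteq>T2. U \<noteq> {} \<longrightarrow> (\<exists>w\<in>U. (\<Sum>y\<in>U \<union> T1. A w y) \<le> c' w))"
    by (rule allowed_split[where q = q]) (fact fin sym cut st)+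
  have "\<forall>U\<subseteq>T2. U \<noteq> {} \<longrightarrow> (\<exists>w\<in>U. (\<Sum>y\<in>U \<union> T1. A w y) \<le> c' w)"
  proof (intro allI impI)
    fix U assume U: "U \<subseteq> T2" "U \<noteq> {}"
    then obtain w where w: "w \<in> U" "(\<Sum>y\<in>U \<union> T1. A w y) \<le> c w" using s al(1) by blast
    thus "\<exists>w\<in>U. (\<Sum>y\<in>U \<union> T1. A w y) \<le> c' w" using eq[of w] U by (intro bexI[of _ w]) auto
  qed
  thus ?thesis using s' al(2) by blast
qed

section \<open>Firing and stabilization\<close>

lemma chips_sym: "chips H x y = chips H y x"
  unfolding chips_def by (auto simp: insert_commute)

lemma degree_eq_sum_chips:
  assumes wf: "wf_mgraph H" and fin: "finite_mgraph H" and x: "x \<in> verts H"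
  shows "degree H x = (\<Sum>y\<in>verts H. chips H x y)"
proof -
  have finV: "finite (verts H)" and finE: "finite (edges H)" using fin by (auto simp: finite_mgraph_def)
  let ?E = "\<lambda>y. {e \<in> edges H. ends H e = {x, y}}"
  have inc: "{e \<in> edges H. x \<in> ends H e} = (\<Union>y\<in>verts H. ?E y)"
  proof (intro equalityI subsetI)
    fix e assume "e \<in> {e \<in> edges H. x \<in> ends H e}"
    hence e: "e \<in> edges H" "x \<in> ends H e" "ends H e \<subseteq> verts H" "card (ends H e) \<in> {1, 2}"
      using wf by (auto simp: wf_mgraph_def)
    have "\<exists>y\<in>verts H. ends H e = {x, y}"
    proof (cases "card (ends H e) = 1")
      case True thus ?thesis using e x by (metis card_1_singletonE insert_absorb2 singletonD)
    next
      case False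
      hence "card (ends H e) = 2" using e by auto
      then obtain a b where "ends H e = {a, b}" by (meson card_2_iff)
      thus ?thesis using e by (metis insert_commute insert_iff insert_subset singletonD)
    qed
    thus "e \<in> (\<Union>y\<in>verts H. ?E y)" using e by auto
  qed auto
  have "card (\<Union>y\<in>verts H. ?E y) = (\<Sum>y\<in>verts H. card (?E y))"
    using finV finE by (intro card_UN_disjoint) (auto simp: doubleton_eq_iff)
  hence "degree H x = (\<Sum>y\<in>verts H. card (?E y)) + card (?E x)"
    by (simp add: degree_def inc)
  also have "\<dots> = (\<Sum>y\<in>verts H - {x}. card (?E y)) + 2 * card (?E x)"
    using finV x by (simp add: sum.remove)
  also have "\<dots> = (\<Sum>y\<in>verts H. chips H x y)"
    using finV x by (simp add: sum.remove chips_def)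
  finally show ?thesis .
qed

locale sandpile =
  fixes H :: "('v, 'e) mgraph" and p :: 'v
  assumes wf: "wf_mgraph H" and fin: "finite_mgraph H" and conn: "connected_mgraph H"
    and p: "p \<in> verts H" and nontrivial: "\<exists>x\<in>verts H. x \<noteq> p"
begin

abbreviation "V \<equiv> verts H"
abbreviation "V0 \<equiv> active H {p}"
abbreviation "A \<equiv> chips H"
abbreviation "d \<equiv> degree H"

lemma V0_eq: "V0 = V - {p}" by (simp add: active_def)

lemma finV [simp]: "finite V" using fin by (simp add: finite_mgraph_def)
lemma finV0 [simp]: "finite V0" by (simp add: V0_eq)
lemma V0_ne: "V0 \<noteq> {}" using nontrivial by (auto simp: V0_eq)

lemma d_eq: "x \<in> V \<Longrightarrow> d x = (\<Sum>y\<in>V. A x y)" using degree_eq_sum_chips wf fin by metis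

lemma adjacent_iff: "adjacent H x y \<longleftrightarrow> A x y > 0"
proof -
  have "finite {e \<in> edges H. ends H e = {x, y}}" using fin by (auto simp: finite_mgraph_def)
  thus ?thesis by (auto simp: adjacent_def chips_def card_gt_0_iff)
qed

lemma exists_boundary_edge:
  assumes "U \<subseteq> V0" "U \<noteq> {}" shows "\<exists>x\<in>U. \<exists>y\<in>V - U. A x y > 0"
proof (rule ccontr)
  assume neg: "\<not> ?thesis"
  obtain x where x: "x \<in> U" using assms by auto
  have "(adjacent H)\<^sup>*\<^sup>* x p" using conn x assms p by (auto simp: connected_mgraph_def V0_eq)
  hence "p \<in> U"
  proof (induction rule: rtranclp_induct)
    case (step y z)
    have "z \<in> V" using step(2) wf by (auto simp: adjacent_def wf_mgraph_def)
    thus ?case using step neg adjacent_iff by blast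
  qed (use x in auto)
  thus False using assms by (auto simp: V0_eq)
qed

lemma allowed_max: "allowed A V0 (\<lambda>x. d x - 1)"
  unfolding allowed_def
proof (intro allI impI)
  fix U assume U: "U \<subseteq> V0" "U \<noteq> {}"
  obtain x y where xy: "x \<in> U" "y \<in> V - U" "A x y > 0" using exists_boundary_edge[OF U] by blast
  have finU: "finite U" using U finV0 finite_subset by blast
  have "(\<Sum>y\<in>U. A x y) + A x y = (\<Sum>y\<in>insert y U. A x y)" using xy finU by simp
  also have "\<dots> \<le> (\<Sum>y\<in>V. A x y)" using xy U by (intro sum_mono2) (auto simp: V0_eq)
  also have "\<dots> = d x" using xy U by (subst d_eq) (auto simp: V0_eq)
  finally show "\<exists>w\<in>U. (\<Sum>y\<in>U. A w y) \<le> d w - 1" using xy by (intro bexI[of _ x]) auto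
qed

lemma d_pos: assumes "x \<in> V0" shows "d x > 0"
proof -
  obtain y where "y \<in> V - {x}" "A x y > 0" using exists_boundary_edge[of "{x}"] assms by auto
  moreover have "A x y \<le> (\<Sum>y\<in>V. A x y)" using calculation by (intro member_le_sum) auto
  ultimately show ?thesis using d_eq[of x] assms by (simp add: V0_eq)
qed

lemma fire_eq:
  assumes "w \<in> V0" "d w \<le> \<eta> w" "x \<in> V0"
  shows "int (fire H {p} w \<eta> x) = int (\<eta> x) - (if x = w then int (d w) else 0) + int (A w x)"
  using assms by (auto simp: fire_def)

lemma fire_outside: "x \<notin> V0 \<Longrightarrow> fire H {p} w \<eta> x = 0" by (simp add: fire_def)

lemma legal_snoc: "legal H P (ws @ [w]) \<eta> \<longleftrightarrow>
    legal H P ws \<eta> \<and> w \<in> active H P \<and> degree H w \<le> fire_list H P ws \<eta> w"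
  by (induction ws arbitrary: \<eta>) auto

lemma fire_list_eq:
  assumes "legal H {p} ws \<eta>" "x \<in> V0"
  shows "int (fire_list H {p} ws \<eta> x) =
    int (\<eta> x) + (\<Sum>y\<in>V. int (A x y) * (int (count_list ws y) - int (count_list ws x)))"
  using assms(1)
proof (induction ws arbitrary: \<eta>)
  case (Cons w ws)
  have w: "w \<in> V0" "d w \<le> \<eta> w" "legal H {p} ws (fire H {p} w \<eta>)" using Cons by auto
  have "(\<Sum>y\<in>V. int (A x y) * (int (count_list (w # ws) y) - int (count_list (w # ws) x))) =
     (\<Sum>y\<in>V. int (A x y) * (int (count_list ws y) - int (count_list ws x))
       + (if y = w then int (A x y) else 0) - (if x = w then int (A x y) else 0))"
    by (intro sum.cong) (auto simp: algebra_simps)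
  also have "\<dots> = (\<Sum>y\<in>V. int (A x y) * (int (count_list ws y) - int (count_list ws x)))
       + int (A x w) - (if x = w then int (d x) else 0)"
    using w(1) assms(2) by (simp add: sum.distrib sum_subtractf V0_eq d_eq)
  finally show ?case using Cons.IH[OF w(3)] fire_eq[where w = w and \<eta> = \<eta> and x = x, OF w(1,2) assms(2)]
    by (simp add: chips_sym[of H w x] del: count_list.simps)
qed auto

lemma fire_list_outside: "\<forall>x. x \<notin> V0 \<longrightarrow> \<eta> x = 0 \<Longrightarrow> x \<notin> V0 \<Longrightarrow> fire_list H {p} ws \<eta> x = 0"
  by (induction ws arbitrary: \<eta>) (auto simp: fire_outside)

lemma legal_active: "legal H {p} ws \<eta> \<Longrightarrow> set ws \<subseteq> V0"
  by (induction ws arbitrary: \<eta>) auto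

lemma allowed_fire:
  assumes "allowed A V0 \<eta>" "w \<in> V0" "d w \<le> \<eta> w"
  shows "allowed A V0 (fire H {p} w \<eta>)"
  unfolding allowed_def
proof (intro allI impI)
  fix U assume U: "U \<subseteq> V0" "U \<noteq> {}"
  have finU: "finite U" using U finV0 finite_subset by blast
  have fe: "fire H {p} w \<eta> x = \<eta> x + A w x" if "x \<in> V0" "x \<noteq> w" for x
    using that by (simp add: fire_def)
  have fw: "A w w \<le> fire H {p} w \<eta> w" using assms by (simp add: fire_def)
  show "\<exists>x\<in>U. (\<Sum>y\<in>U. A x y) \<le> fire H {p} w \<eta> x"
  proof (cases "U - {w} = {}")
    case True
    hence "U = {w}" using U by auto
    thus ?thesis using fw by auto
  next
    case False
    obtain x where x: "x \<in> U - {w}" "(\<Sum>y\<in>U - {w}. A x y) \<le> \<eta> x"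
      using allowedD[OF assms(1), of "U - {w}"] U False by blast
    have "(\<Sum>y\<in>U. A x y) \<le> (\<Sum>y\<in>U - {w}. A x y) + A x w"
      using finU by (cases "w \<in> U") (auto simp: sum.remove[of U w])
    also have "\<dots> \<le> fire H {p} w \<eta> x" using x fe[of x] U chips_sym[of H x w] by auto
    finally show ?thesis using x by auto
  qed
qed

lemma allowed_fire_list:
  "allowed A V0 \<eta> \<Longrightarrow> legal H {p} ws \<eta> \<Longrightarrow> allowed A V0 (fire_list H {p} ws \<eta>)"
  by (induction ws arbitrary: \<eta>) (auto simp: allowed_fire)

end

lemma funpow_cancel:
  assumes "inj_on f S" "\<And>n. (f ^^ n) c \<in> S" "(f ^^ m) c = (f ^^ (m + k)) c"
  shows "(f ^^ k) c = c"
  using assms(3)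
proof (induction m)
  case (Suc m)
  have "f ((f ^^ m) c) = f ((f ^^ (m + k)) c)" using Suc.prems by simp
  hence "(f ^^ m) c = (f ^^ (m + k)) c" using inj_onD[OF assms(1)] assms(2) by blast
  thus ?case by (rule Suc.IH)
qed (metis add_0 funpow_0)

context sandpile begin

definition recurrents :: "('v \<Rightarrow> nat) set" where
  "recurrents = {c. (\<forall>x. x \<notin> V0 \<longrightarrow> c x = 0) \<and> (\<forall>x\<in>V0. c x < d x) \<and> allowed A V0 c}"

lemma fire_list_total:
  assumes "legal H {p} ws \<eta>"
  shows "(\<Sum>x\<in>V0. fire_list H {p} ws \<eta> x) + (\<Sum>y\<in>V. A p y * count_list ws y) = (\<Sum>x\<in>V0. \<eta> x)"
proof -
  let ?u = "\<lambda>x. int (count_list ws x)"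
  let ?L = "\<lambda>x. \<Sum>y\<in>V. int (A x y) * (?u y - ?u x)"
  have "p \<notin> set ws" using legal_active[OF assms] by (auto simp: V0_eq)
  hence up: "?u p = 0" by simp
  have "(\<Sum>x\<in>V. ?L x) = (\<Sum>x\<in>V. \<Sum>y\<in>V. int (A x y) * ?u y) - (\<Sum>x\<in>V. \<Sum>y\<in>V. int (A x y) * ?u x)"
    by (simp add: right_diff_distrib sum_subtractf)
  also have "(\<Sum>x\<in>V. \<Sum>y\<in>V. int (A x y) * ?u x) = (\<Sum>y\<in>V. \<Sum>x\<in>V. int (A x y) * ?u x)"
    by (rule sum.swap)
  also have "\<dots> = (\<Sum>x\<in>V. \<Sum>y\<in>V. int (A x y) * ?u y)" by (simp add: chips_sym)
  finally have "(\<Sum>x\<in>V. ?L x) = 0" by simp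
  moreover have "(\<Sum>x\<in>V. ?L x) = ?L p + (\<Sum>x\<in>V0. ?L x)"
    using sum.remove[OF finV p, of ?L] by (simp add: V0_eq)
  moreover have "(\<Sum>x\<in>V0. int (fire_list H {p} ws \<eta> x)) = (\<Sum>x\<in>V0. int (\<eta> x)) + (\<Sum>x\<in>V0. ?L x)"
    using fire_list_eq[OF assms] by (simp add: sum.distrib)
  moreover have "?L p = (\<Sum>y\<in>V. int (A p y) * ?u y)" using up by simp
  ultimately have "int ((\<Sum>x\<in>V0. fire_list H {p} ws \<eta> x) + (\<Sum>y\<in>V. A p y * count_list ws y)) =
     int (\<Sum>x\<in>V0. \<eta> x)" by simp
  thus ?thesis by linarith
qed

lemma firings_bounded: "\<exists>b. \<forall>ws. legal H {p} ws \<eta> \<longrightarrow> length ws \<le> b"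
proof -
  define S where "S = (\<Sum>x\<in>V0. \<eta> x)"
  define U where "U = {x \<in> V0. \<not> (\<exists>b. \<forall>ws. legal H {p} ws \<eta> \<longrightarrow> count_list ws x \<le> b)}"
  have "U = {}"
  proof (rule ccontr)
    assume "U \<noteq> {}"
    then obtain x y where xy: "x \<in> U" "y \<in> V - U" "A x y > 0"
      using exists_boundary_edge[of U] unfolding U_def by blast
    have "\<exists>b. \<forall>ws. legal H {p} ws \<eta> \<longrightarrow> count_list ws x \<le> b"
    proof (cases "y = p")
      case True
      have "count_list ws x \<le> S" if "legal H {p} ws \<eta>" for ws
      proof -
        have "count_list ws x \<le> A p x * count_list ws x"
          using xy True chips_sym[of H p x] by simp
        also have "\<dots> \<le> (\<Sum>y\<in>V. A p y * count_list ws y)"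
          using xy by (intro member_le_sum) (auto simp: U_def V0_eq)
        finally show ?thesis using fire_list_total[OF that] by (simp add: S_def)
      qed
      thus ?thesis by blast
    next
      case False
      hence y: "y \<in> V0" using xy by (auto simp: V0_eq)
      then obtain b where b: "\<And>ws. legal H {p} ws \<eta> \<Longrightarrow> count_list ws y \<le> b"
        using xy by (auto simp: U_def)
      have "count_list ws x \<le> S + d y * b" if "legal H {p} ws \<eta>" for ws
      proof -
        let ?u = "\<lambda>x. int (count_list ws x)"
        have "(\<Sum>z\<in>V. int (A y z) * (?u z - ?u y)) = (\<Sum>z\<in>V. int (A y z) * ?u z) - int (d y) * ?u y"
          using y by (simp add: right_diff_distrib sum_subtractf V0_eq d_eq sum_distrib_right)
        hence "(\<Sum>z\<in>V. int (A y z) * ?u z) \<le> int (fire_list H {p} ws \<eta> y) + int (d y) * ?u y"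
          using fire_list_eq[OF that y] by simp
        also have "fire_list H {p} ws \<eta> y \<le> (\<Sum>x\<in>V0. fire_list H {p} ws \<eta> x)"
          using y by (intro member_le_sum) auto
        hence "fire_list H {p} ws \<eta> y \<le> S"
          using fire_list_total[OF that] unfolding S_def by linarith
        hence "int (fire_list H {p} ws \<eta> y) \<le> int S" by simp
        also have "int (d y) * ?u y \<le> int (d y) * int b" using b[OF that] by (intro mult_left_mono) auto
        finally have "(\<Sum>z\<in>V. int (A y z) * ?u z) \<le> int S + int (d y) * int b" by simp
        moreover have "int (A y x) * ?u x \<le> (\<Sum>z\<in>V. int (A y z) * ?u z)"
          using xy by (intro member_le_sum) (auto simp: U_def V0_eq)
        moreover have "1 * ?u x \<le> int (A y x) * ?u x"
          using xy chips_sym[of H x y] by (intro mult_right_mono) auto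
        ultimately have "?u x \<le> int (S + d y * b)" by simp
        thus ?thesis by linarith
      qed
      thus ?thesis by blast
    qed
    thus False using xy unfolding U_def by blast
  qed
  hence "\<forall>x\<in>V0. \<exists>b. \<forall>ws. legal H {p} ws \<eta> \<longrightarrow> count_list ws x \<le> b" by (auto simp: U_def)
  then obtain b where b: "\<And>x ws. x \<in> V0 \<Longrightarrow> legal H {p} ws \<eta> \<Longrightarrow> count_list ws x \<le> b x" by metis
  have "length ws \<le> (\<Sum>x\<in>V0. b x)" if "legal H {p} ws \<eta>" for ws
  proof -
    have "length ws = (\<Sum>x\<in>V0. count_list ws x)"
      using sum_count_set[OF legal_active[OF that]] by simp
    also have "\<dots> \<le> (\<Sum>x\<in>V0. b x)" using b that by (intro sum_mono) auto
    finally show ?thesis .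
  qed
  thus ?thesis by blast
qed

lemma stabilizable: "\<exists>ws. legal H {p} ws \<eta> \<and> stable H {p} (fire_list H {p} ws \<eta>)"
proof -
  obtain b where b: "\<And>ws. legal H {p} ws \<eta> \<Longrightarrow> length ws \<le> b" using firings_bounded by blast
  have "legal H {p} [] \<eta>" by simp
  then obtain ws where ws: "legal H {p} ws \<eta>"
    and mx: "\<And>ws'. legal H {p} ws' \<eta> \<Longrightarrow> length ws' \<le> length ws"
    using ex_has_greatest_nat[of "\<lambda>ws. legal H {p} ws \<eta>" "[]" length "Suc b"] b by (meson le_imp_less_Suc)
  have "stable H {p} (fire_list H {p} ws \<eta>)"
    unfolding stable_def
  proof (rule ballI, rule ccontr)
    fix w assume "w \<in> V0" "\<not> fire_list H {p} ws \<eta> w < d w"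
    hence "legal H {p} (ws @ [w]) \<eta>" using ws legal_snoc by auto
    thus False using mx by fastforce
  qed
  thus ?thesis using ws by blast
qed

lemma firing_sequence:
  "legal H {p} (firing_sequence H {p} \<eta>) \<eta>"
  "stable H {p} (fire_list H {p} (firing_sequence H {p} \<eta>) \<eta>)"
  using someI_ex[OF stabilizable[of \<eta>]] by (auto simp: firing_sequence_def)

lemma stabilize_stable:
  assumes "stable H {p} \<eta>" shows "stabilize H {p} \<eta> = \<eta>"
proof -
  have "firing_sequence H {p} \<eta> = []"
    using firing_sequence(1)[of \<eta>] assms by (cases "firing_sequence H {p} \<eta>") (auto simp: stable_def not_less)
  thus ?thesis by (simp add: stabilize_def)
qed

lemma stabilize_outside: "\<forall>x. x \<notin> V0 \<longrightarrow> \<eta> x = 0 \<Longrightarrow> x \<notin> V0 \<Longrightarrow> stabilize H {p} \<eta> x = 0"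
  by (simp add: stabilize_def fire_list_outside)

definition odo :: "'v \<Rightarrow> ('v \<Rightarrow> nat) \<Rightarrow> 'v \<Rightarrow> nat" where
  "odo v c = count_list (firing_sequence H {p} (add_chip v c))"

abbreviation "stab v c \<equiv> stabilize H {p} (add_chip v c)"

lemma odo_outside: "x \<notin> V0 \<Longrightarrow> odo v c x = 0"
  using legal_active[OF firing_sequence(1)] by (auto simp: odo_def count_list_0_iff)

lemma Mav_eq: "Mav H {p} c v = card {x \<in> V. odo v c x > 0}"
proof -
  have "set (firing_sequence H {p} (add_chip v c)) = {x \<in> V. odo v c x > 0}"
    using legal_active[OF firing_sequence(1)]
    by (auto simp: odo_def V0_eq count_list_0_iff simp flip: neq0_conv)
  thus ?thesis by (simp add: Mav_def)
qed

lemma stab_eq: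
  assumes "x \<in> V0"
  shows "int (stab v c x) = int (c x) + (if x = v then 1 else 0)
    + (\<Sum>y\<in>V. int (A x y) * (int (odo v c y) - int (odo v c x)))"
proof -
  have "int (add_chip v c x) = int (c x) + (if x = v then 1 else 0)" by (simp add: add_chip_def)
  thus ?thesis
    using fire_list_eq[OF firing_sequence(1) assms, of "add_chip v c"]
    unfolding stabilize_def odo_def by presburger
qed

lemma recD: "c \<in> recurrents \<Longrightarrow> allowed A V0 c" "c \<in> recurrents \<Longrightarrow> x \<in> V0 \<Longrightarrow> c x < (\<Sum>y\<in>V. A x y)"
  "c \<in> recurrents \<Longrightarrow> x \<in> V0 \<Longrightarrow> c x < d x" "c \<in> recurrents \<Longrightarrow> x \<notin> V0 \<Longrightarrow> c x = 0"
  using d_eq by (auto simp: recurrents_def V0_eq)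

lemma stab_rec:
  assumes "c \<in> recurrents" "v \<in> V0" shows "stab v c \<in> recurrents"
proof -
  have "allowed A V0 (add_chip v c)"
    using recD(1)[OF assms(1)] by (rule allowed_mono) (auto simp: add_chip_def)
  hence "allowed A V0 (stab v c)"
    unfolding stabilize_def by (rule allowed_fire_list[OF _ firing_sequence(1)])
  moreover have "\<forall>x. x \<notin> V0 \<longrightarrow> add_chip v c x = 0" using assms by (auto simp: add_chip_def recD)
  ultimately show ?thesis
    using firing_sequence(2)[of "add_chip v c"] stabilize_outside[of "add_chip v c"]
    by (auto simp: recurrents_def stable_def stabilize_def)
qed

lemma odo_unique:
  assumes c: "c \<in> recurrents" and v: "v \<in> V0" and c': "c' \<in> recurrents"
    and h: "\<And>x. x \<notin> V0 \<Longrightarrow> x \<in> V \<Longrightarrow> h x = 0"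
    and eq: "\<And>x. x \<in> V0 \<Longrightarrow> int (c' x) = int (c x) + (if x = v then 1 else 0)
      + (\<Sum>y\<in>V. int (A x y) * (h y - h x))"
    and x: "x \<in> V"
  shows "int (odo v c x) = h x"
proof (cases "x \<in> V0")
  case True
  have "int (odo v c x) - h x = 0"
  proof (rule harmonic_const[of V V0 c' A "stab v c" "\<lambda>x. int (odo v c x) - h x"])
    fix x assume x: "x \<in> V0"
    have "(\<Sum>y\<in>V. int (A x y) * (int (odo v c y) - h y - (int (odo v c x) - h x))) =
       (\<Sum>y\<in>V. int (A x y) * (int (odo v c y) - int (odo v c x))) - (\<Sum>y\<in>V. int (A x y) * (h y - h x))"
      by (simp add: algebra_simps sum_subtractf sum.distrib)
    thus "int (stab v c x) = int (c' x) + (\<Sum>y\<in>V. int (A x y) * (int (odo v c y) - h y - (int (odo v c x) - h x)))"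
      using eq[OF x] stab_eq[OF x, of v c] by simp
  qed (use recD c' stab_rec[OF c v] True h odo_outside in \<open>auto simp: V0_eq\<close>)
  thus ?thesis by simp
next
  case False thus ?thesis using h odo_outside x by simp
qed

lemma stab_inj_on: assumes v: "v \<in> V0" shows "inj_on (stab v) recurrents"
proof (rule inj_onI)
  fix c c' assume c: "c \<in> recurrents" and c': "c' \<in> recurrents" and e: "stab v c = stab v c'"
  define h where "h x = int (odo v c' x) - int (odo v c x)" for x
  have eq: "int (c x) = int (c' x) + (\<Sum>y\<in>V. int (A x y) * (h y - h x))" if "x \<in> V0" for x
  proof -
    have "(\<Sum>y\<in>V. int (A x y) * (h y - h x)) =
       (\<Sum>y\<in>V. int (A x y) * (int (odo v c' y) - int (odo v c' x)))
        - (\<Sum>y\<in>V. int (A x y) * (int (odo v c y) - int (odo v c x)))"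
      by (simp add: algebra_simps sum_subtractf sum.distrib h_def)
    thus ?thesis using stab_eq[OF that, of v c] stab_eq[OF that, of v c'] e by simp
  qed
  have h0: "h x = 0" if "x \<in> V0" for x
    by (rule harmonic_const[of V V0 c' A c h, OF _ _ _ _ _ _ eq _ that])
      (use recD c c' odo_outside in \<open>auto simp: V0_eq h_def\<close>)
  have hV: "h x = 0" if "x \<in> V" for x
    using that h0[of x] odo_outside[of x] by (cases "x \<in> V0") (auto simp: h_def)
  show "c = c'"
  proof
    fix x show "c x = c' x"
    proof (cases "x \<in> V0")
      case True
      have "(\<Sum>y\<in>V. int (A x y) * (h y - h x)) = 0"
        using hV h0 True by (intro sum.neutral) auto
      thus ?thesis using eq[OF True] by simp
    next
      case False thus ?thesis using recD(4)[OF c] recD(4)[OF c'] by simp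
    qed
  qed
qed

lemma finite_rec [simp]: "finite recurrents"
proof -
  have "recurrents \<subseteq> {f. \<forall>x. (x \<in> V0 \<longrightarrow> f x \<in> {..(\<Sum>x\<in>V0. d x)}) \<and> (x \<notin> V0 \<longrightarrow> f x = 0)}"
  proof
    fix c assume c: "c \<in> recurrents"
    have "c x \<le> (\<Sum>x\<in>V0. d x)" if "x \<in> V0" for x
    proof -
      have "d x \<le> (\<Sum>x\<in>V0. d x)" using that by (intro member_le_sum) auto
      thus ?thesis using recD(3)[OF c that] by linarith
    qed
    thus "c \<in> {f. \<forall>x. (x \<in> V0 \<longrightarrow> f x \<in> {..(\<Sum>x\<in>V0. d x)}) \<and> (x \<notin> V0 \<longrightarrow> f x = 0)}"
      using recD(4)[OF c] by auto
  qed
  thus ?thesis using finite_set_of_finite_funs[of V0 "{..(\<Sum>x\<in>V0. d x)}" 0] finite_subset by auto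
qed

lemma max_rec: "(\<lambda>x. if x \<in> V0 then d x - 1 else 0) \<in> recurrents"
proof -
  have "allowed A V0 (\<lambda>x. if x \<in> V0 then d x - 1 else 0)"
    using allowed_max by (rule allowed_mono) auto
  thus ?thesis using d_pos by (auto simp: recurrents_def)
qed

lemma rec_ne: "recurrents \<noteq> {}" using max_rec by auto

section \<open>Recurrent states of the sandpile Markov chain\<close>

lemma hit_Suc:
  assumes q: "set_pmf q = V0"
  shows "hit_within (sandpile_chain H {p} q) y (Suc n) x =
    (\<Sum>w\<in>V0. pmf q w * (if stab w x = y then 1 else hit_within (sandpile_chain H {p} q) y n (stab w x)))"
  by (simp add: sandpile_chain_def) (subst integral_measure_pmf_real[where A = V0], use q in \<open>auto simp: mult.commute\<close>)

lemma sum_pmf: "set_pmf q = V0 \<Longrightarrow> (\<Sum>w\<in>V0. pmf q w) = 1"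
  by (simp add: sum_pmf_eq_1)

lemma hit_bounds:
  assumes q: "set_pmf q = V0"
  shows "0 \<le> hit_within (sandpile_chain H {p} q) y n x \<and> hit_within (sandpile_chain H {p} q) y n x \<le> 1"
proof (induction n arbitrary: x)
  case (Suc n)
  have "(\<Sum>w\<in>V0. pmf q w * (if stab w x = y then 1 else hit_within (sandpile_chain H {p} q) y n (stab w x)))
     \<le> (\<Sum>w\<in>V0. pmf q w * 1)" using Suc by (intro sum_mono mult_left_mono) auto
  moreover have "0 \<le> (\<Sum>w\<in>V0. pmf q w * (if stab w x = y then 1 else hit_within (sandpile_chain H {p} q) y n (stab w x)))"
    using Suc by (intro sum_nonneg mult_nonneg_nonneg) auto
  ultimately show ?case using hit_Suc[OF q] sum_pmf[OF q] by simp
qed simp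

lemma hit_mono_Suc:
  assumes q: "set_pmf q = V0"
  shows "hit_within (sandpile_chain H {p} q) y n x \<le> hit_within (sandpile_chain H {p} q) y (Suc n) x"
proof (induction n arbitrary: x)
  case 0 thus ?case using hit_bounds[OF q, of y "Suc 0" x] by simp
next
  case (Suc n)
  show ?case unfolding hit_Suc[OF q, of y _ x]
    using Suc by (intro sum_mono mult_left_mono) auto
qed

lemma hit_mono:
  assumes q: "set_pmf q = V0" and "m \<le> n"
  shows "hit_within (sandpile_chain H {p} q) y m x \<le> hit_within (sandpile_chain H {p} q) y n x"
  using lift_Suc_mono_le[of "\<lambda>n. hit_within (sandpile_chain H {p} q) y n x", OF hit_mono_Suc[OF q] assms(2)] .

primrec reaches :: "nat \<Rightarrow> ('v \<Rightarrow> nat) \<Rightarrow> bool" where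
  "reaches 0 c \<longleftrightarrow> c \<in> recurrents"
| "reaches (Suc l) c \<longleftrightarrow> (\<exists>w\<in>V0. reaches l (stab w c))"

lemma stable_reaches:
  assumes "\<forall>x. x \<notin> V0 \<longrightarrow> c x = 0" "\<forall>x\<in>V0. c x < d x"
  shows "\<exists>l. reaches l c"
  using assms
proof (induction "\<Sum>x\<in>V0. d x - 1 - c x" arbitrary: c rule: less_induct)
  case less
  show ?case
  proof (cases "\<exists>w\<in>V0. c w < d w - 1")
    case False
    have "c = (\<lambda>x. if x \<in> V0 then d x - 1 else 0)"
    proof
      fix x show "c x = (if x \<in> V0 then d x - 1 else 0)" using less(2,3) False by force
    qed
    hence "reaches 0 c" using max_rec by simp
    thus ?thesis by blast
  next
    case True
    then obtain w where w: "w \<in> V0" "c w < d w - 1" by auto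
    have st: "stable H {p} (add_chip w c)" using w less(3) by (auto simp: stable_def add_chip_def)
    have "(\<Sum>x\<in>V0. d x - 1 - add_chip w c x) < (\<Sum>x\<in>V0. d x - 1 - c x)"
      using w by (intro sum_strict_mono_ex1) (auto simp: add_chip_def)
    moreover have "\<forall>x. x \<notin> V0 \<longrightarrow> add_chip w c x = 0" using less(2) w by (auto simp: add_chip_def)
    moreover have "\<forall>x\<in>V0. add_chip w c x < d x" using st by (auto simp: stable_def)
    ultimately obtain l where "reaches l (add_chip w c)" using less(1) by blast
    hence "reaches (Suc l) c" using w stabilize_stable[OF st] by (auto intro!: bexI[of _ w])
    thus ?thesis by blast
  qed
qed

lemma recurrent_imp_rec:
  assumes c: "c \<in> recurrent_configs H {p}" shows "c \<in> recurrents"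
proof (rule ccontr)
  assume nr: "c \<notin> recurrents"
  define q where "q = pmf_of_set V0"
  have q: "set_pmf q = V0" using V0_ne by (simp add: q_def)
  let ?hit = "hit_within (sandpile_chain H {p} q) c"
  have st: "\<forall>x. x \<notin> V0 \<longrightarrow> c x = 0" "\<forall>x\<in>V0. c x < d x"
    using c by (auto simp: recurrent_configs_def stable_configs_def stable_def)
  define L where "L = (LEAST l. reaches l c)"
  have L: "reaches L c" using stable_reaches[OF st] LeastI_ex unfolding L_def by metis
  have least: "\<not> reaches l c" if "l < L" for l using that not_less_Least unfolding L_def by blast
  have rec0: "?hit n x = 0" if "x \<in> recurrents" for n x
    using that
  proof (induction n arbitrary: x)
    case (Suc n)
    have "stab w x \<in> recurrents \<and> stab w x \<noteq> c" if "w \<in> V0" for w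
      using stab_rec[OF Suc(2) that] nr by auto
    thus ?case using Suc(1) unfolding hit_Suc[OF q] by (intro sum.neutral) auto
  qed simp
  have "\<exists>\<delta>>0. \<forall>n. ?hit n x \<le> 1 - \<delta>" if "reaches l x" "l \<le> L" for l x
    using that
  proof (induction l arbitrary: x)
    case 0 thus ?case using rec0 by (intro exI[of _ 1]) auto
  next
    case (Suc l)
    then obtain w where w: "w \<in> V0" "reaches l (stab w x)" by auto
    then obtain \<delta> where \<delta>: "\<delta> > 0" "\<And>n. ?hit n (stab w x) \<le> 1 - \<delta>" using Suc by (meson Suc_leD)
    have ne: "stab w x \<noteq> c" using least[of l] w Suc(3) by auto
    have pw: "pmf q w > 0" using w q by (simp add: pmf_positive)
    have "?hit n x \<le> 1 - pmf q w * \<delta>" for n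
    proof (cases n)
      case 0
      have "pmf q w * \<delta> \<le> 1 * 1" using \<delta>(2)[of 0] \<delta>(1) by (intro mult_mono) (auto simp: pmf_le_1)
      thus ?thesis using 0 by simp
    next
      case (Suc m)
      have "?hit n x = pmf q w * ?hit m (stab w x) +
         (\<Sum>w\<in>V0 - {w}. pmf q w * (if stab w x = c then 1 else ?hit m (stab w x)))"
        unfolding Suc hit_Suc[OF q] using w(1) ne by (subst sum.remove[of V0 w]) auto
      also have "\<dots> \<le> pmf q w * (1 - \<delta>) + (\<Sum>w\<in>V0 - {w}. pmf q w * 1)"
        using \<delta>(2) hit_bounds[OF q] by (intro add_mono sum_mono mult_left_mono) auto
      also have "\<dots> = 1 - pmf q w * \<delta>"
        using sum_pmf[OF q] w(1) by (simp add: sum.remove[of V0 w] algebra_simps)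
      finally show ?thesis .
    qed
    thus ?case using pw \<delta> by (intro exI[of _ "pmf q w * \<delta>"]) auto
  qed
  from this[OF L order_refl] obtain \<delta> where \<delta>: "\<delta> > 0" "\<And>n. ?hit n c \<le> 1 - \<delta>" by auto
  have "(\<lambda>n. ?hit n c) \<longlonglongrightarrow> 1"
    using c q by (auto simp: recurrent_configs_def recurrent_state_def)
  hence "1 \<le> 1 - \<delta>" using \<delta> by (intro LIMSEQ_le_const2) auto
  thus False using \<delta> by simp
qed

definition steps :: "(('v \<Rightarrow> nat) \<times> ('v \<Rightarrow> nat)) set" where
  "steps = {(c, stab w c) | c w. c \<in> recurrents \<and> w \<in> V0}"

lemma steps_rtrancl_rec: "(c, x) \<in> steps\<^sup>* \<Longrightarrow> c \<in> recurrents \<Longrightarrow> x \<in> recurrents"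
  by (induction rule: rtrancl_induct) (auto simp: steps_def stab_rec)

lemma funpow_stab_steps:
  assumes "c \<in> recurrents" "w \<in> V0" shows "((stab w ^^ n) c) \<in> recurrents \<and> (c, (stab w ^^ n) c) \<in> steps\<^sup>*"
proof (induction n)
  case (Suc n)
  thus ?case using assms by (auto simp: stab_rec steps_def intro!: rtrancl_into_rtrancl[of c "(stab w ^^ n) c"])
qed (use assms in auto)

lemma steps_back:
  assumes c: "c \<in> recurrents" and w: "w \<in> V0" shows "(stab w c, c) \<in> steps\<^sup>*"
proof -
  let ?f = "\<lambda>n. (stab w ^^ n) c"
  have "finite (range ?f)" using funpow_stab_steps[OF c w] by (intro finite_subset[OF _ finite_rec]) auto
  hence "\<not> inj ?f" using finite_imageD by blast
  then obtain m n where mn: "m < n" "?f m = ?f n" using linorder_injI[of ?f] by blast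
  obtain k where n: "n = m + Suc k" using less_imp_Suc_add[OF mn(1)] by auto
  have "(stab w ^^ Suc k) c = c"
  proof (rule funpow_cancel[OF stab_inj_on[OF w]])
    show "(stab w ^^ i) c \<in> recurrents" for i using funpow_stab_steps[OF c w] by blast
    show "(stab w ^^ m) c = (stab w ^^ (m + Suc k)) c" using mn(2) unfolding n .
  qed
  hence "(stab w ^^ k) (stab w c) = c" by (simp only: funpow_Suc_right comp_apply)
  thus ?thesis using funpow_stab_steps[OF stab_rec[OF c w] w, of k] by simp
qed

lemma steps_sym: "(c, x) \<in> steps\<^sup>* \<Longrightarrow> (x, c) \<in> steps\<^sup>*"
proof (induction rule: rtrancl_induct)
  case (step y z)
  have "(z, y) \<in> steps\<^sup>*" using step(2) steps_back by (auto simp: steps_def)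
  thus ?case using step(3) by (rule rtrancl_trans)
qed auto

lemma steps_hit:
  assumes q: "set_pmf q = V0"
  shows "(x, c) \<in> steps\<^sup>+ \<Longrightarrow> \<exists>n. hit_within (sandpile_chain H {p} q) c n x > 0"
proof (induction rule: converse_trancl_induct)
  case (base x)
  then obtain w where w: "w \<in> V0" "c = stab w x" by (auto simp: steps_def)
  have "0 < pmf q w * 1" using w q by (simp add: pmf_positive)
  also have "\<dots> \<le> hit_within (sandpile_chain H {p} q) c (Suc 0) x"
    unfolding hit_Suc[OF q] using w by (subst sum.remove[of V0 w]) (auto intro!: sum_nonneg)
  finally show ?case by blast
next
  case (step x z)
  then obtain w where w: "w \<in> V0" "z = stab w x" by (auto simp: steps_def)
  obtain n where n: "hit_within (sandpile_chain H {p} q) c n z > 0" using step by auto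
  have "0 < pmf q w * (if z = c then 1 else hit_within (sandpile_chain H {p} q) c n z)"
    using w q n by (auto simp: pmf_positive)
  also have "\<dots> \<le> hit_within (sandpile_chain H {p} q) c (Suc n) x"
    unfolding hit_Suc[OF q] using w hit_bounds[OF q]
    by (subst sum.remove[of V0 w]) (auto intro!: sum_nonneg mult_nonneg_nonneg)
  finally show ?case by blast
qed

lemma rec_recurrent_state:
  assumes c: "c \<in> recurrents" and q: "set_pmf q = V0"
  shows "recurrent_state (sandpile_chain H {p} q) c"
proof -
  let ?hit = "hit_within (sandpile_chain H {p} q) c"
  define S where "S = {x. (c, x) \<in> steps\<^sup>*}"
  have SR: "S \<subseteq> recurrents" using steps_rtrancl_rec c by (auto simp: S_def)
  hence finS: "finite S" using finite_subset finite_rec by blast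
  have cS: "c \<in> S" by (simp add: S_def)
  have closed: "stab w x \<in> S" if "x \<in> S" "w \<in> V0" for x w
    using that SR by (auto simp: S_def steps_def intro!: rtrancl_into_rtrancl[of c x])
  obtain w0 where w0: "w0 \<in> V0" using V0_ne by auto
  have "\<exists>n. ?hit n x > 0" if "x \<in> S" for x
  proof -
    have "(x, stab w0 x) \<in> steps" using that SR w0 by (auto simp: steps_def)
    moreover have "(stab w0 x, c) \<in> steps\<^sup>*" using closed[OF that w0] steps_sym by (auto simp: S_def)
    ultimately show ?thesis by (intro steps_hit[OF q]) auto
  qed
  then obtain n where n: "\<And>x. x \<in> S \<Longrightarrow> ?hit (n x) x > 0" by metis
  define N where "N = Max (n ` S)"
  define \<epsilon> where "\<epsilon> = Min ((\<lambda>x. ?hit N x) ` S)"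
  have pos: "?hit N x > 0" if "x \<in> S" for x
    using n[OF that] hit_mono[OF q, of "n x" N c x] that finS by (force simp: N_def)
  have \<epsilon>: "\<epsilon> > 0" "\<And>x. x \<in> S \<Longrightarrow> \<epsilon> \<le> ?hit N x"
  proof -
    have fin: "finite ((\<lambda>x. ?hit N x) ` S)" using finS by simp
    have "\<epsilon> \<in> (\<lambda>x. ?hit N x) ` S" unfolding \<epsilon>_def using fin cS by (intro Min_in) auto
    thus "\<epsilon> > 0" using pos by auto
    show "\<epsilon> \<le> ?hit N x" if "x \<in> S" for x unfolding \<epsilon>_def using fin that by (intro Min_le) auto
  qed
  have \<epsilon>1: "\<epsilon> \<le> 1" using \<epsilon>(2)[OF cS] hit_bounds[OF q, of c N c] by linarith
  have iter: "1 - ?hit (j + m) x \<le> (1 - ?hit j x) * b"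
    if b: "\<And>x. x \<in> S \<Longrightarrow> 1 - ?hit m x \<le> b" and x: "x \<in> S" for j m x b
    using x
  proof (induction j arbitrary: x)
    case 0 thus ?case using b by simp
  next
    case (Suc j)
    have e: "1 - ?hit (Suc k) x = (\<Sum>w\<in>V0. pmf q w * (if stab w x = c then 0 else 1 - ?hit k (stab w x)))" for k
    proof -
      have "1 - ?hit (Suc k) x = (\<Sum>w\<in>V0. pmf q w) - ?hit (Suc k) x" using sum_pmf[OF q] by simp
      also have "\<dots> = (\<Sum>w\<in>V0. pmf q w * (if stab w x = c then 0 else 1 - ?hit k (stab w x)))"
        unfolding hit_Suc[OF q] sum_subtractf[symmetric] by (intro sum.cong) (auto simp: algebra_simps)
      finally show ?thesis .
    qed
    have "1 - ?hit (Suc j + m) x = (\<Sum>w\<in>V0. pmf q w * (if stab w x = c then 0 else 1 - ?hit (j + m) (stab w x)))"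
      using e[of "j + m"] by simp
    also have "\<dots> \<le> (\<Sum>w\<in>V0. pmf q w * (if stab w x = c then 0 else (1 - ?hit j (stab w x)) * b))"
      using Suc closed by (intro sum_mono mult_left_mono) auto
    also have "\<dots> = (1 - ?hit (Suc j) x) * b"
      unfolding e sum_distrib_right by (intro sum.cong) auto
    finally show ?case .
  qed
  have miss: "1 - ?hit (k * N) x \<le> (1 - \<epsilon>) ^ k" if "x \<in> S" for k x
    using that
  proof (induction k arbitrary: x)
    case (Suc k)
    have "1 - ?hit (N + k * N) x \<le> (1 - ?hit N x) * (1 - \<epsilon>) ^ k"
      using Suc by (intro iter) auto
    also have "\<dots> \<le> (1 - \<epsilon>) * (1 - \<epsilon>) ^ k" using \<epsilon>(2)[OF Suc(2)] \<epsilon>1 by (intro mult_right_mono) auto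
    finally show ?case by (simp add: algebra_simps)
  qed simp
  have "(\<lambda>n. ?hit n c) \<longlonglongrightarrow> 1"
  proof (rule LIMSEQ_I)
    fix r :: real assume r: "r > 0"
    obtain k where k: "(1 - \<epsilon>) ^ k < r" using real_arch_pow_inv[of r "1 - \<epsilon>"] r \<epsilon> by auto
    have "norm (?hit n c - 1) < r" if "n \<ge> k * N" for n
      using miss[OF cS, of k] hit_mono[OF q that, of c c] hit_bounds[OF q, of c n c] k by simp
    thus "\<exists>no. \<forall>n\<ge>no. norm (?hit n c - 1) < r" by blast
  qed
  thus ?thesis by (simp add: recurrent_state_def)
qed

lemma recurrent_configs_eq: "recurrent_configs H {p} = recurrents"
  using recurrent_imp_rec rec_recurrent_state
  by (auto simp: recurrent_configs_def stable_configs_def stable_def recurrents_def)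

lemma avalanche_prob_eq: "avalanche_prob H {p} v M = card {c \<in> recurrents. Mav H {p} c v = M} / card recurrents"
  using measure_pmf_of_set[OF rec_ne finite_rec, of "{c. Mav H {p} c v = M}"]
  by (simp add: avalanche_prob_def recurrent_configs_eq Int_def)

end

section \<open>A cycle block of the graph\<close>

definition nxt :: "nat \<Rightarrow> nat \<Rightarrow> nat" where "nxt k t = (if Suc t = k then 0 else Suc t)"
definition prv :: "nat \<Rightarrow> nat \<Rightarrow> nat" where "prv k t = (if t = 0 then k - 1 else t - 1)"

text \<open>\<open>pos x\<close> is the index of the vertex of the cycle \<open>f 0, \<dots>, f (k - 1)\<close> through which \<open>x\<close> is
  attached to the cycle.\<close>

definition gated_cycle :: "('v \<Rightarrow> 'v \<Rightarrow> nat) \<Rightarrow> 'v set \<Rightarrow> nat \<Rightarrow> (nat \<Rightarrow> 'v) \<Rightarrow> ('v \<Rightarrow> nat) \<Rightarrow> bool" where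
  "gated_cycle A V k f pos \<longleftrightarrow> 3 \<le> k \<and> (\<forall>t<k. f t \<in> V \<and> pos (f t) = t) \<and> (\<forall>x\<in>V. pos x < k) \<and>
     (\<forall>x\<in>V. \<forall>y\<in>V. pos x \<noteq> pos y \<longrightarrow> A x y =
        (if x = f (pos x) \<and> y = f (pos y) \<and> (pos y = nxt k (pos x) \<or> pos x = nxt k (pos y)) then 1 else 0))"

lemma nxt_prv: "s < k \<Longrightarrow> t < k \<Longrightarrow> t = nxt k s \<longleftrightarrow> s = prv k t"
  by (auto simp: nxt_def prv_def)

locale sandpile_cycle = sandpile H p for H :: "('v, 'e) mgraph" and p +
  fixes k :: nat and f :: "nat \<Rightarrow> 'v" and pos :: "'v \<Rightarrow> nat"
  assumes gated: "gated_cycle (chips H) (verts H) k f pos" and pos_p: "pos p = 0"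
begin

lemma k3: "3 \<le> k" using gated by (simp add: gated_cycle_def)
lemma f_V: "t < k \<Longrightarrow> f t \<in> V" using gated by (simp add: gated_cycle_def)
lemma pos_f [simp]: "t < k \<Longrightarrow> pos (f t) = t" using gated by (simp add: gated_cycle_def)
lemma pos_less: "x \<in> V \<Longrightarrow> pos x < k" using gated by (simp add: gated_cycle_def)
lemma f_inj: "s < k \<Longrightarrow> t < k \<Longrightarrow> f s = f t \<longleftrightarrow> s = t" using pos_f by metis
lemma A_cross: "x \<in> V \<Longrightarrow> y \<in> V \<Longrightarrow> pos x \<noteq> pos y \<Longrightarrow> A x y =
    (if x = f (pos x) \<and> y = f (pos y) \<and> (pos y = nxt k (pos x) \<or> pos x = nxt k (pos y)) then 1 else 0)"
  using gated by (simp add: gated_cycle_def)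
lemma nxt_less: "t < k \<Longrightarrow> nxt k t < k" using k3 by (auto simp: nxt_def)
lemma prv_less: "t < k \<Longrightarrow> prv k t < k" using k3 by (auto simp: prv_def)
lemma nxt_ne_prv: "t < k \<Longrightarrow> nxt k t \<noteq> prv k t" "t < k \<Longrightarrow> nxt k t \<noteq> t" "t < k \<Longrightarrow> prv k t \<noteq> t"
  using k3 by (auto simp: nxt_def prv_def)

lemma A_nxt: assumes "t < k" shows "A (f t) (f (nxt k t)) = 1" "A (f t) (f (prv k t)) = 1"
proof -
  note ne = nxt_ne_prv[OF assms]
  show "A (f t) (f (nxt k t)) = 1"
    using A_cross[of "f t" "f (nxt k t)"] f_V[OF assms] f_V[OF nxt_less[OF assms]] ne nxt_less assms by simp
  have "t = nxt k (prv k t)" using nxt_prv[of "prv k t" k t] prv_less assms by simp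
  thus "A (f t) (f (prv k t)) = 1"
    using A_cross[of "f t" "f (prv k t)"] f_V[OF assms] f_V[OF prv_less[OF assms]] ne prv_less assms by simp
qed

lemma V0_if_pos: "x \<in> V \<Longrightarrow> pos x \<noteq> 0 \<Longrightarrow> x \<in> V0" using pos_p by (auto simp: V0_eq)

lemma f_V0: "0 < t \<Longrightarrow> t < k \<Longrightarrow> f t \<in> V0" using V0_if_pos f_V by auto

lemma laplacian_on_cycle:
  fixes h :: "'v \<Rightarrow> int"
  assumes t: "t < k" and h: "\<And>y. y \<in> V \<Longrightarrow> pos y = t \<Longrightarrow> A (f t) y > 0 \<Longrightarrow> h y = h (f t)"
  shows "(\<Sum>y\<in>V. int (A (f t) y) * (h y - h (f t))) = h (f (prv k t)) + h (f (nxt k t)) - 2 * h (f t)"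
proof -
  let ?S = "{f (prv k t), f (nxt k t)}"
  have "(\<Sum>y\<in>V. int (A (f t) y) * (h y - h (f t))) = (\<Sum>y\<in>?S. int (A (f t) y) * (h y - h (f t)))"
  proof (rule sum.mono_neutral_right)
    show "?S \<subseteq> V" using f_V prv_less nxt_less t by auto
    show "\<forall>y\<in>V - ?S. int (A (f t) y) * (h y - h (f t)) = 0"
    proof
      fix y assume y: "y \<in> V - ?S"
      show "int (A (f t) y) * (h y - h (f t)) = 0"
      proof (cases "pos y = t")
        case True thus ?thesis using h[of y] y by (cases "A (f t) y") auto
      next
        case False
        have "\<not> (y = f (pos y) \<and> (pos y = nxt k t \<or> t = nxt k (pos y)))"
          using y t nxt_prv[of "pos y" k t] pos_less[of y] by auto
        hence "A (f t) y = 0" using A_cross[of "f t" y] f_V[OF t] y False t by auto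
        thus ?thesis by simp
      qed
    qed
  qed simp
  also have "\<dots> = (h (f (prv k t)) - h (f t)) + (h (f (nxt k t)) - h (f t))"
    using A_nxt[OF t] nxt_ne_prv[OF t] f_inj[OF prv_less[OF t] nxt_less[OF t]] by simp
  finally show ?thesis by simp
qed

lemma laplacian_off_cycle:
  fixes h :: "'v \<Rightarrow> int"
  assumes x: "x \<in> V" "x \<noteq> f (pos x)" and h: "\<And>y. y \<in> V \<Longrightarrow> pos y = pos x \<Longrightarrow> A x y > 0 \<Longrightarrow> h y = h x"
  shows "(\<Sum>y\<in>V. int (A x y) * (h y - h x)) = 0"
proof (rule sum.neutral, rule ballI)
  fix y assume y: "y \<in> V"
  show "int (A x y) * (h y - h x) = 0"
    using A_cross[of x y] h[of y] x y by (cases "pos y = pos x"; cases "A x y") auto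
qed

lemma out_degree_arc:
  assumes lr: "0 < l" "l \<le> r" "r < k" and w: "w \<in> V" "l \<le> pos w" "pos w \<le> r"
  shows "(\<Sum>y\<in>{y \<in> V. l \<le> pos y \<and> pos y \<le> r}. A w y) + ((if w = f l then 1 else 0) + (if w = f r then 1 else 0)) = d w"
proof -
  let ?U = "{y \<in> V. l \<le> pos y \<and> pos y \<le> r}"
  define h :: "'v \<Rightarrow> int" where "h y = (if l \<le> pos y \<and> pos y \<le> r then 0 else 1)" for y
  have hw: "h w = 0" using w by (simp add: h_def)
  have "(\<Sum>y\<in>V. int (A w y) * (h y - h w)) = (if w = f l then 1 else 0) + (if w = f r then 1 else 0)"
  proof (cases "w = f (pos w)")
    case True
    define t where "t = pos w"
    have t: "0 < t" "t < k" "l \<le> t" "t \<le> r" "w = f t" using w lr True pos_less by (auto simp: t_def)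
    have "h (f (prv k t)) = (if t = l then 1 else 0)"
      using t lr by (auto simp: h_def prv_def)
    moreover have "h (f (nxt k t)) = (if t = r then 1 else 0)"
      using t lr k3 by (auto simp: h_def nxt_def)
    moreover have "f t = f l \<longleftrightarrow> t = l" "f t = f r \<longleftrightarrow> t = r" using t lr by (auto simp: f_inj)
    ultimately show ?thesis using laplacian_on_cycle[OF t(2), of h] t hw by (simp add: h_def)
  next
    case False
    have "w \<noteq> f l" "w \<noteq> f r" using False lr pos_f[of l] pos_f[of r] by auto
    thus ?thesis using laplacian_off_cycle[of w h] w False by (simp add: h_def)
  qed
  moreover have "(\<Sum>y\<in>V. int (A w y) * (h y - h w)) = (\<Sum>y\<in>V - ?U. int (A w y))"
    unfolding hw by (intro sum.mono_neutral_cong_right) (auto simp: h_def)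
  moreover have "(\<Sum>y\<in>V. int (A w y)) = (\<Sum>y\<in>V - ?U. int (A w y)) + (\<Sum>y\<in>?U. int (A w y))"
    by (intro sum.subset_diff) auto
  moreover have "(\<Sum>y\<in>V. int (A w y)) = int (d w)" using d_eq[OF w(1)] by simp
  ultimately have "int ((\<Sum>y\<in>?U. A w y) + ((if w = f l then 1 else 0) + (if w = f r then 1 else 0))) = int (d w)"
    by simp
  thus ?thesis by linarith
qed

lemma arc_allowed:
  assumes c: "c \<in> recurrents" and lr: "0 < l" "l \<le> r" "r < k"
  shows "\<exists>w\<in>{f l, f r}. d w \<le> c w + ((if w = f l then 1 else 0) + (if w = f r then 1 else 0))"
proof -
  let ?U = "{y \<in> V. l \<le> pos y \<and> pos y \<le> r}"
  have U: "?U \<subseteq> V0" using V0_if_pos lr by auto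
  have "f l \<in> ?U" using lr f_V by auto
  then obtain w where w: "w \<in> ?U" "(\<Sum>y\<in>?U. A w y) \<le> c w"
    using allowedD[OF recD(1)[OF c] U] by blast
  have "d w \<le> c w + ((if w = f l then 1 else 0) + (if w = f r then 1 else 0))"
    using out_degree_arc[OF lr, of w] w by auto
  moreover have "c w < d w" using recD(3)[OF c] U w by blast
  ultimately show ?thesis by (auto split: if_splits)
qed

lemma at_least_two_missing: "c \<in> recurrents \<Longrightarrow> 0 < t \<Longrightarrow> t < k \<Longrightarrow> d (f t) \<le> c (f t) + 2"
  using arc_allowed[of c t t] by auto

lemma one_zero:
  assumes "c \<in> recurrents" "0 < l" "l < r" "r < k" "c (f l) + 2 = d (f l)" shows "c (f r) + 2 \<noteq> d (f r)"
proof
  assume r: "c (f r) + 2 = d (f r)"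
  have "f l \<noteq> f r" using assms by (simp add: f_inj)
  then obtain w where "w \<in> {f l, f r}" "d w \<le> c w + 1"
    using arc_allowed[of c l r] assms by (auto split: if_splits)
  thus False using r assms(5) by auto
qed

definition zero_pos :: "('v \<Rightarrow> nat) \<Rightarrow> nat" where
  "zero_pos c = (if \<exists>t. 0 < t \<and> t < k \<and> c (f t) + 2 = d (f t)
     then SOME t. 0 < t \<and> t < k \<and> c (f t) + 2 = d (f t) else 0)"

lemma zero_pos:
  assumes c: "c \<in> recurrents"
  shows "zero_pos c < k" "0 < t \<Longrightarrow> t < k \<Longrightarrow> c (f t) + 1 + (if t = zero_pos c then 1 else 0) = d (f t)"
proof -
  let ?P = "\<lambda>t. 0 < t \<and> t < k \<and> c (f t) + 2 = d (f t)"
  have ex: "?P (zero_pos c)" if "\<exists>t. ?P t" using someI_ex[OF that] that by (simp add: zero_pos_def)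
  show "zero_pos c < k" using ex k3 by (cases "\<exists>t. ?P t") (auto simp: zero_pos_def)
  assume t: "0 < t" "t < k"
  have lt: "c (f t) < d (f t)" using recD(3)[OF c f_V0] t by auto
  have le: "d (f t) \<le> c (f t) + 2" using at_least_two_missing c t by auto
  show "c (f t) + 1 + (if t = zero_pos c then 1 else 0) = d (f t)"
  proof (cases "t = zero_pos c")
    case True
    have "\<exists>t. ?P t"
    proof (rule ccontr)
      assume "\<not> ?thesis"
      hence "zero_pos c = 0" by (simp only: zero_pos_def if_False)
      thus False using True t by simp
    qed
    from ex[OF this] have "c (f t) + 2 = d (f t)" unfolding True by blast
    thus ?thesis using True by simp
  next
    case False
    have "c (f t) + 2 \<noteq> d (f t)"
    proof
      assume "c (f t) + 2 = d (f t)"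
      with t have "?P t" by simp
      hence "?P (zero_pos c)" using ex by blast
      thus False using one_zero[OF c, of t "zero_pos c"] one_zero[OF c, of "zero_pos c" t] False \<open>?P t\<close>
        by (meson linorder_neqE_nat)
    qed
    hence "c (f t) + 1 = d (f t)" using lt le by linarith
    thus ?thesis using False by simp
  qed
qed

lemma zero_pos_eqI:
  assumes c: "c \<in> recurrents" and z: "z < k"
    and eq: "\<And>t. 0 < t \<Longrightarrow> t < k \<Longrightarrow> c (f t) + 1 + (if t = z then 1 else 0) = d (f t)"
  shows "zero_pos c = z"
proof (rule ccontr)
  assume ne: "zero_pos c \<noteq> z"
  have "0 < t \<Longrightarrow> t < k \<Longrightarrow> (t = zero_pos c \<longleftrightarrow> t = z)" for t
    using zero_pos(2)[OF c, of t] eq[of t] by (simp split: if_splits)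
  hence "\<not> 0 < z" "\<not> 0 < zero_pos c" using ne z zero_pos(1)[OF c] by metis+
  thus False using ne by simp
qed

lemma two_le_degree: "t < k \<Longrightarrow> 2 \<le> d (f t)"
proof -
  assume t: "t < k"
  let ?S = "{f (prv k t), f (nxt k t)}"
  have "(\<Sum>y\<in>?S. A (f t) y) \<le> (\<Sum>y\<in>V. A (f t) y)"
    using t f_V prv_less nxt_less by (intro sum_mono2) auto
  moreover have "(\<Sum>y\<in>?S. A (f t) y) = 2"
    using A_nxt[OF t] nxt_ne_prv[OF t] f_inj[OF prv_less[OF t] nxt_less[OF t]] by simp
  ultimately show ?thesis using d_eq[OF f_V[OF t]] by simp
qed

definition set_zero :: "nat \<Rightarrow> ('v \<Rightarrow> nat) \<Rightarrow> ('v \<Rightarrow> nat)" where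
  "set_zero z c = (\<lambda>x. if x \<in> f ` {1..<k} then d x - 1 - (if x = f z then 1 else 0) else c x)"

lemma set_zero_f: "0 < t \<Longrightarrow> t < k \<Longrightarrow> z < k \<Longrightarrow> set_zero z c (f t) = d (f t) - 1 - (if t = z then 1 else 0)"
  by (auto simp: set_zero_def f_inj)

lemma cut0:
  assumes "x \<in> V" "pos x \<noteq> 0" "y \<in> V" "pos y = 0" "A x y > 0" shows "y = f 0"
  using A_cross[of x y] assms by (auto split: if_splits)

lemma cut:
  assumes "x \<in> V" "pos x = t" "x \<noteq> f t" "y \<in> V" "A x y > 0" shows "pos y = t"
  using A_cross[of x y] assms by (cases "pos y = t") (auto split: if_splits)

lemma row_sum_closed:
  assumes "x \<in> V" "S \<subseteq> V" "\<And>y. y \<in> V - S \<Longrightarrow> A x y = 0" shows "(\<Sum>y\<in>S. A x y) = d x"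
  using assms d_eq[OF assms(1)] by (simp add: sum.mono_neutral_left)

lemma row_sum_less:
  assumes "x \<in> V" "S \<subseteq> V" "S' \<subseteq> V - S" shows "(\<Sum>y\<in>S. A x y) + (\<Sum>y\<in>S'. A x y) \<le> d x"
proof -
  have "(\<Sum>y\<in>S. A x y) + (\<Sum>y\<in>S'. A x y) = (\<Sum>y\<in>S \<union> S'. A x y)"
    using assms finite_subset[OF _ finV] by (intro sum.union_disjoint[symmetric]) blast+
  also have "\<dots> \<le> d x" unfolding d_eq[OF assms(1)] using assms by (intro sum_mono2) auto
  finally show ?thesis .
qed

lemma allowed_one_zero:
  assumes c: "c \<in> recurrents" and z: "z < k"
  shows "allowed A {x \<in> V. pos x \<noteq> 0} (set_zero z c)"
  unfolding allowed_def
proof (intro allI impI)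
  fix U assume U: "U \<subseteq> {x \<in> V. pos x \<noteq> 0}" "U \<noteq> {}"
  have UV: "U \<subseteq> V" and UV0: "U \<subseteq> V0" using U V0_if_pos by auto
  define S where "S = {t. 0 < t \<and> t < k \<and> f t \<in> U}"
  have memS: "t \<in> S \<longleftrightarrow> 0 < t \<and> t < k \<and> f t \<in> U" for t by (simp add: S_def)
  have finS: "finite S" by (rule finite_subset[of _ "{..<k}"]) (auto simp: memS)
  show "\<exists>w\<in>U. (\<Sum>y\<in>U. A w y) \<le> set_zero z c w"
  proof (cases "S = {}")
    case True
    obtain w where w: "w \<in> U" "(\<Sum>y\<in>U. A w y) \<le> c w"
      using allowedD[OF recD(1)[OF c] UV0 U(2)] by blast
    have "w \<notin> f ` {1..<k}" using True w by (auto simp: S_def)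
    thus ?thesis using w by (intro bexI[of _ w]) (auto simp: set_zero_def)
  next
    case False
    have zU: "f 0 \<notin> U" using U k3 pos_f[of 0] by auto
    have l: "Min S \<in> S" and r: "Max S \<in> S" using False finS by auto
    have lk: "0 < Min S" "Min S < k" "f (Min S) \<in> U" using l unfolding memS by blast+
    have rk: "0 < Max S" "Max S < k" "f (Max S) \<in> U" using r unfolding memS by blast+
    have lp: "f (prv k (Min S)) \<notin> U"
    proof
      assume *: "f (prv k (Min S)) \<in> U"
      hence "Min S \<noteq> 1" using zU by (auto simp: prv_def)
      hence "Min S - 1 \<in> S" using * lk by (simp add: memS prv_def)
      from Min_le[OF finS this] show False using lk by linarith
    qed
    have rn: "f (nxt k (Max S)) \<notin> U"
    proof
      assume *: "f (nxt k (Max S)) \<in> U"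
      hence "Suc (Max S) \<noteq> k" using zU by (simp add: nxt_def split: if_splits)
      hence "Suc (Max S) \<in> S" using * rk by (simp add: memS nxt_def)
      from Max_ge[OF finS this] show False by linarith
    qed
    consider "Min S \<noteq> z" | "Max S \<noteq> z" | "Min S = z" "Max S = z" by blast
    thus ?thesis
    proof cases
      case 1
      have "(\<Sum>y\<in>U. A (f (Min S)) y) + (\<Sum>y\<in>{f (prv k (Min S))}. A (f (Min S)) y) \<le> d (f (Min S))"
        using lp lk f_V prv_less UV by (intro row_sum_less) auto
      thus ?thesis using A_nxt[OF lk(2)] 1 lk z by (intro bexI[of _ "f (Min S)"]) (auto simp: set_zero_f)
    next
      case 2
      have "(\<Sum>y\<in>U. A (f (Max S)) y) + (\<Sum>y\<in>{f (nxt k (Max S))}. A (f (Max S)) y) \<le> d (f (Max S))"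
        using rn rk f_V nxt_less UV by (intro row_sum_less) auto
      thus ?thesis using A_nxt[OF rk(2)] 2 rk z by (intro bexI[of _ "f (Max S)"]) (auto simp: set_zero_f)
    next
      case 3
      have "(\<Sum>y\<in>U. A (f z) y) + (\<Sum>y\<in>{f (prv k z), f (nxt k z)}. A (f z) y) \<le> d (f z)"
        using rn lp 3 rk f_V nxt_less prv_less UV by (intro row_sum_less) auto
      moreover have "(\<Sum>y\<in>{f (prv k z), f (nxt k z)}. A (f z) y) = 2"
        using A_nxt[OF z] nxt_ne_prv[OF z] f_inj[OF prv_less[OF z] nxt_less[OF z]] by simp
      ultimately show ?thesis using 3 lk z by (intro bexI[of _ "f z"]) (auto simp: set_zero_f)
    qed
  qed
qed

lemma set_zero_rec:
  assumes c: "c \<in> recurrents" and z: "z < k" shows "set_zero z c \<in> recurrents"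
proof -
  let ?T1 = "{x \<in> V. pos x \<noteq> 0}" and ?T2 = "{x \<in> V0. pos x = 0}"
  have V0: "?T1 \<union> ?T2 = V0" using V0_if_pos by (auto simp: V0_eq)
  have fT1: "f ` {1..<k} \<subseteq> ?T1" using f_V by auto
  have st: "set_zero z c x < d x" if "x \<in> V0" for x
  proof (cases "x \<in> f ` {1..<k}")
    case True
    then obtain t where t: "0 < t" "t < k" "x = f t" by (auto simp: Suc_le_eq)
    thus ?thesis using two_le_degree[of t] z by (simp add: set_zero_f)
  next
    case False
    hence "set_zero z c x = c x" unfolding set_zero_def by simp
    thus ?thesis using recD(3)[OF c that] by simp
  qed
  have rs: "(\<Sum>y\<in>insert (f 0) ?T1. A x y) = d x" if "x \<in> ?T1" for x
  proof (rule row_sum_closed)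
    show "A x y = 0" if "y \<in> V - insert (f 0) ?T1" for y
      using cut0[of x y] that \<open>x \<in> ?T1\<close> by auto
  qed (use that f_V[of 0] k3 in auto)
  have "allowed A (?T1 \<union> ?T2) (set_zero z c)"
  proof (rule allowed_glue[where q = "f 0" and c = c])
    show "allowed A (?T1 \<union> ?T2) c" using recD(1)[OF c] V0 by simp
    show "allowed A ?T1 (set_zero z c)" by (rule allowed_one_zero[OF c z])
    show "set_zero z c x = c x" if "x \<in> ?T2" for x using that fT1 by (auto simp: set_zero_def)
    show "y = f 0" if "x \<in> ?T1" "y \<in> ?T2" "A x y > 0" for x y using cut0[of x y] that by (auto simp: V0_eq)
    show "c x < (\<Sum>y\<in>insert (f 0) ?T1. A x y)" if "x \<in> ?T1" for x
      using rs[OF that] recD(3)[OF c, of x] that V0 by auto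
    show "set_zero z c x < (\<Sum>y\<in>insert (f 0) ?T1. A x y)" if "x \<in> ?T1" for x
      using rs[OF that] st[of x] that V0 by auto
  qed (auto simp: chips_sym)
  moreover have "set_zero z c x = 0" if "x \<notin> V0" for x
    using recD(4)[OF c that] that fT1 V0 unfolding set_zero_def by auto
  ultimately show ?thesis using st V0 by (auto simp: recurrents_def)
qed

lemma zero_pos_set_zero: "c \<in> recurrents \<Longrightarrow> z < k \<Longrightarrow> zero_pos (set_zero z c) = z"
proof (intro zero_pos_eqI set_zero_rec)
  fix t assume "z < k" "0 < t" "t < k"
  thus "set_zero z c (f t) + 1 + (if t = z then 1 else 0) = d (f t)"
    using two_le_degree[of t] by (cases "t = z") (simp_all add: set_zero_f)
qed

lemma set_zero_set_zero: "set_zero z (set_zero z' c) = set_zero z c"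
  by (auto simp: set_zero_def)

lemma set_zero_zero_pos: assumes c: "c \<in> recurrents" shows "set_zero (zero_pos c) c = c"
proof
  fix x show "set_zero (zero_pos c) c x = c x"
  proof (cases "x \<in> f ` {1..<k}")
    case True
    then obtain t where t: "0 < t" "t < k" "x = f t" by (auto simp: Suc_le_eq)
    have "c (f t) + 1 + (if t = zero_pos c then 1 else 0) = d (f t)" using zero_pos(2)[OF c t(1,2)] .
    thus ?thesis using set_zero_f[OF t(1,2) zero_pos(1)[OF c]] t(3) by simp
  qed (simp add: set_zero_def)
qed

end

section \<open>Odometers along a cycle\<close>

definition ring_arc :: "nat \<Rightarrow> nat \<Rightarrow> nat \<Rightarrow> nat set" where
  "ring_arc k a z = (if a < z then {1..<z} else {z + 1..<k})"

text \<open>Away from \<open>a\<close> and \<open>z\<close> the function is concave and nonnegative, so a zero there forces zeros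
  at both neighbours and hence spreads.\<close>

lemma concave_support:
  fixes g :: "nat \<Rightarrow> int"
  assumes g0: "g 0 = 0" and gk: "g k = 0" and nn: "\<And>t. g t \<ge> 0" and a: "0 < a" "a < k" "g a > 0"
    and conc: "\<And>t. 0 < t \<Longrightarrow> t < k \<Longrightarrow> t \<noteq> a \<Longrightarrow> t \<noteq> z \<Longrightarrow> g (t + 1) + g (t - 1) \<le> 2 * g t"
    and out: "g 1 + g (k - 1) \<le> 1"
  shows "z < a \<longrightarrow> 0 < z \<and> g 1 = 0 \<and> g (k - 1) = 1 \<and> (\<forall>t<k. g t > 0 \<longleftrightarrow> z < t)"
    and "a < z \<longrightarrow> z < k \<and> g 1 = 1 \<and> g (k - 1) = 0 \<and> (\<forall>t<k. g t > 0 \<longleftrightarrow> 0 < t \<and> t < z)"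
    and "z \<noteq> a" "z \<noteq> 0" "z < k"
proof -
  have up: "g (t + 1) = 0" if "g t = 0" "0 < t" "t < k" "t \<noteq> a" "t \<noteq> z" for t
    using conc[OF that(2-5)] nn[of "t + 1"] nn[of "t - 1"] that(1) by linarith
  have down: "g (t - 1) = 0" if "g t = 0" "0 < t" "t < k" "t \<noteq> a" "t \<noteq> z" for t
    using conc[OF that(2-5)] nn[of "t + 1"] nn[of "t - 1"] that(1) by linarith
  have ups: "g t' = 0" if "t \<le> t'" "g t = 0" "0 < t" "t' \<le> k" "\<And>s. t \<le> s \<Longrightarrow> s < t' \<Longrightarrow> s \<noteq> a \<and> s \<noteq> z" for t t'
    using that
  proof (induction t' rule: dec_induct)
    case (step n) thus ?case using up[of n] by simp
  qed
  have downs: "g t' = 0" if "t' \<le> t" "g t = 0" "t < k" "\<And>s. t' < s \<Longrightarrow> s \<le> t \<Longrightarrow> s \<noteq> a \<and> s \<noteq> z" for t t'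
    using that
  proof (induction t' rule: inc_induct)
    case (step n)
    have "g (Suc n) = 0" using step by simp
    thus ?case using down[of "Suc n"] step by simp
  qed
  have left: "g t > 0" if "\<not> (0 < z \<and> z < a)" "0 < t" "t < a" for t
  proof (rule ccontr)
    assume "\<not> g t > 0"
    hence "g t = 0" using nn[of t] by linarith
    hence "g a = 0" using that a by (intro ups[of t a]) auto
    thus False using a by simp
  qed
  have right: "g t > 0" if "\<not> (a < z \<and> z < k)" "a < t" "t < k" for t
  proof (rule ccontr)
    assume "\<not> g t > 0"
    hence "g t = 0" using nn[of t] by linarith
    hence "g a = 0" using that a by (intro downs[of a t]) auto
    thus False using a by simp
  qed
  have l1: "g 1 > 0" if "\<not> (0 < z \<and> z < a)"
    using left[OF that, of 1] a by (cases "a = 1") auto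
  have r1: "g (k - 1) > 0" if "\<not> (a < z \<and> z < k)"
    using right[OF that, of "k - 1"] a by (cases "a = k - 1") auto
  have zz: "0 < z \<and> z < a \<or> a < z \<and> z < k" using l1 r1 out by linarith
  show "z < a \<longrightarrow> 0 < z \<and> g 1 = 0 \<and> g (k - 1) = 1 \<and> (\<forall>t<k. g t > 0 \<longleftrightarrow> z < t)"
  proof (intro impI conjI allI)
    assume za: "z < a"
    show z0: "0 < z" using zz za by auto
    have "g (k - 1) > 0" using r1 za by auto
    thus o: "g 1 = 0" "g (k - 1) = 1" using out nn[of 1] by linarith+
    fix t assume t: "t < k"
    show "g t > 0 \<longleftrightarrow> z < t"
    proof
      assume "g t > 0"
      show "z < t"
      proof (rule ccontr)
        assume "\<not> z < t"
        hence "g t = 0"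
          using ups[of 1 t] o za g0 a by (cases "t = 0") auto
        thus False using \<open>g t > 0\<close> by simp
      qed
    next
      assume zt: "z < t"
      show "g t > 0"
      proof (rule ccontr)
        assume "\<not> g t > 0"
        hence gt: "g t = 0" using nn[of t] by linarith
        show False
        proof (cases "t < a")
          case True
          hence "g a = 0" using gt zt a by (intro ups[of t a]) auto
          thus False using a by simp
        next
          case False
          thus False using right[of t] gt za t a by (cases "t = a") auto
        qed
      qed
    qed
  qed
  show "a < z \<longrightarrow> z < k \<and> g 1 = 1 \<and> g (k - 1) = 0 \<and> (\<forall>t<k. g t > 0 \<longleftrightarrow> 0 < t \<and> t < z)"
  proof (intro impI conjI allI)
    assume za: "a < z"
    show zk: "z < k" using zz za by auto
    have "g 1 > 0" using l1 za by auto
    thus o: "g 1 = 1" "g (k - 1) = 0" using out nn[of "k - 1"] by linarith+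
    fix t assume t: "t < k"
    show "g t > 0 \<longleftrightarrow> 0 < t \<and> t < z"
    proof
      assume gt: "g t > 0"
      show "0 < t \<and> t < z"
      proof (rule ccontr)
        assume n: "\<not> (0 < t \<and> t < z)"
        have "t \<noteq> 0" using gt g0 by (cases "t = 0") auto
        hence "z \<le> t" using n by simp
        hence "g t = 0" using za t o by (intro downs[of t "k - 1"]) auto
        thus False using gt by simp
      qed
    next
      assume zt: "0 < t \<and> t < z"
      show "g t > 0"
      proof (rule ccontr)
        assume "\<not> g t > 0"
        hence gt: "g t = 0" using nn[of t] by linarith
        show False
        proof (cases "a < t")
          case True
          hence "g a = 0" using gt zt t by (intro downs[of a t]) auto
          thus False using a by simp
        next
          case False
          thus False using left[of t] gt za zt a by (cases "t = a") auto
        qed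
      qed
    qed
  qed
  show "z \<noteq> a" "z \<noteq> 0" "z < k" using zz a by auto
qed

definition relu :: "int \<Rightarrow> int" where "relu x = max 0 x"

text \<open>The odometer, along the cycle, of an avalanche that is started by one chip at \<open>a\<close> and meets
  the zero at \<open>z\<close>; the zero moves to \<open>moved_zero k a z\<close>.\<close>

definition tent :: "nat \<Rightarrow> nat \<Rightarrow> nat \<Rightarrow> nat \<Rightarrow> int" where
  "tent k a z t = (if a < z
     then int t + relu (int t - int z) - relu (int t - (int z - int a)) - relu (int t - int a)
     else (int k - int t) + relu (int z - int t) - relu (int k - int a + int z - int t) - relu (int a - int t))"

definition moved_zero :: "nat \<Rightarrow> nat \<Rightarrow> nat \<Rightarrow> nat" where
  "moved_zero k a z = (if a < z then z - a else k - a + z)"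

lemma second_difference_sum:
  fixes x1 x2 x3 a1 a2 a3 b1 b2 b3 c1 c2 c3 i j l :: int
  assumes "a1 + a2 - 2 * a3 = i" "b1 + b2 - 2 * b3 = j" "c1 + c2 - 2 * c3 = l" "x1 + x2 - 2 * x3 = 0"
  shows "(x1 + a1 - b1 - c1) + (x2 + a2 - b2 - c2) - 2 * (x3 + a3 - b3 - c3) = i - j - l"
  unfolding assms(1-3)[symmetric] using assms(4) by (simp add: algebra_simps)

lemma tent:
  assumes "0 < a" "a < k" "0 < z" "z < k" "z \<noteq> a"
  shows "tent k a z 0 = 0" "tent k a z k = 0" "tent k a z a > 0" "tent k a z 1 + tent k a z (k - 1) = 1"
    "moved_zero k a z < k" "0 < moved_zero k a z"
    and "0 < t \<Longrightarrow> t < k \<Longrightarrow> tent k a z (t - 1) + tent k a z (t + 1) - 2 * tent k a z t =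
      (if t = z then 1 else 0) - (if t = moved_zero k a z then 1 else 0) - (if t = a then 1 else 0)"
proof -
  show "tent k a z 0 = 0" "tent k a z k = 0" "tent k a z a > 0"
    using assms by (auto simp: tent_def relu_def max_def)
  show "tent k a z 1 + tent k a z (k - 1) = 1"
    using assms by (auto simp: tent_def relu_def max_def of_nat_diff)
  show "moved_zero k a z < k" "0 < moved_zero k a z" using assms by (auto simp: moved_zero_def)
  assume t: "0 < t" "t < k"
  have e: "int (t - 1) = int t - 1" "int (t + 1) = int t + 1" using t by auto
  show "tent k a z (t - 1) + tent k a z (t + 1) - 2 * tent k a z t =
      (if t = z then 1 else 0) - (if t = moved_zero k a z then 1 else 0) - (if t = a then 1 else 0)"
  proof (cases "a < z")
    case True
    have r: "relu (int t - 1 - b) + relu (int t + 1 - b) - 2 * relu (int t - b) = (if int t = b then 1 else 0)" for b :: int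
      by (auto simp: relu_def max_def)
    have "int t = int z - int a \<longleftrightarrow> t = z - a" using True by auto
    thus ?thesis
      using second_difference_sum[OF r[of "int z"] r[of "int z - int a"] r[of "int a"], of "int t - 1" "int t + 1" "int t"] True
      unfolding tent_def moved_zero_def e by (simp only: if_True of_nat_eq_iff)
  next
    case False
    have r: "relu (b - (int t - 1)) + relu (b - (int t + 1)) - 2 * relu (b - int t) = (if int t = b then 1 else 0)" for b :: int
      by (auto simp: relu_def max_def)
    have "int t = int k - int a + int z \<longleftrightarrow> t = k - a + z" using assms(2) by auto
    thus ?thesis
      using second_difference_sum[OF r[of "int z"] r[of "int k - int a + int z"] r[of "int a"],
          of "int k - (int t - 1)" "int k - (int t + 1)" "int k - int t"] False
      unfolding tent_def moved_zero_def e by (simp only: if_False of_nat_eq_iff) simp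
  qed
qed

text \<open>The chip added at \<open>v\<close>, stabilized inside \<open>T\<close> with odometer \<open>h\<close>, makes exactly one chip leave
  \<open>T\<close> through \<open>q\<close>. This involves only \<open>T\<close> and is therefore independent of the surrounding graph.\<close>

definition single_exit :: "('v \<Rightarrow> 'v \<Rightarrow> nat) \<Rightarrow> ('v \<Rightarrow> nat) \<Rightarrow> 'v \<Rightarrow> 'v set \<Rightarrow> 'v \<Rightarrow> ('v \<Rightarrow> nat) \<Rightarrow> ('v \<Rightarrow> int) \<Rightarrow> bool" where
  "single_exit A d v T q c h \<longleftrightarrow> (\<exists>c'. (\<forall>x\<in>T. c' x < d x) \<and> allowed A T c' \<and>
     (\<forall>x\<in>T. int (c' x) = int (c x) + (if x = v then 1 else 0) + (\<Sum>y\<in>T. int (A x y) * h y) - int (d x) * h x) \<and>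
     (\<Sum>y\<in>T. int (A q y) * h y) = 1)"

lemma single_exit_cong:
  assumes "\<And>x. x \<in> T \<Longrightarrow> c x = c' x" "\<And>x. x \<in> T \<Longrightarrow> d x = d' x"
    "\<And>x y. x \<in> insert q T \<Longrightarrow> y \<in> T \<Longrightarrow> A x y = A' x y" "\<And>x. x \<in> T \<Longrightarrow> h x = h' x"
  shows "single_exit A d v T q c h \<longleftrightarrow> single_exit A' d' v T q c' h'"
proof -
  have "(\<Sum>y\<in>T. int (A x y) * h y) = (\<Sum>y\<in>T. int (A' x y) * h' y)" if "x \<in> insert q T" for x
    using assms(3)[OF that] assms(4) by (intro sum.cong) auto
  moreover have "allowed A T c'' = allowed A' T c''" for c''
    using assms(3) by (intro allowed_cong) auto
  ultimately show ?thesis unfolding single_exit_def using assms(1,2,4) by simp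
qed

section \<open>Avalanches through two consecutive cycles\<close>

context sandpile begin

lemma odo_const:
  assumes c: "c \<in> recurrents" and v: "v \<in> V0" and T: "T \<subseteq> V0" "v \<notin> T"
    and bd: "\<And>x y. x \<in> T \<Longrightarrow> y \<in> V - T \<Longrightarrow> A x y > 0 \<Longrightarrow> odo v c y = K" and x: "x \<in> T"
  shows "odo v c x = K"
proof -
  have "int (odo v c x) = int K"
  proof (rule harmonic_const[of V T c A "stab v c" "\<lambda>x. int (odo v c x)"])
    show "T \<subseteq> V" using T by (auto simp: V0_eq)
    show "allowed A T c" "allowed A T (stab v c)"
      using recD(1) c stab_rec[OF c v] T allowed_subset by blast+
    show "c x < (\<Sum>y\<in>V. A x y)" "stab v c x < (\<Sum>y\<in>V. A x y)" if "x \<in> T" for x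
      using recD(2) c stab_rec[OF c v] T that by blast+
    show "int (stab v c x) = int (c x) + (\<Sum>y\<in>V. int (A x y) * (int (odo v c y) - int (odo v c x)))"
      if "x \<in> T" for x
      using stab_eq[of x v c] T that by auto
    show "int (odo v c y) = int K" if "x \<in> T" "y \<in> V - T" "A x y > 0" for x y
      using bd[OF that] by simp
  qed (use x in auto)
  thus ?thesis by simp
qed

lemma odo_pos_all:
  assumes c: "c \<in> recurrents" and v: "v \<in> V0" and T: "T \<subseteq> V0"
    and bd: "\<And>x y. x \<in> T \<Longrightarrow> y \<in> V - T \<Longrightarrow> A x y > 0 \<Longrightarrow> odo v c y > 0" and x: "x \<in> T"
  shows "odo v c x > 0"
proof (rule ccontr)
  assume "\<not> odo v c x > 0"
  define U where "U = {x \<in> T. odo v c x = 0}"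
  have U: "U \<subseteq> V0" "U \<noteq> {}" "U \<subseteq> V" using T x \<open>\<not> _\<close> by (auto simp: U_def V0_eq)
  obtain w where w: "w \<in> U" "(\<Sum>y\<in>U. A w y) \<le> c w"
    using allowedD[OF recD(1)[OF c] U(1,2)] by blast
  have wT: "w \<in> T" "odo v c w = 0" using w by (auto simp: U_def)
  have wV0: "w \<in> V0" and wV: "w \<in> V" using w U by auto
  have "(\<Sum>y\<in>V. int (A w y)) = (\<Sum>y\<in>U. int (A w y)) + (\<Sum>y\<in>V - U. int (A w y))"
    using sum.subset_diff[OF U(3) finV, of "\<lambda>y. int (A w y)"] by simp
  also have "(\<Sum>y\<in>V - U. int (A w y)) = (\<Sum>y\<in>V. if y \<in> U then 0 else int (A w y))"
    by (intro sum.mono_neutral_cong_left) auto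
  also have "\<dots> \<le> (\<Sum>y\<in>V. int (A w y) * (int (odo v c y) - int (odo v c w)))"
  proof (rule sum_mono)
    fix y assume y: "y \<in> V"
    show "(if y \<in> U then 0 else int (A w y)) \<le> int (A w y) * (int (odo v c y) - int (odo v c w))"
    proof (cases "y \<in> U \<or> A w y = 0")
      case True thus ?thesis using wT by auto
    next
      case False
      hence "odo v c y > 0" using bd[OF wT(1), of y] y by (cases "y \<in> T") (auto simp: U_def)
      hence "int (A w y) * 1 \<le> int (A w y) * int (odo v c y)" by (intro mult_left_mono) auto
      thus ?thesis using wT False by simp
    qed
  qed
  finally have "int (d w) \<le> int (stab v c w)"
    using stab_eq[OF wV0, of v c] w(2) d_eq[OF wV] by (simp flip: of_nat_sum split: if_splits)
  thus False using recD(3)[OF stab_rec[OF c v] wV0] by simp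
qed

end

context sandpile_cycle begin

definition gate :: "nat \<Rightarrow> 'v set" where "gate t = {x \<in> V. pos x = t \<and> x \<noteq> f t}"

lemma gate_cut: assumes "x \<in> gate t" "y \<in> V - gate t" "A x y > 0" shows "y = f t"
  using cut[of x t y] assms by (auto simp: gate_def)

lemma gate_V: "gate t \<subseteq> V" by (auto simp: gate_def)

lemma finite_gate [simp]: "finite (gate t)" using finite_subset[OF gate_V finV] .

lemma gate_V0: "0 < t \<Longrightarrow> gate t \<subseteq> V0" using V0_if_pos by (auto simp: gate_def)

lemma gate_row_sum: assumes "x \<in> gate t" "t < k" shows "(\<Sum>y\<in>insert (f t) (gate t). A x y) = d x"
proof (rule row_sum_closed)
  show "A x y = 0" if "y \<in> V - insert (f t) (gate t)" for y using gate_cut[OF assms(1), of y] that by auto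
qed (use assms gate_V f_V in auto)

lemma rec_glue_gate:
  assumes t: "0 < t" "t < k" and c: "c \<in> recurrents"
    and g: "\<And>x. x \<in> gate t \<Longrightarrow> c' x < d x" "allowed A (gate t) c'"
  shows "(\<lambda>x. if x \<in> gate t then c' x else c x) \<in> recurrents"
proof -
  let ?c = "\<lambda>x. if x \<in> gate t then c' x else c x"
  note gV0 = gate_V0[OF t(1)]
  have V0: "gate t \<union> (V0 - gate t) = V0" using gV0 by auto
  have "allowed A (gate t \<union> (V0 - gate t)) ?c"
  proof (rule allowed_glue[where q = "f t" and c = c])
    show "allowed A (gate t \<union> (V0 - gate t)) c" using recD(1)[OF c] V0 by simp
    show "allowed A (gate t) ?c" using g(2) by (rule allowed_mono) auto
    show "y = f t" if "x \<in> gate t" "y \<in> V0 - gate t" "A x y > 0" for x y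
      using gate_cut[of x t y] that by (auto simp: V0_eq)
    show "c x < (\<Sum>y\<in>insert (f t) (gate t). A x y)" if "x \<in> gate t" for x
      using gate_row_sum[OF that t(2)] recD(3)[OF c] that gV0 by auto
    show "?c x < (\<Sum>y\<in>insert (f t) (gate t). A x y)" if "x \<in> gate t" for x
      using gate_row_sum[OF that t(2)] g(1)[OF that] that by auto
  qed (auto simp: chips_sym)
  thus ?thesis using g(1) recD(3,4)[OF c] gV0 V0 by (auto simp: recurrents_def)
qed

lemma zero_pos_glue_gate:
  assumes t: "0 < t" "t < k" and c: "c \<in> recurrents" and c': "(\<lambda>x. if x \<in> gate t then c' x else c x) \<in> recurrents"
  shows "zero_pos (\<lambda>x. if x \<in> gate t then c' x else c x) = zero_pos c"
proof (rule zero_pos_eqI[OF c' zero_pos(1)[OF c]])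
  fix s assume s: "0 < s" "s < k"
  have "f s \<notin> gate t" using s by (auto simp: gate_def)
  thus "(if f s \<in> gate t then c' (f s) else c (f s)) + 1 + (if s = zero_pos c then 1 else 0) = d (f s)"
    using zero_pos(2)[OF c s] by simp
qed

end

locale two_cycles = B1: sandpile_cycle H p k f pos + B2: sandpile_cycle H p k' f' pos'
  for H :: "('v, 'e) mgraph" and p k f pos k' f' pos' +
  fixes a a' :: nat and v :: 'v
  assumes a: "0 < a" "a < k" and a': "0 < a'" "a' < k'" and joint: "f 0 = f' a'"
    and nested: "\<And>x. x \<in> verts H \<Longrightarrow> pos x \<noteq> 0 \<Longrightarrow> pos' x = a'"
    and v: "v \<in> B1.gate a"
begin

abbreviation "T \<equiv> B1.gate a"
abbreviation "T' \<equiv> B2.gate a'"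

lemma pos_T': "x \<in> verts H \<Longrightarrow> pos x \<noteq> 0 \<Longrightarrow> x \<in> T'"
  using nested[of x] joint a' B1.pos_f[of 0] B1.k3 by (auto simp: B2.gate_def)

lemma T_sub: "T \<subseteq> T'" using pos_T' a by (auto simp: B1.gate_def)

lemma f_T': "0 < t \<Longrightarrow> t < k \<Longrightarrow> f t \<in> T'" using pos_T' B1.f_V by auto

lemma f0_V0: "f 0 \<in> B1.V0" unfolding joint using B2.f_V0 a' by auto

lemma f0_notin: "f 0 \<notin> T'" using joint by (simp add: B2.gate_def)

lemma v_V0: "v \<in> B1.V0" using v B1.gate_V0 a by auto

lemma v_T': "v \<in> T'" using v T_sub by auto

lemma notin_T'D: "x \<in> verts H \<Longrightarrow> x \<notin> T' \<Longrightarrow> pos x = 0" using pos_T' by auto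

text \<open>An avalanche that reaches \<open>f a\<close> but not \<open>f 0\<close> fires exactly the part of the graph that hangs
  at the arc between \<open>f 0\<close> and the zero of the cycle.\<close>

lemma avalanche_shape:
  assumes c: "c \<in> B1.recurrents" and fa: "B1.odo v c (f a) > 0" and f0: "B1.odo v c (f 0) = 0"
  defines "z \<equiv> B1.zero_pos c"
  shows "0 < z" "z < k" "z \<noteq> a"
    and "\<And>x. x \<in> verts H \<Longrightarrow> B1.odo v c x > 0 \<longleftrightarrow> pos x \<in> ring_arc k a z"
    and "c (f 0) + 2 = degree H (f 0)"
    and "single_exit (chips H) (degree H) v T' (f 0) c (\<lambda>x. int (B1.odo v c x))"
proof -
  let ?u = "B1.odo v c"
  let ?A = "chips H" and ?V = "verts H"
  define g where "g t = (if t < k then int (?u (f t)) else 0)" for t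
  note v0 = v_V0
  have vpos: "pos v = a" "v \<in> ?V" "v \<noteq> f a" using v by (auto simp: B1.gate_def)
  have uout: "?u x = 0" if "x \<in> ?V" "pos x = 0" for x
  proof (cases "x = f 0 \<or> x = p")
    case True thus ?thesis using f0 B1.odo_outside[of p v c] by (auto simp: B1.V0_eq)
  next
    case False
    show ?thesis
    proof (rule B1.odo_const[OF c v0, of "{x \<in> ?V. pos x = 0 \<and> x \<noteq> f 0 \<and> x \<noteq> p}"])
      show "?u y = 0" if xy: "x \<in> {x \<in> ?V. pos x = 0 \<and> x \<noteq> f 0 \<and> x \<noteq> p}"
        "y \<in> ?V - {x \<in> ?V. pos x = 0 \<and> x \<noteq> f 0 \<and> x \<noteq> p}" "?A x y > 0" for x y
      proof -
        have "pos y = 0" using B1.cut[of x 0 y] xy by auto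
        hence "y = f 0 \<or> y = p" using xy by auto
        thus ?thesis using f0 B1.odo_outside[of p v c] by (auto simp: B1.V0_eq)
      qed
    qed (use that False a vpos in \<open>auto simp: B1.V0_eq\<close>)
  qed
  have uconst: "?u x = ?u (f t)" if "x \<in> ?V" "pos x = t" "t \<noteq> 0" "t \<noteq> a" for x t
  proof (cases "x = f t")
    case False
    show ?thesis
    proof (rule B1.odo_const[OF c v0, of "B1.gate t"])
      show "?u y = ?u (f t)" if "x \<in> B1.gate t" "y \<in> ?V - B1.gate t" "?A x y > 0" for x y
        using B1.gate_cut[OF that] by simp
    qed (use that False vpos B1.gate_V0 in \<open>auto simp: B1.gate_def\<close>)
  qed simp
  have upos: "?u x > 0" if "x \<in> ?V" "pos x = a" for x
  proof (cases "x = f a")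
    case False
    show ?thesis
    proof (rule B1.odo_pos_all[OF c v0, of "B1.gate a"])
      show "?u y > 0" if "x \<in> B1.gate a" "y \<in> ?V - B1.gate a" "?A x y > 0" for x y
        using B1.gate_cut[OF that] fa by simp
    qed (use that False B1.gate_V0 a in \<open>auto simp: B1.gate_def\<close>)
  qed (use fa in auto)
  have k3: "3 \<le> k" by (rule B1.k3)
  have g0: "g 0 = 0" using f0 k3 by (simp add: g_def)
  have gk: "g k = 0" by (simp add: g_def)
  have gnn: "g t \<ge> 0" for t by (simp add: g_def)
  have prvg: "int (?u (f (prv k t))) = g (t - 1)" if "0 < t" "t < k" for t using that by (simp add: g_def prv_def)
  have nxtg: "int (?u (f (nxt k t))) = g (t + 1)" if "t < k" for t using that f0 k3 by (auto simp: g_def nxt_def)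
  have c': "B1.stab v c \<in> B1.recurrents" by (rule B1.stab_rec[OF c v0])
  define z' where "z' = B1.zero_pos (B1.stab v c)"
  have conc: "g (t + 1) + g (t - 1) \<le> 2 * g t" if t: "0 < t" "t < k" "t \<noteq> a" "t \<noteq> z" for t
  proof -
    have "(\<Sum>y\<in>?V. int (?A (f t) y) * (int (?u y) - int (?u (f t)))) = g (t - 1) + g (t + 1) - 2 * g t"
      using B1.laplacian_on_cycle[OF t(2), of "\<lambda>x. int (?u x)"] uconst t prvg nxtg by (simp add: g_def)
    moreover have "f t \<noteq> v" using vpos t by auto
    moreover have "f t \<in> B1.V0" using B1.f_V0 t by simp
    moreover have "B1.stab v c (f t) < degree H (f t)" using B1.recD(3)[OF c'] B1.f_V0 t by simp
    moreover have "c (f t) + 1 = degree H (f t)" using B1.zero_pos(2)[OF c t(1,2)] t(4) by (simp add: z_def)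
    ultimately show ?thesis using B1.stab_eq[of "f t" v c] by simp
  qed
  have ex: "(\<Sum>y\<in>?V. int (?A (f 0) y) * (int (?u y) - int (?u (f 0)))) = g 1 + g (k - 1)"
    using B1.laplacian_on_cycle[of 0 "\<lambda>x. int (?u x)"] uout f0 k3 by (simp add: g_def prv_def nxt_def)
  have f0v: "f 0 \<noteq> v" using vpos a k3 B1.pos_f[of 0] by auto
  have eq0: "int (B1.stab v c (f 0)) = int (c (f 0)) + (g 1 + g (k - 1))"
    using B1.stab_eq[OF f0_V0, of v c] ex f0v by simp
  have c2: "degree H (f 0) \<le> c (f 0) + 2"
    using B2.at_least_two_missing[OF c, of a'] a' joint by simp
  have s1: "B1.stab v c (f 0) < degree H (f 0)" using B1.recD(3)[OF c' f0_V0] .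
  have out: "g 1 + g (k - 1) \<le> 1" using eq0 c2 s1 by linarith
  have ga: "g a > 0" using fa a by (simp add: g_def)
  note shape = concave_support[of g k a z, OF g0 gk gnn a ga conc out]
  show z: "0 < z" "z < k" "z \<noteq> a" using shape(3-5) by auto
  have one: "g 1 + g (k - 1) = 1" using shape(1,2) z(3) by linarith
  show "c (f 0) + 2 = degree H (f 0)" using eq0 one c2 s1 by linarith
  have supp: "g t > 0 \<longleftrightarrow> t \<in> ring_arc k a z" if "t < k" for t
    using shape(1,2) z that unfolding ring_arc_def by (cases "a < z") auto
  have arc_a: "a \<in> ring_arc k a z" "0 \<notin> ring_arc k a z" using a z by (auto simp: ring_arc_def)
  show fired: "?u x > 0 \<longleftrightarrow> pos x \<in> ring_arc k a z" if x: "x \<in> ?V" for x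
  proof -
    consider "pos x = 0" | "pos x = a" | "pos x \<noteq> 0" "pos x \<noteq> a" by blast
    thus ?thesis
    proof cases
      case 1 thus ?thesis using uout[OF x] arc_a by simp
    next
      case 2 thus ?thesis using upos[OF x] arc_a by simp
    next
      case 3
      have "?u x = ?u (f (pos x))" using uconst[OF x refl 3] .
      thus ?thesis using supp[of "pos x"] B1.pos_less[OF x] by (simp add: g_def)
    qed
  qed
  have restrict: "(\<Sum>y\<in>T'. int (?A x y) * int (?u y)) = (\<Sum>y\<in>?V. int (?A x y) * int (?u y))" for x
    using B2.gate_V notin_T'D uout by (intro sum.mono_neutral_left) auto
  show "single_exit ?A (degree H) v T' (f 0) c (\<lambda>x. int (?u x))"
    unfolding single_exit_def
  proof (intro exI[of _ "B1.stab v c"] conjI ballI)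
    have T'V0: "T' \<subseteq> B1.V0" using B2.gate_V0 a' by simp
    show "B1.stab v c x < degree H x" if "x \<in> T'" for x using B1.recD(3)[OF c'] that T'V0 by auto
    show "allowed ?A T' (B1.stab v c)" using allowed_subset[OF B1.recD(1)[OF c'] T'V0] .
    show "(\<Sum>y\<in>T'. int (?A (f 0) y) * int (?u y)) = 1" using ex one f0 unfolding restrict by simp
    show "int (B1.stab v c x) = int (c x) + (if x = v then 1 else 0) +
        (\<Sum>y\<in>T'. int (?A x y) * int (?u y)) - int (degree H x) * int (?u x)" if "x \<in> T'" for x
    proof -
      have x: "x \<in> B1.V0" "x \<in> ?V" using that T'V0 by (auto simp: B1.V0_eq)
      show ?thesis using B1.stab_eq[OF x(1), of v c] B1.d_eq[OF x(2)]
        unfolding restrict by (simp add: right_diff_distrib sum_subtractf sum_distrib_right)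
    qed
  qed
qed

lemma exit_step:
  assumes c: "c \<in> B1.recurrents" and ex: "single_exit (chips H) (degree H) v T (f a) c h"
    and z: "0 < B1.zero_pos c" "B1.zero_pos c \<noteq> a"
  shows "\<exists>h'. single_exit (chips H) (degree H) v T' (f 0) c h' \<and> h' (f a) > 0"
proof -
  let ?A = "chips H" and ?V = "verts H"
  define z where "z = B1.zero_pos c"
  define z' where "z' = moved_zero k a z"
  have zk: "0 < z" "z < k" "z \<noteq> a" using z B1.zero_pos(1)[OF c] by (auto simp: z_def)
  note tent = tent[OF a zk]
  have z'k: "z' < k" using tent(5) by (simp add: z'_def)
  obtain e where e: "\<And>x. x \<in> T \<Longrightarrow> e x < degree H x" "allowed ?A T e"
    "\<And>x. x \<in> T \<Longrightarrow> int (e x) = int (c x) + (if x = v then 1 else 0) + (\<Sum>y\<in>T. int (?A x y) * h y) - int (degree H x) * h x"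
    "(\<Sum>y\<in>T. int (?A (f a) y) * h y) = 1"
    using ex unfolding single_exit_def by blast
  define e1 where "e1 = (\<lambda>x. if x \<in> T then e x else c x)"
  have e1: "e1 \<in> B1.recurrents" unfolding e1_def using e by (intro B1.rec_glue_gate a c) auto
  have ze1: "B1.zero_pos e1 = z"
    using B1.zero_pos_glue_gate[OF a c e1[unfolded e1_def]] by (simp add: e1_def z_def)
  define e2 where "e2 = B1.set_zero z' e1"
  have e2: "e2 \<in> B1.recurrents" unfolding e2_def by (rule B1.set_zero_rec[OF e1 z'k])
  define hT where "hT = (\<lambda>x. if x \<in> T then h x else 0)"
  define G where "G = (\<lambda>x. tent k a z (pos x))"
  define h' where "h' = (\<lambda>x. hT x + G x)"
  have T'V0: "T' \<subseteq> B1.V0" using B2.gate_V0 a' by simp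
  have TV: "T \<subseteq> ?V" by (rule B1.gate_V)
  have hTsum: "(\<Sum>y\<in>?V. int (?A x y) * hT y) = (\<Sum>y\<in>T. int (?A x y) * h y)" for x
    unfolding hT_def using TV by (intro sum.mono_neutral_cong_right) auto
  have lapT: "(\<Sum>y\<in>?V. int (?A x y) * (hT y - hT x)) =
      (if x \<in> T then int (e x) - int (c x) - (if x = v then 1 else 0) else if x = f a then 1 else 0)"
    if x: "x \<in> ?V" for x
  proof -
    have s: "(\<Sum>y\<in>?V. int (?A x y) * (hT y - hT x)) = (\<Sum>y\<in>T. int (?A x y) * h y) - int (degree H x) * hT x"
      using B1.d_eq[OF x] hTsum[of x] by (simp add: right_diff_distrib sum_subtractf sum_distrib_right)
    consider "x \<in> T" | "x = f a" "x \<notin> T" | "x \<noteq> f a" "x \<notin> T" by blast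
    thus ?thesis
    proof cases
      case 1 thus ?thesis using s e(3)[OF 1] by (simp add: hT_def)
    next
      case 2 thus ?thesis using s e(4) by (simp add: hT_def)
    next
      case 3
      have "(\<Sum>y\<in>T. int (?A x y) * h y) = 0"
      proof (rule sum.neutral, rule ballI)
        fix y assume "y \<in> T"
        thus "int (?A x y) * h y = 0"
          using B1.gate_cut[of y a x] 3 x chips_sym[of H x y] by (cases "?A x y") auto
      qed
      thus ?thesis using s 3 by (simp add: hT_def)
    qed
  qed
  have Gf: "G (f t) = tent k a z t" if "t < k" for t using that by (simp add: G_def)
  have k3: "3 \<le> k" by (rule B1.k3)
  have lapG: "(\<Sum>y\<in>?V. int (?A (f t) y) * (G y - G (f t))) =
      (if t = z then 1 else 0) - (if t = z' then 1 else 0) - (if t = a then 1 else 0)" if t: "0 < t" "t < k" for t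
  proof -
    have eq: "(\<Sum>y\<in>?V. int (?A (f t) y) * (G y - G (f t))) = G (f (prv k t)) + G (f (nxt k t)) - 2 * G (f t)"
      using B1.laplacian_on_cycle[OF t(2), of G] t by (simp add: G_def)
    have p: "G (f (prv k t)) = tent k a z (t - 1)" using Gf t by (simp add: prv_def)
    have n: "G (f (nxt k t)) = tent k a z (t + 1)" using Gf[of 0] Gf[of "t + 1"] t tent(1,2) by (auto simp: nxt_def)
    show ?thesis using eq tent(7)[OF t] by (simp only: p n Gf[OF t(2)] z'_def)
  qed
  have lapG0: "(\<Sum>y\<in>?V. int (?A x y) * (G y - G x)) = 0" if "x \<in> ?V" "x \<noteq> f (pos x)" for x
    using B1.laplacian_off_cycle[of x G] that by (simp add: G_def)
  have split: "(\<Sum>y\<in>?V. int (?A x y) * (h' y - h' x)) =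
      (\<Sum>y\<in>?V. int (?A x y) * (hT y - hT x)) + (\<Sum>y\<in>?V. int (?A x y) * (G y - G x))" for x
    by (simp add: h'_def algebra_simps sum.distrib sum_subtractf)
  have fT: "f t \<notin> T" if "t < k" for t using that by (auto simp: B1.gate_def)
  have main: "int (e2 x) = int (c x) + (if x = v then 1 else 0) + (\<Sum>y\<in>?V. int (?A x y) * (h' y - h' x))"
    if x: "x \<in> T'" for x
  proof -
    have xV: "x \<in> ?V" using x B2.gate_V by auto
    have xf0: "x \<noteq> f 0" using x f0_notin by auto
    show ?thesis
    proof (cases "x = f (pos x)")
      case True
      define t where "t = pos x"
      have t: "0 < t" "t < k" "x = f t" using True xf0 B1.pos_less[OF xV] by (auto simp: t_def intro: Nat.gr0I)
      have "f t \<notin> T" "x \<noteq> v" using fT[OF t(2)] v t(3) by auto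
      have "e2 x = degree H (f t) - 1 - (if t = z' then 1 else 0)"
        unfolding e2_def t(3) by (rule B1.set_zero_f[OF t(1,2) z'k])
      moreover have "2 \<le> degree H (f t)" by (rule B1.two_le_degree[OF t(2)])
      ultimately have e2x: "int (e2 x) = int (degree H (f t)) - 1 - (if t = z' then 1 else 0)" by auto
      have cx: "int (c x) = int (degree H (f t)) - 1 - (if t = z then 1 else 0)"
        using B1.zero_pos(2)[OF c t(1,2)] t(3) by (simp add: z_def split: if_splits)
      have "f t = f a \<longleftrightarrow> t = a" using B1.f_inj t a by blast
      hence "(\<Sum>y\<in>?V. int (?A x y) * (hT y - hT x)) = (if t = a then 1 else 0)"
        using lapT[OF xV] \<open>f t \<notin> T\<close> t(3) by simp
      thus ?thesis using split[of x] lapG[OF t(1,2)] t(3) e2x cx \<open>x \<noteq> v\<close> by simp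
    next
      case False
      have "x \<notin> f ` {1..<k}" using False B1.pos_f by auto
      hence e2x: "e2 x = e1 x" unfolding e2_def B1.set_zero_def by simp
      have xfa: "x \<noteq> f a" using False B1.pos_f[OF a(2)] by metis
      show ?thesis
      proof (cases "x \<in> T")
        case True
        thus ?thesis using split[of x] lapG0[OF xV False] lapT[OF xV] e2x by (simp add: e1_def)
      next
        case F: False
        hence "x \<noteq> v" using v by auto
        thus ?thesis using split[of x] lapG0[OF xV False] lapT[OF xV] e2x F xfa by (simp add: e1_def)
      qed
    qed
  qed
  have h'out: "h' x = 0" if "x \<in> ?V" "x \<notin> T'" for x
    using that notin_T'D[OF that] T_sub tent(1) by (auto simp: h'_def hT_def G_def)
  have restrict: "(\<Sum>y\<in>T'. int (?A x y) * h' y) = (\<Sum>y\<in>?V. int (?A x y) * h' y)" for x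
    using B2.gate_V h'out by (intro sum.mono_neutral_left) auto
  have "single_exit ?A (degree H) v T' (f 0) c h'"
    unfolding single_exit_def
  proof (intro exI[of _ e2] conjI ballI)
    show "e2 x < degree H x" if "x \<in> T'" for x using B1.recD(3)[OF e2] that T'V0 by auto
    show "allowed ?A T' e2" using allowed_subset[OF B1.recD(1)[OF e2] T'V0] .
    show "int (e2 x) = int (c x) + (if x = v then 1 else 0) +
        (\<Sum>y\<in>T'. int (?A x y) * h' y) - int (degree H x) * h' x" if "x \<in> T'" for x
    proof -
      have x: "x \<in> ?V" using that B2.gate_V by auto
      show ?thesis using main[OF that] B1.d_eq[OF x]
        unfolding restrict by (simp add: right_diff_distrib sum_subtractf sum_distrib_right)
    qed
    have f0: "f 0 \<in> ?V" "f 0 \<notin> T" using B1.f_V[of 0] fT[of 0] k3 by auto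
    have f0a: "f 0 \<noteq> f a" using B1.f_inj[of 0 a] a k3 by auto
    have "(\<Sum>y\<in>?V. int (?A (f 0) y) * (G y - G (f 0))) = 1"
      using B1.laplacian_on_cycle[of 0 G] k3 Gf[of 0] Gf[of 1] Gf[of "k - 1"] tent(1,4)
      by (simp add: G_def prv_def nxt_def)
    hence "(\<Sum>y\<in>?V. int (?A (f 0) y) * (h' y - h' (f 0))) = 1"
      using split[of "f 0"] lapT[OF f0(1)] f0 f0a by simp
    thus "(\<Sum>y\<in>T'. int (?A (f 0) y) * h' y) = 1"
      using h'out[OF f0(1) f0_notin] unfolding restrict by simp
  qed
  moreover have "h' (f a) > 0" using tent(3) fT[OF a(2)] Gf[OF a(2)] by (simp add: h'_def hT_def)
  ultimately show ?thesis by blast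
qed

lemma exit_final:
  assumes c: "c \<in> B1.recurrents" and ex: "single_exit (chips H) (degree H) v T' (f 0) c h"
    and z: "c (f 0) + 2 = degree H (f 0)" and x: "x \<in> verts H"
  shows "int (B1.odo v c x) = (if x \<in> T' then h x else 0)"
proof -
  let ?A = "chips H" and ?V = "verts H"
  obtain e where e: "\<And>x. x \<in> T' \<Longrightarrow> e x < degree H x" "allowed ?A T' e"
    "\<And>x. x \<in> T' \<Longrightarrow> int (e x) = int (c x) + (if x = v then 1 else 0) + (\<Sum>y\<in>T'. int (?A x y) * h y) - int (degree H x) * h x"
    "(\<Sum>y\<in>T'. int (?A (f 0) y) * h y) = 1"
    using ex unfolding single_exit_def by blast
  define e1 where "e1 = (\<lambda>x. if x \<in> T' then e x else c x)"
  have e1: "e1 \<in> B1.recurrents" unfolding e1_def using e by (intro B2.rec_glue_gate a' c) auto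
  define e2 where "e2 = e1(f 0 := c (f 0) + 1)"
  have T'V0: "T' \<subseteq> B1.V0" using B2.gate_V0 a' by simp
  have e2: "e2 \<in> B1.recurrents"
  proof -
    have "allowed ?A B1.V0 e2"
      using B1.recD(1)[OF e1] by (rule allowed_mono) (use f0_notin in \<open>auto simp: e2_def e1_def\<close>)
    thus ?thesis using B1.recD(3,4)[OF e1] f0_V0 z by (auto simp: B1.recurrents_def e2_def)
  qed
  define h' where "h' = (\<lambda>x. if x \<in> T' then h x else 0)"
  have hsum: "(\<Sum>y\<in>?V. int (?A x y) * h' y) = (\<Sum>y\<in>T'. int (?A x y) * h y)" for x
    unfolding h'_def using B2.gate_V by (intro sum.mono_neutral_cong_right) auto
  have s: "(\<Sum>y\<in>?V. int (?A x y) * (h' y - h' x)) = (\<Sum>y\<in>T'. int (?A x y) * h y) - int (degree H x) * h' x"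
    if "x \<in> ?V" for x
    using B1.d_eq[OF that] hsum[of x] by (simp add: right_diff_distrib sum_subtractf sum_distrib_right)
  have "int (B1.odo v c x) = h' x"
  proof (rule B1.odo_unique[OF c v_V0 e2 _ _ x])
    show "h' x = 0" if "x \<notin> B1.V0" for x using that T'V0 by (auto simp: h'_def)
    fix x assume x0: "x \<in> B1.V0"
    have x: "x \<in> ?V" using x0 by (simp add: B1.V0_eq)
    consider "x \<in> T'" | "x = f 0" "x \<notin> T'" | "x \<noteq> f 0" "x \<notin> T'" by blast
    thus "int (e2 x) = int (c x) + (if x = v then 1 else 0) + (\<Sum>y\<in>?V. int (?A x y) * (h' y - h' x))"
    proof cases
      case 1
      hence "x \<noteq> f 0" using f0_notin by auto
      thus ?thesis using s[OF x] e(3)[OF 1] 1 by (simp add: h'_def e2_def e1_def)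
    next
      case 2
      hence "x \<noteq> v" using v_T' by auto
      thus ?thesis using s[OF x] e(4) 2 by (simp add: h'_def e2_def e1_def)
    next
      case 3
      have "(\<Sum>y\<in>T'. int (?A x y) * h y) = 0"
      proof (rule sum.neutral, rule ballI)
        fix y assume "y \<in> T'"
        thus "int (?A x y) * h y = 0"
          using B2.gate_cut[of y a' x] 3 x chips_sym[of H x y] joint by (cases "?A x y") auto
      qed
      moreover have "x \<noteq> v" using 3 v_T' by auto
      ultimately show ?thesis using s[OF x] 3 by (simp add: h'_def e2_def e1_def)
    qed
  qed
  thus ?thesis by (simp add: h'_def)
qed

lemma mass_location:
  assumes c: "c \<in> B1.recurrents" and lo: "card (insert (f a) T) \<le> Mav H {p} c v"
    and hi: "Mav H {p} c v < card (insert (f 0) T')"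
  shows "B1.odo v c (f a) > 0" "B1.odo v c (f 0) = 0"
proof -
  let ?F = "{x \<in> verts H. B1.odo v c x > 0}"
  have M: "Mav H {p} c v = card ?F" by (rule B1.Mav_eq)
  show "B1.odo v c (f a) > 0"
  proof (rule ccontr)
    assume "\<not> B1.odo v c (f a) > 0"
    hence fa: "B1.odo v c (f a) = 0" by simp
    have out: "B1.odo v c x = 0" if "x \<in> verts H" "x \<notin> T" for x
    proof (cases "x = f a \<or> x = p")
      case True thus ?thesis using fa B1.odo_outside[of p v c] by (auto simp: B1.V0_eq)
    next
      case False
      show ?thesis
      proof (rule B1.odo_const[OF c v_V0, of "B1.V0 - insert (f a) T"])
        show "B1.odo v c y = 0" if "x \<in> B1.V0 - insert (f a) T" "y \<in> verts H - (B1.V0 - insert (f a) T)" "chips H x y > 0" for x y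
          using B1.gate_cut[of y a x] that fa B1.odo_outside[of p v c] chips_sym[of H x y]
          by (auto simp: B1.V0_eq)
      qed (use that False v in \<open>auto simp: B1.V0_eq\<close>)
    qed
    have "?F \<subseteq> T"
    proof
      fix x assume "x \<in> ?F"
      thus "x \<in> T" using out[of x] by (cases "x \<in> T") auto
    qed
    hence "card ?F \<le> card T" by (intro card_mono) auto
    moreover have "card (insert (f a) T) = Suc (card T)" by (simp add: B1.gate_def)
    ultimately show False using lo M by simp
  qed
  show "B1.odo v c (f 0) = 0"
  proof (rule ccontr)
    assume "B1.odo v c (f 0) \<noteq> 0"
    have "B1.odo v c x > 0" if "x \<in> T'" for x
    proof (rule B1.odo_pos_all[OF c v_V0 _ _ that])
      show "T' \<subseteq> B1.V0" using B2.gate_V0 a' by simp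
      show "B1.odo v c y > 0" if "x \<in> T'" "y \<in> verts H - T'" "chips H x y > 0" for x y
        using B2.gate_cut[OF that] joint \<open>B1.odo v c (f 0) \<noteq> 0\<close> by simp
    qed
    hence "insert (f 0) T' \<subseteq> ?F" using \<open>B1.odo v c (f 0) \<noteq> 0\<close> B2.gate_V B1.f_V[of 0] B1.k3 by auto
    hence "card (insert (f 0) T') \<le> card ?F" by (intro card_mono) auto
    thus False using hi M by simp
  qed
qed

end

section \<open>Counting recurrent configurations\<close>

definition depends_on :: "'v set \<Rightarrow> (('v \<Rightarrow> nat) \<Rightarrow> bool) \<Rightarrow> bool" where
  "depends_on T P \<longleftrightarrow> (\<forall>c c'. (\<forall>x\<in>T. c x = c' x) \<longrightarrow> P c = P c')"

lemma depends_onD: "depends_on T P \<Longrightarrow> (\<And>x. x \<in> T \<Longrightarrow> c x = c' x) \<Longrightarrow> P c \<longleftrightarrow> P c'"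
  by (auto simp: depends_on_def)

definition local_rec :: "('v \<Rightarrow> 'v \<Rightarrow> nat) \<Rightarrow> ('v \<Rightarrow> nat) \<Rightarrow> 'v set \<Rightarrow> ('v \<Rightarrow> nat) set" where
  "local_rec A d T = {c. (\<forall>x. x \<notin> T \<longrightarrow> c x = 0) \<and> (\<forall>x\<in>T. c x < d x) \<and> allowed A T c}"

lemma local_rec_cong:
  assumes "\<And>x. x \<in> T \<Longrightarrow> d x = d' x" "\<And>x y. x \<in> T \<Longrightarrow> y \<in> T \<Longrightarrow> A x y = A' x y"
  shows "local_rec A d T = local_rec A' d' T"
proof -
  have "allowed A T c \<longleftrightarrow> allowed A' T c" for c using assms(2) by (intro allowed_cong) auto
  thus ?thesis using assms(1) unfolding local_rec_def by auto
qed

lemma card_image_fibres: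
  assumes "finite X" "g ` X \<subseteq> Y" "finite Y" "\<And>y. y \<in> Y \<Longrightarrow> card {x \<in> X. g x = y} = n"
  shows "card X = card Y * n"
proof -
  have "card X = (\<Sum>y\<in>Y. card {x \<in> X. g x = y})"
    using sum.group[OF assms(1,3,2), of "\<lambda>_. 1::nat"] by simp
  thus ?thesis using assms(4) by simp
qed

context sandpile_cycle begin

lemma card_zero_pos:
  assumes inv: "\<And>c z. c \<in> recurrents \<Longrightarrow> z < k \<Longrightarrow> P (set_zero z c) \<longleftrightarrow> P c" and B: "B \<subseteq> {..<k}"
  shows "card {c \<in> recurrents. P c \<and> zero_pos c \<in> B} * k = card B * card {c \<in> recurrents. P c}"
proof -
  let ?X = "{c \<in> recurrents. P c}"
  define n where "n = card {c \<in> ?X. zero_pos c = 0}"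
  have fib: "card {c \<in> ?X. zero_pos c = z} = n" if z: "z < k" for z
  proof -
    have "bij_betw (set_zero 0) {c \<in> ?X. zero_pos c = z} {c \<in> ?X. zero_pos c = 0}"
    proof (rule bij_betw_byWitness[where f' = "set_zero z"])
      show "\<forall>c\<in>{c \<in> ?X. zero_pos c = z}. set_zero z (set_zero 0 c) = c"
        using set_zero_zero_pos by (auto simp: set_zero_set_zero)
      show "\<forall>c\<in>{c \<in> ?X. zero_pos c = 0}. set_zero 0 (set_zero z c) = c"
        using set_zero_zero_pos by (auto simp: set_zero_set_zero) metis
      show "set_zero 0 ` {c \<in> ?X. zero_pos c = z} \<subseteq> {c \<in> ?X. zero_pos c = 0}"
        using inv[of _ 0] zero_pos_set_zero[of _ 0] set_zero_rec[of _ 0] k3 by auto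
      show "set_zero z ` {c \<in> ?X. zero_pos c = 0} \<subseteq> {c \<in> ?X. zero_pos c = z}"
        using inv[of _ z] zero_pos_set_zero[of _ z] set_zero_rec[of _ z] z by auto
    qed
    thus ?thesis unfolding n_def by (rule bij_betw_same_card)
  qed
  have "card {c \<in> recurrents. P c \<and> zero_pos c \<in> B} = card B * n"
  proof (rule card_image_fibres[where g = zero_pos])
    show "finite B" using B finite_subset by blast
    fix z assume z: "z \<in> B"
    have "{c \<in> {c \<in> recurrents. P c \<and> zero_pos c \<in> B}. zero_pos c = z} = {c \<in> ?X. zero_pos c = z}" using z by auto
    thus "card {c \<in> {c \<in> recurrents. P c \<and> zero_pos c \<in> B}. zero_pos c = z} = n" using fib B z by auto
  qed auto
  moreover have "card ?X = card {..<k} * n"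
    using zero_pos(1) fib by (intro card_image_fibres[where g = zero_pos]) auto
  ultimately show ?thesis by simp
qed

lemma card_gate:
  assumes t: "0 < t" "t < k" and dep: "depends_on (gate t) P"
  shows "card {c \<in> recurrents. P c} * card (local_rec A d (gate t)) = card {c \<in> local_rec A d (gate t). P c} * card recurrents"
    and "finite (local_rec A d (gate t))"
proof -
  let ?R = "local_rec A d (gate t)"
  define rst where "rst c = (\<lambda>x. if x \<in> gate t then c x else 0::nat)" for c :: "'v \<Rightarrow> nat"
  define glue where "glue r c = (\<lambda>x. if x \<in> gate t then r x else c x)" for r c :: "'v \<Rightarrow> nat"
  have rst: "rst c \<in> ?R" if "c \<in> recurrents" for c
  proof -
    have "allowed A (gate t) (rst c)"
      using allowed_subset[OF recD(1)[OF that] gate_V0[OF t(1)]] by (rule allowed_mono) (simp add: rst_def)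
    thus ?thesis using recD(3)[OF that] gate_V0[OF t(1)] by (auto simp: local_rec_def rst_def)
  qed
  have glue: "glue r c \<in> recurrents" if "r \<in> ?R" "c \<in> recurrents" for r c
    unfolding glue_def using that by (intro rec_glue_gate[OF t]) (auto simp: local_rec_def)
  have rstg: "rst (glue r c) = r" if "r \<in> ?R" for r c
    using that by (auto simp: rst_def glue_def local_rec_def)
  obtain c0 where c0: "c0 \<in> recurrents" using rec_ne by auto
  have R_sub: "?R \<subseteq> rst ` recurrents" using rstg glue c0 by (metis image_eqI subsetI)
  show finR: "finite ?R" using finite_subset[OF R_sub] by simp
  define n where "n = card {c \<in> recurrents. rst c = rst c0}"
  have fib: "card {c \<in> recurrents. rst c = r} = n" if r: "r \<in> ?R" for r
  proof -
    have g: "glue (rst c) c' = c" if "rst c' = rst c" "\<And>x. x \<notin> gate t \<Longrightarrow> c x = c' x" for c c'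
      using that by (auto simp: rst_def glue_def fun_eq_iff)
    have "bij_betw (glue (rst c0)) {c \<in> recurrents. rst c = r} {c \<in> recurrents. rst c = rst c0}"
    proof (rule bij_betw_byWitness[where f' = "glue r"])
      show "\<forall>c\<in>{c \<in> recurrents. rst c = r}. glue r (glue (rst c0) c) = c"
        by (auto simp: glue_def rst_def fun_eq_iff)
      show "\<forall>c\<in>{c \<in> recurrents. rst c = rst c0}. glue (rst c0) (glue r c) = c"
        by (auto simp: glue_def rst_def fun_eq_iff)
      show "glue (rst c0) ` {c \<in> recurrents. rst c = r} \<subseteq> {c \<in> recurrents. rst c = rst c0}"
        using rstg glue rst c0 by auto
      show "glue r ` {c \<in> recurrents. rst c = rst c0} \<subseteq> {c \<in> recurrents. rst c = r}"
        using rstg glue r by auto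
    qed
    thus ?thesis unfolding n_def by (rule bij_betw_same_card)
  qed
  have "card {c \<in> recurrents. P c} = card {c \<in> ?R. P c} * n"
  proof (rule card_image_fibres[where g = rst])
    have e: "P (rst c) \<longleftrightarrow> P c" for c by (rule depends_onD[OF dep]) (simp add: rst_def)
    show "rst ` {c \<in> recurrents. P c} \<subseteq> {c \<in> ?R. P c}" using rst e by auto
    fix r assume r: "r \<in> {c \<in> ?R. P c}"
    have "{c \<in> {c \<in> recurrents. P c}. rst c = r} = {c \<in> recurrents. rst c = r}" using r e by auto
    thus "card {c \<in> {c \<in> recurrents. P c}. rst c = r} = n" using fib r by simp
  qed (use finR in auto)
  moreover have "card recurrents = card ?R * n"
    using rst fib finR by (intro card_image_fibres[where g = rst]) auto
  ultimately show "card {c \<in> recurrents. P c} * card ?R = card {c \<in> ?R. P c} * card recurrents" by simp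
qed

end

context two_cycles begin

lemma f'_notin: "s < k' \<Longrightarrow> f' s \<notin> T'"
  using B2.pos_f[of s] by (auto simp: B2.gate_def)

lemma depends_on_set_zero:
  assumes "depends_on T' P" "z < k'" shows "P (B2.set_zero z c) \<longleftrightarrow> P c"
  by (rule depends_onD[OF assms(1)]) (use f'_notin in \<open>auto simp: B2.set_zero_def\<close>)

lemma depends_on_zero_pos: "depends_on T' (\<lambda>c. Q (B1.zero_pos c))"
  unfolding depends_on_def
proof (intro allI impI)
  fix c c' assume "\<forall>x\<in>T'. c x = (c' x :: nat)"
  hence "c (f t) = c' (f t)" if "0 < t" "t < k" for t using f_T' that by auto
  hence "(0 < t \<and> t < k \<and> c (f t) + 2 = degree H (f t)) = (0 < t \<and> t < k \<and> c' (f t) + 2 = degree H (f t))" for t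
    by auto
  thus "Q (B1.zero_pos c) = Q (B1.zero_pos c')" unfolding B1.zero_pos_def by presburger
qed

lemma depends_on_mono: "depends_on S P \<Longrightarrow> S \<subseteq> S' \<Longrightarrow> depends_on S' P"
  unfolding depends_on_def by (meson subsetD)

lemma ring_arc_card_less:
  assumes "0 < z" "z < k" "z' < k" "0 < z'" "z \<noteq> a" "z' \<noteq> a" "z < z'"
  shows "a < z \<Longrightarrow> card {x \<in> verts H. pos x \<in> ring_arc k a z} < card {x \<in> verts H. pos x \<in> ring_arc k a z'}"
    and "z' < a \<Longrightarrow> card {x \<in> verts H. pos x \<in> ring_arc k a z'} < card {x \<in> verts H. pos x \<in> ring_arc k a z}"
proof -
  assume "a < z"
  hence "f z \<in> {x \<in> verts H. pos x \<in> ring_arc k a z'} - {x \<in> verts H. pos x \<in> ring_arc k a z}"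
    "{x \<in> verts H. pos x \<in> ring_arc k a z} \<subseteq> {x \<in> verts H. pos x \<in> ring_arc k a z'}"
    using assms B1.f_V by (auto simp: ring_arc_def)
  thus "card {x \<in> verts H. pos x \<in> ring_arc k a z} < card {x \<in> verts H. pos x \<in> ring_arc k a z'}"
    by (intro psubset_card_mono) auto
next
  assume "z' < a"
  hence "f z' \<in> {x \<in> verts H. pos x \<in> ring_arc k a z} - {x \<in> verts H. pos x \<in> ring_arc k a z'}"
    "{x \<in> verts H. pos x \<in> ring_arc k a z'} \<subseteq> {x \<in> verts H. pos x \<in> ring_arc k a z}"
    using assms B1.f_V by (auto simp: ring_arc_def)
  thus "card {x \<in> verts H. pos x \<in> ring_arc k a z'} < card {x \<in> verts H. pos x \<in> ring_arc k a z}"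
    by (intro psubset_card_mono) auto
qed

lemma avalanche_mass:
  assumes c: "c \<in> B1.recurrents" and fa: "B1.odo v c (f a) > 0" and f0: "B1.odo v c (f 0) = 0"
  shows "Mav H {p} c v = card {x \<in> verts H. pos x \<in> ring_arc k a (B1.zero_pos c)}"
proof -
  have "{x \<in> verts H. B1.odo v c x > 0} = {x \<in> verts H. pos x \<in> ring_arc k a (B1.zero_pos c)}"
    using avalanche_shape(4)[OF assms] by blast
  thus ?thesis unfolding B1.Mav_eq by simp
qed

lemma zero_pos_joint: "c \<in> B1.recurrents \<Longrightarrow> B2.zero_pos c = a' \<longleftrightarrow> c (f 0) + 2 = degree H (f 0)"
  using B2.zero_pos(2)[of c a'] a' joint by (auto split: if_splits)

lemma card_mass_le:
  assumes lo: "card (insert (f a) T) \<le> M" and hi: "M < card (insert (f 0) T')"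
  shows "card {c \<in> B1.recurrents. Mav H {p} c v = M} * (k * k') \<le> 2 * card B1.recurrents"
proof -
  let ?w = "\<lambda>z. card {x \<in> verts H. pos x \<in> ring_arc k a z}"
  define Z where "Z = {z. 0 < z \<and> z < k \<and> z \<noteq> a \<and> ?w z = M}"
  have Zk: "Z \<subseteq> {..<k}" by (auto simp: Z_def)
  hence finZ: "finite Z" using finite_subset by blast
  have "Z \<inter> {..<a} \<subseteq> {z}" if "z \<in> Z \<inter> {..<a}" for z
    using that ring_arc_card_less(2)[of z] ring_arc_card_less(2)[of _ z]
    by (auto simp: Z_def) (metis less_irrefl linorder_neqE_nat)
  hence c1: "card (Z \<inter> {..<a}) \<le> 1" by (metis card.empty card_mono finite.intros is_singletonI is_singleton_altdef all_not_in_conv zero_le_one)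
  have "Z \<inter> {a<..} \<subseteq> {z}" if "z \<in> Z \<inter> {a<..}" for z
    using that ring_arc_card_less(1)[of z] ring_arc_card_less(1)[of _ z]
    by (auto simp: Z_def) (metis less_irrefl linorder_neqE_nat)
  hence c2: "card (Z \<inter> {a<..}) \<le> 1" by (metis card.empty card_mono finite.intros is_singletonI is_singleton_altdef all_not_in_conv zero_le_one)
  have "Z = (Z \<inter> {..<a}) \<union> (Z \<inter> {a<..})" by (auto simp: Z_def)
  hence "card Z \<le> card (Z \<inter> {..<a}) + card (Z \<inter> {a<..})" by (metis card_Un_le)
  hence cZ: "card Z \<le> 2" using c1 c2 by linarith
  let ?E = "{c \<in> B1.recurrents. B1.zero_pos c \<in> Z \<and> B2.zero_pos c \<in> {a'}}"
  have sub: "{c \<in> B1.recurrents. Mav H {p} c v = M} \<subseteq> ?E"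
  proof (intro subsetI CollectI conjI)
    fix c assume "c \<in> {c \<in> B1.recurrents. Mav H {p} c v = M}"
    hence c: "c \<in> B1.recurrents" "Mav H {p} c v = M" by auto
    have o: "B1.odo v c (f a) > 0" "B1.odo v c (f 0) = 0" using mass_location[OF c(1)] lo hi c(2) by auto
    note s = avalanche_shape[OF c(1) o]
    show "c \<in> B1.recurrents" by fact
    show "B1.zero_pos c \<in> Z" using s(1-3) avalanche_mass[OF c(1) o] c(2) by (simp add: Z_def)
    show "B2.zero_pos c \<in> {a'}" using s(5) zero_pos_joint[OF c(1)] by simp
  qed
  have "card {c \<in> B1.recurrents. B1.zero_pos c \<in> Z \<and> B2.zero_pos c \<in> {a'}} * k' =
      card {a'} * card {c \<in> B1.recurrents. B1.zero_pos c \<in> Z}"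
    using depends_on_set_zero[OF depends_on_zero_pos[of "\<lambda>x. x \<in> Z"]] a' by (intro B2.card_zero_pos) auto
  moreover have "card {c \<in> B1.recurrents. True \<and> B1.zero_pos c \<in> Z} * k = card Z * card {c \<in> B1.recurrents. True}"
    by (rule B1.card_zero_pos[OF _ Zk]) simp
  ultimately have "card ?E * (k * k') = card Z * card B1.recurrents" by (simp add: algebra_simps)
  moreover have "card Z * card B1.recurrents \<le> 2 * card B1.recurrents" using cZ by (rule mult_right_mono) simp
  moreover have "card {c \<in> B1.recurrents. Mav H {p} c v = M} \<le> card ?E" by (rule card_mono[OF _ sub]) simp
  ultimately show ?thesis using mult_le_mono1[of "card {c \<in> B1.recurrents. Mav H {p} c v = M}" "card ?E" "k * k'"] by linarith
qed

lemma mass_iff: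
  assumes c: "c \<in> B1.recurrents" and lo: "card (insert (f a) T) \<le> M" and hi: "M < card (insert (f 0) T')"
  shows "Mav H {p} c v = M \<longleftrightarrow> c (f 0) + 2 = degree H (f 0) \<and>
    (\<exists>h. single_exit (chips H) (degree H) v T' (f 0) c h \<and> card {x \<in> T'. h x > 0} = M)"
proof
  assume M: "Mav H {p} c v = M"
  have o: "B1.odo v c (f a) > 0" "B1.odo v c (f 0) = 0" using mass_location[OF c] lo hi M by auto
  note s = avalanche_shape[OF c o]
  have "x \<in> T'" if "x \<in> verts H" "B1.odo v c x > 0" for x
    using s(4)[OF that(1)] that pos_T'[of x] by (auto simp: ring_arc_def split: if_splits)
  hence "{x \<in> T'. int (B1.odo v c x) > 0} = {x \<in> verts H. B1.odo v c x > 0}" using B2.gate_V by auto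
  hence "card {x \<in> T'. int (B1.odo v c x) > 0} = M" using M B1.Mav_eq[of c v] by simp
  thus "c (f 0) + 2 = degree H (f 0) \<and>
    (\<exists>h. single_exit (chips H) (degree H) v T' (f 0) c h \<and> card {x \<in> T'. h x > 0} = M)"
    using s(5,6) by blast
next
  assume R: "c (f 0) + 2 = degree H (f 0) \<and>
    (\<exists>h. single_exit (chips H) (degree H) v T' (f 0) c h \<and> card {x \<in> T'. h x > 0} = M)"
  then obtain h where h: "single_exit (chips H) (degree H) v T' (f 0) c h" "card {x \<in> T'. h x > 0} = M" by blast
  have "B1.odo v c x > 0 \<longleftrightarrow> x \<in> T' \<and> h x > 0" if "x \<in> verts H" for x
  proof -
    have "int (B1.odo v c x) = (if x \<in> T' then h x else 0)"
      using exit_final[OF c h(1) _ that] R by blast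
    thus ?thesis by (cases "x \<in> T'") auto
  qed
  hence "{x \<in> verts H. B1.odo v c x > 0} = {x \<in> T'. h x > 0}"
    using B2.gate_V by blast
  thus "Mav H {p} c v = M" using h(2) B1.Mav_eq by simp
qed

end

locale cycle_chain = sandpile H p for H :: "('v, 'e) mgraph" and p +
  fixes k :: "nat \<Rightarrow> nat" and f :: "nat \<Rightarrow> nat \<Rightarrow> 'v" and pos :: "nat \<Rightarrow> 'v \<Rightarrow> nat"
    and a :: "nat \<Rightarrow> nat" and v :: 'v and J N :: nat
  assumes gateds: "\<And>j. J \<le> j \<Longrightarrow> j \<le> N \<Longrightarrow> gated_cycle (chips H) (verts H) (k j) (f j) (pos j)"
    and pos_ps: "\<And>j. J \<le> j \<Longrightarrow> j \<le> N \<Longrightarrow> pos j p = 0"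
    and as: "\<And>j. J \<le> j \<Longrightarrow> j \<le> N \<Longrightarrow> 0 < a j \<and> a j < k j"
    and joints: "\<And>j. J \<le> j \<Longrightarrow> j < N \<Longrightarrow> f j 0 = f (Suc j) (a (Suc j))"
    and nesteds: "\<And>j x. J \<le> j \<Longrightarrow> j < N \<Longrightarrow> x \<in> verts H \<Longrightarrow> pos j x \<noteq> 0 \<Longrightarrow> pos (Suc j) x = a (Suc j)"
    and vs: "\<And>j. J \<le> j \<Longrightarrow> j \<le> N \<Longrightarrow> v \<in> verts H \<and> pos j v = a j \<and> v \<noteq> f j (a j)"
begin

definition inner :: "nat \<Rightarrow> 'v set" where
  "inner j = {x \<in> verts H. pos j x = a j \<and> x \<noteq> f j (a j)}"

lemma cycle: "J \<le> j \<Longrightarrow> j \<le> N \<Longrightarrow> sandpile_cycle H p (k j) (f j) (pos j)"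
  using gateds pos_ps by unfold_locales auto

lemma gate_eq: "J \<le> j \<Longrightarrow> j \<le> N \<Longrightarrow> sandpile_cycle.gate H (f j) (pos j) (a j) = inner j"
  by (simp add: sandpile_cycle.gate_def[OF cycle] inner_def)

lemma two: assumes "J \<le> j" "j < N"
  shows "two_cycles H p (k j) (f j) (pos j) (k (Suc j)) (f (Suc j)) (pos (Suc j)) (a j) (a (Suc j)) v"
proof -
  interpret B1: sandpile_cycle H p "k j" "f j" "pos j" using cycle assms by simp
  interpret B2: sandpile_cycle H p "k (Suc j)" "f (Suc j)" "pos (Suc j)" using cycle assms by simp
  show ?thesis
  proof (unfold_locales)
    show "0 < a j" "a j < k j" "0 < a (Suc j)" "a (Suc j) < k (Suc j)" using as assms by auto
    show "f j 0 = f (Suc j) (a (Suc j))" using joints assms by auto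
    show "pos (Suc j) x = a (Suc j)" if "x \<in> verts H" "pos j x \<noteq> 0" for x
      using nesteds[OF assms that] .
    show "v \<in> B1.gate (a j)" using vs[of j] assms unfolding B1.gate_def by simp
  qed
qed

abbreviation "exits j c h \<equiv> single_exit (chips H) (degree H) v (inner j) (f j (a j)) c h"

lemma card_mass_ge:
  assumes ij: "J \<le> i1" "i1 \<le> i" "i < N"
    and c1: "c1 \<in> local_rec (chips H) (degree H) (inner i1)" "exits i1 c1 h1"
    and z: "0 < z" "z < k i" "z \<noteq> a i" and M: "M = card {x \<in> verts H. pos i x \<in> ring_arc (k i) (a i) z}"
  shows "card recurrents * (\<Prod>j=i1..<i. k j - 2) \<le>
    card {c \<in> recurrents. Mav H {p} c v = M} * card (local_rec (chips H) (degree H) (inner i1)) * (\<Prod>j=i1..<i. k j) * (k i * k (Suc i))"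
proof -
  let ?R = "local_rec (chips H) (degree H) (inner i1)"
  let ?z = "\<lambda>j. sandpile_cycle.zero_pos H (k j) (f j)"
  define P where "P m c \<longleftrightarrow> (\<forall>x\<in>inner i1. c x = c1 x) \<and> (\<forall>j\<in>{i1..<m}. ?z j c \<in> {..<k j} - {0, a j})" for m c
  have base: "card {c \<in> recurrents. P i1 c} * card ?R = card recurrents"
  proof -
    interpret B: sandpile_cycle H p "k i1" "f i1" "pos i1" using cycle ij by simp
    have g: "B.gate (a i1) = inner i1" using gate_eq ij by simp
    have d: "depends_on (B.gate (a i1)) (P i1)" unfolding depends_on_def g P_def by simp
    have "c = c1" if "c \<in> ?R" "P i1 c" for c
    proof
      fix x show "c x = c1 x"
        using that c1(1) by (cases "x \<in> inner i1") (auto simp: P_def local_rec_def)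
    qed
    moreover have "P i1 c1" by (simp add: P_def)
    ultimately have "{c \<in> ?R. P i1 c} = {c1}" using c1(1) by blast
    thus ?thesis using B.card_gate(1)[OF _ _ d] as[of i1] ij by (simp add: g)
  qed
  have step: "depends_on (inner m) (P m) \<and>
      card {c \<in> recurrents. P m c} * (\<Prod>j=i1..<m. k j) = card {c \<in> recurrents. P i1 c} * (\<Prod>j=i1..<m. k j - 2) \<and>
      (\<forall>c\<in>recurrents. P m c \<longrightarrow> (\<exists>h. exits m c h))" if "i1 \<le> m" "m \<le> i" for m
    using that
  proof (induction m rule: dec_induct)
    case base
    have "depends_on (inner i1) (P i1)" by (simp add: depends_on_def P_def)
    moreover have "exits i1 c h1" if "P i1 c" for c
      using c1(2) single_exit_cong[of "inner i1" c c1 "degree H" "degree H" "f i1 (a i1)" "chips H" "chips H" h1 h1 v] that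
      by (simp add: P_def)
    ultimately show ?case by auto
  next
    case (step m)
    hence IH: "depends_on (inner m) (P m)"
      "card {c \<in> recurrents. P m c} * (\<Prod>j=i1..<m. k j) = card {c \<in> recurrents. P i1 c} * (\<Prod>j=i1..<m. k j - 2)"
      "\<And>c. c \<in> recurrents \<Longrightarrow> P m c \<Longrightarrow> \<exists>h. exits m c h" and mN: "m < N" "J \<le> m" using ij by auto
    interpret two_cycles H p "k m" "f m" "pos m" "k (Suc m)" "f (Suc m)" "pos (Suc m)" "a m" "a (Suc m)" v
      by (rule two[OF mN(2,1)])
    have g: "B1.gate (a m) = inner m" "B2.gate (a (Suc m)) = inner (Suc m)" using gate_eq mN by auto
    have PS: "P (Suc m) c \<longleftrightarrow> P m c \<and> B1.zero_pos c \<in> {..<k m} - {0, a m}" for c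
      using step(1) by (auto simp: P_def less_Suc_eq)
    have d: "depends_on (inner (Suc m)) (P (Suc m))"
    proof -
      have "depends_on (inner (Suc m)) (P m)" using depends_on_mono[OF IH(1)] T_sub g by simp
      moreover have "depends_on (inner (Suc m)) (\<lambda>c. B1.zero_pos c \<in> {..<k m} - {0, a m})"
        using depends_on_zero_pos[of "\<lambda>z. z \<in> {..<k m} - {0, a m}"] g by simp
      ultimately show ?thesis unfolding depends_on_def PS by blast
    qed
    have inv: "P m (B1.set_zero z c) \<longleftrightarrow> P m c" if "z < k m" for z c
    proof (rule depends_onD[OF IH(1)])
      fix x assume "x \<in> inner m"
      hence "x \<notin> f m ` {1..<k m}" using B1.pos_f by (auto simp: inner_def)
      thus "B1.set_zero z c x = c x" unfolding B1.set_zero_def by simp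
    qed
    have "card {c \<in> recurrents. P m c \<and> B1.zero_pos c \<in> {..<k m} - {0, a m}} * k m =
        card ({..<k m} - {0, a m}) * card {c \<in> recurrents. P m c}"
      by (rule B1.card_zero_pos) (use inv in auto)
    moreover have "card ({..<k m} - {0, a m}) = k m - 2"
      using as[of m] mN by (subst card_Diff_subset) auto
    ultimately have cnt: "card {c \<in> recurrents. P (Suc m) c} * k m = (k m - 2) * card {c \<in> recurrents. P m c}"
      unfolding PS by simp
    have "card {c \<in> recurrents. P (Suc m) c} * (\<Prod>j=i1..<Suc m. k j) =
        (card {c \<in> recurrents. P (Suc m) c} * k m) * (\<Prod>j=i1..<m. k j)"
      using step(1) by (simp add: prod.atLeastLessThan_Suc algebra_simps)
    also have "\<dots> = (k m - 2) * (card {c \<in> recurrents. P m c} * (\<Prod>j=i1..<m. k j))"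
      unfolding cnt by (simp add: algebra_simps)
    also have "\<dots> = card {c \<in> recurrents. P i1 c} * (\<Prod>j=i1..<Suc m. k j - 2)"
      unfolding IH(2) using step(1) by (simp add: prod.atLeastLessThan_Suc algebra_simps)
    finally have e: "card {c \<in> recurrents. P (Suc m) c} * (\<Prod>j=i1..<Suc m. k j) =
        card {c \<in> recurrents. P i1 c} * (\<Prod>j=i1..<Suc m. k j - 2)" .
    have x: "\<exists>h. exits (Suc m) c h" if c: "c \<in> recurrents" and "P (Suc m) c" for c
    proof -
      have Pm: "P m c" and "B1.zero_pos c \<in> {..<k m} - {0, a m}" using that(2) unfolding PS by auto
      hence zc: "0 < B1.zero_pos c" "B1.zero_pos c \<noteq> a m" by auto
      obtain h where h: "exits m c h" using IH(3)[OF c Pm] by blast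
      have h1: "single_exit (chips H) (degree H) v (B1.gate (a m)) (f m (a m)) c h" unfolding g by (rule h)
      have "\<exists>h'. single_exit (chips H) (degree H) v (B2.gate (a (Suc m))) (f m 0) c h'"
        using exit_step[OF c h1 zc] by blast
      thus ?thesis unfolding g joints[OF mN(2,1)] .
    qed
    show ?case using d e x by blast
  qed
  interpret two_cycles H p "k i" "f i" "pos i" "k (Suc i)" "f (Suc i)" "pos (Suc i)" "a i" "a (Suc i)" v
    using two ij by simp
  have g: "B1.gate (a i) = inner i" "B2.gate (a (Suc i)) = inner (Suc i)" using gate_eq ij by auto
  note S = step[OF ij(2) order_refl]
  let ?E = "{c \<in> recurrents. (P i c \<and> B1.zero_pos c \<in> {z}) \<and> B2.zero_pos c \<in> {a (Suc i)}}"
  have sub: "?E \<subseteq> {c \<in> recurrents. Mav H {p} c v = M}"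
  proof
    fix c assume "c \<in> ?E"
    hence c: "c \<in> recurrents" "P i c" "B1.zero_pos c = z" "B2.zero_pos c = a (Suc i)" by blast+
    obtain h where h: "exits i c h" using S c by blast
    have h1: "single_exit (chips H) (degree H) v (B1.gate (a i)) (f i (a i)) c h" unfolding g by (rule h)
    have zc: "0 < B1.zero_pos c" "B1.zero_pos c \<noteq> a i" using z c(3) by auto
    obtain h' where h': "single_exit (chips H) (degree H) v T' (f i 0) c h'" "h' (f i (a i)) > 0"
      using exit_step[OF c(1) h1 zc] by blast
    have c0: "c (f i 0) + 2 = degree H (f i 0)" using zero_pos_joint[OF c(1)] c(4) by simp
    note o = exit_final[OF c(1) h'(1) c0]
    have "f i (a i) \<in> T'" using f_T' as[of i] ij by auto
    moreover from this have "f i (a i) \<in> verts H" using B2.gate_V by blast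
    ultimately have o1: "odo v c (f i (a i)) > 0" using o[of "f i (a i)"] h'(2) by simp
    have o2: "odo v c (f i 0) = 0" using o[of "f i 0"] f0_notin f0_V0 by (simp add: V0_eq)
    show "c \<in> {c \<in> recurrents. Mav H {p} c v = M}" using avalanche_mass[OF c(1) o1 o2] M c by simp
  qed
  have dz: "depends_on T' (\<lambda>c. P i c \<and> B1.zero_pos c \<in> {z})"
  proof -
    have "depends_on T' (P i)"
      by (rule depends_on_mono[OF S[THEN conjunct1]]) (use T_sub in \<open>simp only: g\<close>)
    thus ?thesis using depends_on_zero_pos[of "\<lambda>x. x \<in> {z}"] unfolding depends_on_def by blast
  qed
  have "card ?E * k (Suc i) = card {a (Suc i)} * card {c \<in> recurrents. P i c \<and> B1.zero_pos c \<in> {z}}"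
    using depends_on_set_zero[OF dz] as[of "Suc i"] ij by (intro B2.card_zero_pos) auto
  moreover have "card {c \<in> recurrents. P i c \<and> B1.zero_pos c \<in> {z}} * k i = card {z} * card {c \<in> recurrents. P i c}"
  proof (rule B1.card_zero_pos)
    show "P i (B1.set_zero z c) \<longleftrightarrow> P i c" if "z < k i" for z c
    proof (rule depends_onD[OF S[THEN conjunct1]])
      fix x assume "x \<in> inner i"
      hence "x \<notin> f i ` {1..<k i}" using B1.pos_f by (auto simp: inner_def)
      thus "B1.set_zero z c x = c x" unfolding B1.set_zero_def by simp
    qed
  qed (use z in auto)
  ultimately have E: "card ?E * (k i * k (Suc i)) = card {c \<in> recurrents. P i c}" by (simp add: algebra_simps)
  have "card recurrents * (\<Prod>j=i1..<i. k j - 2) = card ?R * (card {c \<in> recurrents. P i1 c} * (\<Prod>j=i1..<i. k j - 2))"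
    using base by (simp add: algebra_simps)
  also have "\<dots> = card ?R * (card ?E * (k i * k (Suc i)) * (\<Prod>j=i1..<i. k j))"
    using S E by simp
  also have "\<dots> = card ?E * (card ?R * (\<Prod>j=i1..<i. k j) * (k i * k (Suc i)))" by (simp add: algebra_simps)
  also have "\<dots> \<le> card {c \<in> recurrents. Mav H {p} c v = M} * (card ?R * (\<Prod>j=i1..<i. k j) * (k i * k (Suc i)))"
    by (intro mult_right_mono card_mono sub) auto
  finally show ?thesis by (simp add: algebra_simps)
qed

lemma mass_exits:
  assumes ij: "J \<le> i" "i < N" and c: "c \<in> recurrents"
    and lo: "card (insert (f i (a i)) (inner i)) \<le> Mav H {p} c v"
    and hi: "Mav H {p} c v < card (insert (f (Suc i) (a (Suc i))) (inner (Suc i)))"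
  shows "\<exists>z. 0 < z \<and> z < k i \<and> z \<noteq> a i \<and> Mav H {p} c v = card {x \<in> verts H. pos i x \<in> ring_arc (k i) (a i) z}"
    and "\<exists>h. exits (Suc i) c h"
proof -
  interpret two_cycles H p "k i" "f i" "pos i" "k (Suc i)" "f (Suc i)" "pos (Suc i)" "a i" "a (Suc i)" v
    using two ij by simp
  have g: "B1.gate (a i) = inner i" "B2.gate (a (Suc i)) = inner (Suc i)" using gate_eq ij by auto
  have o: "odo v c (f i (a i)) > 0" "odo v c (f i 0) = 0"
    using mass_location[OF c] lo hi g joints[OF ij] by auto
  note s = avalanche_shape[OF c o]
  show "\<exists>z. 0 < z \<and> z < k i \<and> z \<noteq> a i \<and> Mav H {p} c v = card {x \<in> verts H. pos i x \<in> ring_arc (k i) (a i) z}"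
    using s(1-3) avalanche_mass[OF c o] by blast
  show "\<exists>h. exits (Suc i) c h" using s(6) g joints[OF ij] by auto
qed

lemma avalanche_prob_local:
  assumes ij: "J \<le> i" "Suc i < N"
    and lo: "card (insert (f i (a i)) (inner i)) \<le> M"
    and hi: "M < card (insert (f (Suc i) (a (Suc i))) (inner (Suc i)))"
  defines "R \<equiv> local_rec (chips H) (degree H) (inner (Suc (Suc i)))"
  shows "avalanche_prob H {p} v M = card {c \<in> R. c (f i 0) + 2 = degree H (f i 0) \<and>
    (\<exists>h. exits (Suc i) c h \<and> card {x \<in> inner (Suc i). h x > 0} = M)} / card R"
proof -
  interpret two_cycles H p "k i" "f i" "pos i" "k (Suc i)" "f (Suc i)" "pos (Suc i)" "a i" "a (Suc i)" v
    using two ij by simp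
  interpret BB: two_cycles H p "k (Suc i)" "f (Suc i)" "pos (Suc i)" "k (Suc (Suc i))" "f (Suc (Suc i))"
    "pos (Suc (Suc i))" "a (Suc i)" "a (Suc (Suc i))" v
    using two ij by simp
  have g: "B1.gate (a i) = inner i" "B2.gate (a (Suc i)) = inner (Suc i)"
    "BB.B2.gate (a (Suc (Suc i))) = inner (Suc (Suc i))" using gate_eq ij by auto
  have j: "f i 0 = f (Suc i) (a (Suc i))" using joints ij by simp
  define P where "P c \<longleftrightarrow> c (f i 0) + 2 = degree H (f i 0) \<and>
    (\<exists>h. exits (Suc i) c h \<and> card {x \<in> inner (Suc i). h x > 0} = M)" for c
  have "Mav H {p} c v = M \<longleftrightarrow> P c" if "c \<in> recurrents" for c
    using mass_iff[OF that, of M] lo hi g j by (simp add: P_def)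
  hence eq: "{c \<in> recurrents. Mav H {p} c v = M} = {c \<in> recurrents. P c}" by auto
  have dep: "depends_on (BB.B2.gate (a (Suc (Suc i)))) P"
    unfolding depends_on_def g
  proof (intro allI impI)
    fix c c' :: "'v \<Rightarrow> nat" assume cc: "\<forall>x\<in>inner (Suc (Suc i)). c x = c' x"
    have "f i 0 \<in> inner (Suc (Suc i))" using BB.f_T'[of "a (Suc i)"] as[of "Suc i"] ij g j by simp
    moreover have "inner (Suc i) \<subseteq> inner (Suc (Suc i))" using BB.T_sub g by simp
    ultimately have "c (f i 0) = c' (f i 0)" "\<And>x. x \<in> inner (Suc i) \<Longrightarrow> c x = c' x" using cc by auto
    thus "P c = P c'" unfolding P_def
      using single_exit_cong[of "inner (Suc i)" c c' "degree H" "degree H" "f (Suc i) (a (Suc i))" "chips H" "chips H" _ _ v]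
      by simp
  qed
  have cg: "card {c \<in> recurrents. P c} * card R = card {c \<in> R. P c} * card recurrents" "finite R"
    using BB.B2.card_gate[OF _ _ dep] as[of "Suc (Suc i)"] ij unfolding g R_def by auto
  have pos: "card recurrents > 0" using rec_ne by (simp add: card_gt_0_iff)
  have Rpos: "card R > 0"
  proof -
    have t: "depends_on (BB.B2.gate (a (Suc (Suc i)))) (\<lambda>c. True)" by (simp add: depends_on_def)
    obtain c0 where c0: "c0 \<in> recurrents" using rec_ne by auto
    have sub: "inner (Suc (Suc i)) \<subseteq> V0"
      using BB.B2.gate_V0[of "a (Suc (Suc i))"] as[of "Suc (Suc i)"] ij unfolding g by auto
    have "allowed (chips H) (inner (Suc (Suc i))) (\<lambda>x. if x \<in> inner (Suc (Suc i)) then c0 x else 0)"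
      using allowed_subset[OF recD(1)[OF c0] sub] by (rule allowed_mono) simp
    hence "(\<lambda>x. if x \<in> inner (Suc (Suc i)) then c0 x else 0) \<in> R"
      using recD(3)[OF c0] sub unfolding R_def local_rec_def by auto
    thus ?thesis using cg(2) by (auto simp: card_gt_0_iff)
  qed
  have n: "real (card recurrents) \<noteq> 0" "real (card R) \<noteq> 0" using pos Rpos by linarith+
  have "real (card {c \<in> recurrents. P c}) * real (card R) = real (card {c \<in> R. P c}) * real (card recurrents)"
    using cg(1) by (simp only: flip: of_nat_mult)
  hence "real (card {c \<in> recurrents. P c}) / real (card recurrents) = real (card {c \<in> R. P c}) / real (card R)"
    by (simp only: frac_eq_eq[OF n])
  thus ?thesis unfolding avalanche_prob_eq eq P_def .
qed

end

section \<open>Blocks and their gates\<close>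

lemma adjacent_sym: "adjacent G x y \<longleftrightarrow> adjacent G y x"
  by (auto simp: adjacent_def insert_commute)

lemma rtranclp_flip:
  assumes "r\<^sup>*\<^sup>* x y" "\<And>x y. r x y \<Longrightarrow> r y x" shows "r\<^sup>*\<^sup>* y x"
  using assms(1) by (induction rule: rtranclp_induct) (auto intro: converse_rtranclp_into_rtranclp assms(2))

lemma adjacent_rtranclp_sym: "(adjacent G)\<^sup>*\<^sup>* x y \<Longrightarrow> (adjacent G)\<^sup>*\<^sup>* y x"
  by (rule rtranclp_flip) (simp_all add: adjacent_sym)

lemma connected_mgraphI:
  assumes "\<And>x. x \<in> verts G \<Longrightarrow> \<exists>s\<in>S. (adjacent G)\<^sup>*\<^sup>* x s"
    and "\<And>s t. s \<in> S \<Longrightarrow> t \<in> S \<Longrightarrow> (adjacent G)\<^sup>*\<^sup>* s t"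
  shows "connected_mgraph G"
  unfolding connected_mgraph_def
proof (intro ballI)
  fix x y assume "x \<in> verts G" "y \<in> verts G"
  then obtain s t where "s \<in> S" "t \<in> S" "(adjacent G)\<^sup>*\<^sup>* x s" "(adjacent G)\<^sup>*\<^sup>* y t" using assms(1) by metis
  thus "(adjacent G)\<^sup>*\<^sup>* x y"
    using assms(2)[of s t] adjacent_rtranclp_sym[of G y t] by (meson rtranclp_trans)
qed

lemma connectedD: "connected_mgraph G \<Longrightarrow> x \<in> verts G \<Longrightarrow> y \<in> verts G \<Longrightarrow> (adjacent G)\<^sup>*\<^sup>* x y"
  by (simp add: connected_mgraph_def)

lemma adjacent_mono:
  assumes "edges B \<subseteq> edges G" "ends B = ends G" "adjacent B x y" shows "adjacent G x y"
  using assms by (auto simp: adjacent_def)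

lemma adjacent_rtranclp_mono:
  assumes "\<And>x y. adjacent B x y \<Longrightarrow> adjacent G x y" "(adjacent B)\<^sup>*\<^sup>* x y" shows "(adjacent G)\<^sup>*\<^sup>* x y"
  using assms(2)
proof (induction rule: rtranclp_induct)
  case (step y z)
  from step(3) assms(1)[OF step(2)] show ?case by (rule rtranclp.rtrancl_into_rtrancl)
qed simp

lemma adjacent_verts: "wf_mgraph G \<Longrightarrow> adjacent G x y \<Longrightarrow> x \<in> verts G \<and> y \<in> verts G"
  by (auto simp: adjacent_def wf_mgraph_def)

lemma verts_delete: "verts (delete_verts G {z}) = verts G - {z}"
  by (auto simp: delete_verts_def induced_def)

lemma adjacent_delete: "wf_mgraph G \<Longrightarrow> adjacent (delete_verts G {z}) x y \<longleftrightarrow> adjacent G x y \<and> x \<noteq> z \<and> y \<noteq> z"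
proof -
  assume wf: "wf_mgraph G"
  have "{x, y} \<subseteq> verts G - {z} \<longleftrightarrow> x \<noteq> z \<and> y \<noteq> z" if "e \<in> edges G" "ends G e = {x, y}" for e
    using wf that by (auto simp: wf_mgraph_def)
  thus ?thesis by (fastforce simp: adjacent_def delete_verts_def induced_def)
qed

lemma two_connected_delete:
  assumes "two_connected B" "wf_mgraph B" "x \<in> verts B - {z}" "y \<in> verts B - {z}"
  shows "(adjacent (delete_verts B {z}))\<^sup>*\<^sup>* x y"
proof (cases "z \<in> verts B")
  case True
  hence "connected_mgraph (delete_verts B {z})"
    using assms(1) by (auto simp: two_connected_def cut_vertex_def)
  thus ?thesis using assms by (intro connectedD) (auto simp: verts_delete)
next
  case False
  have "(adjacent B)\<^sup>*\<^sup>* x y" using assms by (auto simp: two_connected_def intro: connectedD)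
  moreover have "adjacent (delete_verts B {z}) a b" if "adjacent B a b" for a b
    using that adjacent_verts[OF assms(2) that] False assms(2) by (auto simp: adjacent_delete)
  ultimately show ?thesis using adjacent_rtranclp_mono by metis
qed

lemma two_connected_ear:
  fixes w :: "nat \<Rightarrow> 'v" and g :: "nat \<Rightarrow> 'e" and B :: "('v, 'e) mgraph"
  assumes B: "two_connected B" "wf_mgraph B"
    and w: "w 0 \<in> verts B" "w n \<in> verts B" "inj_on w {..n}"
    and g: "\<And>i. i < n \<Longrightarrow> ends B (g i) = {w i, w (Suc i)}"
  defines "B' \<equiv> \<lparr>verts = verts B \<union> w ` {..n}, edges = edges B \<union> g ` {..<n}, ends = ends B\<rparr>"
  shows "wf_mgraph B'" "two_connected B'"
proof -
  have ne: "w i \<noteq> w (Suc i)" if "i < n" for i using inj_onD[OF w(3), of i "Suc i"] that by auto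
  show wf: "wf_mgraph B'"
    unfolding wf_mgraph_def
  proof
    fix e assume "e \<in> edges B'"
    then consider "e \<in> edges B" | i where "i < n" "e = g i" by (auto simp: B'_def)
    thus "ends B' e \<subseteq> verts B' \<and> card (ends B' e) \<in> {1, 2}"
    proof cases
      case 1 thus ?thesis using B(2) by (auto simp: B'_def wf_mgraph_def)
    next
      case 2 thus ?thesis using g[OF 2(1)] ne[OF 2(1)] by (auto simp: B'_def)
    qed
  qed
  have adjB: "adjacent B' x y" if "adjacent B x y" for x y using that by (auto simp: adjacent_def B'_def)
  have adjw: "adjacent B' (w i) (w (Suc i))" if "i < n" for i
    using g[OF that] that by (auto simp: adjacent_def B'_def intro!: bexI[of _ "g i"])
  have conn: "connected_mgraph B'"
  proof (rule connected_mgraphI[where S = "verts B"])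
    fix x assume "x \<in> verts B'"
    then consider "x \<in> verts B" | i where "i \<le> n" "x = w i" by (auto simp: B'_def)
    thus "\<exists>s\<in>verts B. (adjacent B')\<^sup>*\<^sup>* x s"
    proof cases
      case 2
      have "i \<le> n \<Longrightarrow> (adjacent B')\<^sup>*\<^sup>* (w 0) (w i)" for i
      proof (induction i)
        case (Suc i)
        from Suc adjw[of i] show ?case by (auto intro: rtranclp.rtrancl_into_rtrancl)
      qed simp
      thus ?thesis using 2 w(1) adjacent_rtranclp_sym by metis
    qed auto
  next
    fix s t assume "s \<in> verts B" "t \<in> verts B"
    hence "(adjacent B)\<^sup>*\<^sup>* s t" using B(1) by (auto simp: two_connected_def intro: connectedD)
    thus "(adjacent B')\<^sup>*\<^sup>* s t" by (rule adjacent_rtranclp_mono[rotated]) (rule adjB)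
  qed
  have "connected_mgraph (delete_verts B' {z})" for z
  proof (rule connected_mgraphI[where S = "verts B - {z}"])
    let ?D = "delete_verts B' {z}"
    fix x assume "x \<in> verts ?D"
    hence x: "x \<in> verts B'" "x \<noteq> z" by (auto simp: verts_delete)
    then consider "x \<in> verts B" | j where "j \<le> n" "x = w j" by (auto simp: B'_def)
    thus "\<exists>s\<in>verts B - {z}. (adjacent ?D)\<^sup>*\<^sup>* x s"
    proof cases
      case 2
      have "z \<notin> w ` {..j} \<or> z \<notin> w ` {j..n}"
      proof (rule ccontr)
        assume "\<not> ?thesis"
        then obtain i i' where "i \<in> {..j}" "z = w i" "i' \<in> {j..n}" "z = w i'" by blast
        hence ii: "z = w i" "i \<le> j" "z = w i'" "j \<le> i'" "i' \<le> n" by auto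
        hence "i = i'" using inj_onD[OF w(3), of i i'] 2 by auto
        thus False using ii 2 x by auto
      qed
      thus ?thesis
      proof
        assume z: "z \<notin> w ` {..j}"
        have "i \<le> j \<Longrightarrow> (adjacent ?D)\<^sup>*\<^sup>* (w 0) (w i)" for i
        proof (induction i)
          case (Suc i)
          have "adjacent ?D (w i) (w (Suc i))" using adjw[of i] Suc 2 z wf by (auto simp: adjacent_delete)
          thus ?case using Suc by (auto intro: rtranclp.rtrancl_into_rtrancl)
        qed auto
        from this[of j] have "(adjacent ?D)\<^sup>*\<^sup>* x (w 0)" unfolding 2(2) by (rule adjacent_rtranclp_sym) simp
        moreover have "w 0 \<noteq> z" using z by auto
        ultimately show ?thesis using w(1) by auto
      next
        assume z: "z \<notin> w ` {j..n}"
        have "j \<le> i \<Longrightarrow> i \<le> n \<Longrightarrow> (adjacent ?D)\<^sup>*\<^sup>* (w j) (w i)" for i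
        proof (induction i rule: dec_induct)
          case (step i)
          have "adjacent ?D (w i) (w (Suc i))" using adjw[of i] step 2 z wf by (auto simp: adjacent_delete)
          thus ?case using step by (auto intro: rtranclp.rtrancl_into_rtrancl)
        qed auto
        hence "(adjacent ?D)\<^sup>*\<^sup>* x (w n)" using 2 by auto
        moreover have "w n \<noteq> z" using z 2 by auto
        ultimately show ?thesis using w(2) by auto
      qed
    qed (use x in auto)
  next
    fix s t assume "s \<in> verts B - {z}" "t \<in> verts B - {z}"
    hence "(adjacent (delete_verts B {z}))\<^sup>*\<^sup>* s t" using two_connected_delete B by metis
    thus "(adjacent (delete_verts B' {z}))\<^sup>*\<^sup>* s t"
      by (rule adjacent_rtranclp_mono[rotated]) (use adjB wf B(2) in \<open>auto simp: adjacent_delete\<close>)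
  qed
  hence "\<nexists>z. cut_vertex B' z" by (auto simp: cut_vertex_def)
  moreover have "\<exists>x\<in>verts B'. \<exists>y\<in>verts B'. x \<noteq> y"
  proof -
    obtain x y where "x \<in> verts B" "y \<in> verts B" "x \<noteq> y" using B(1) by (auto simp: two_connected_def)
    moreover have "verts B \<subseteq> verts B'" by (auto simp: B'_def)
    ultimately show ?thesis by blast
  qed
  ultimately show "two_connected B'" using conn unfolding two_connected_def by blast
qed

lemma two_connected_union:
  assumes B: "two_connected B" "wf_mgraph B" and B': "two_connected B'" "wf_mgraph B'"
    and ends: "ends B' = ends B"
    and xy: "x \<in> verts B \<inter> verts B'" "y \<in> verts B \<inter> verts B'" "x \<noteq> y"
  defines "U \<equiv> \<lparr>verts = verts B \<union> verts B', edges = edges B \<union> edges B', ends = ends B\<rparr>"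
  shows "wf_mgraph U" "two_connected U"
proof -
  show wf: "wf_mgraph U" using B(2) B'(2) ends by (auto simp: wf_mgraph_def U_def)
  have adj: "adjacent B a b \<Longrightarrow> adjacent U a b" "adjacent B' a b \<Longrightarrow> adjacent U a b" for a b
    using ends by (auto simp: adjacent_def U_def)
  have del: "connected_mgraph (delete_verts U {z})" for z
  proof -
    let ?D = "delete_verts U {z}"
    obtain t where t: "t \<in> verts B - {z}" "t \<in> verts B' - {z}" using xy by blast
    show ?thesis
    proof (rule connected_mgraphI[where S = "{t}"])
      fix a assume "a \<in> verts ?D"
      hence "a \<in> verts B - {z} \<or> a \<in> verts B' - {z}" by (auto simp: verts_delete U_def)
      hence "(adjacent (delete_verts B {z}))\<^sup>*\<^sup>* a t \<or> (adjacent (delete_verts B' {z}))\<^sup>*\<^sup>* a t"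
        using two_connected_delete[OF B] two_connected_delete[OF B'] t by blast
      moreover have "adjacent ?D a b" if "adjacent (delete_verts B {z}) a b" for a b
        using that adj wf B(2) by (auto simp: adjacent_delete)
      moreover have "adjacent ?D a b" if "adjacent (delete_verts B' {z}) a b" for a b
        using that adj wf B'(2) by (auto simp: adjacent_delete)
      ultimately have "(adjacent ?D)\<^sup>*\<^sup>* a t"
        using adjacent_rtranclp_mono[of _ ?D a t] by blast
      thus "\<exists>s\<in>{t}. (adjacent ?D)\<^sup>*\<^sup>* a s" by simp
    qed auto
  qed
  have "connected_mgraph U"
  proof (rule connected_mgraphI[where S = "{x}"])
    fix a assume "a \<in> verts U"
    hence "(adjacent B)\<^sup>*\<^sup>* a x \<or> (adjacent B')\<^sup>*\<^sup>* a x"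
      using B(1) B'(1) xy by (auto simp: two_connected_def U_def intro: connectedD)
    thus "\<exists>s\<in>{x}. (adjacent U)\<^sup>*\<^sup>* a s" using adjacent_rtranclp_mono[of _ U a x] adj by blast
  qed auto
  moreover have "\<nexists>z. cut_vertex U z" using del by (auto simp: cut_vertex_def)
  moreover have "\<exists>x\<in>verts U. \<exists>y\<in>verts U. x \<noteq> y" using xy by (auto simp: U_def)
  ultimately show "two_connected U" unfolding two_connected_def by blast
qed

lemma blockD:
  assumes "block G B"
  shows "two_connected B" "wf_mgraph B" "verts B \<subseteq> verts G" "edges B \<subseteq> edges G" "ends B = ends G"
    "e \<in> edges B \<Longrightarrow> card (ends G e) = 2"
  using assms by (auto simp: block_def subgraph_def delete_loops_def)

lemma block_maximal:
  assumes "block G B" "two_connected B'" "wf_mgraph B'" "ends B' = ends G" "verts B' \<subseteq> verts G"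
    "edges B' \<subseteq> {e \<in> edges G. card (ends G e) = 2}" "verts B \<subseteq> verts B'" "edges B \<subseteq> edges B'"
  shows "B' = B"
proof -
  have "subgraph B' (delete_loops G)" using assms by (auto simp: subgraph_def delete_loops_def)
  moreover have "subgraph B B'" using assms blockD[OF assms(1)] by (auto simp: subgraph_def)
  ultimately show ?thesis using assms(1,2) by (auto simp: block_def)
qed

lemma block_eqI:
  assumes "block G B" "block G B'" "x \<in> verts B \<inter> verts B'" "y \<in> verts B \<inter> verts B'" "x \<noteq> y"
  shows "B = B'"
proof -
  note b = blockD[OF assms(1)] and b' = blockD[OF assms(2)]
  define U where "U = \<lparr>verts = verts B \<union> verts B', edges = edges B \<union> edges B', ends = ends B\<rparr>"
  have e: "ends B' = ends B" using b b' by simp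
  note U = two_connected_union[OF b(1,2) b'(1,2) e assms(3-5), folded U_def]
  have "U = B" by (rule block_maximal[OF assms(1) U(2,1)]) (use b b' in \<open>auto simp: U_def\<close>)
  moreover have "U = B'" by (rule block_maximal[OF assms(2) U(2,1)]) (use b b' in \<open>auto simp: U_def\<close>)
  ultimately show ?thesis by simp
qed

definition off :: "('v, 'e) mgraph \<Rightarrow> ('v, 'e) mgraph \<Rightarrow> 'v \<Rightarrow> 'v \<Rightarrow> bool" where
  "off G B x y \<longleftrightarrow> (\<exists>e\<in>edges G - edges B. ends G e = {x, y})"

lemma off_sym: "off G B x y \<longleftrightarrow> off G B y x" by (auto simp: off_def insert_commute)

lemma off_rtranclp_sym: "(off G B)\<^sup>*\<^sup>* x y \<Longrightarrow> (off G B)\<^sup>*\<^sup>* y x"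
  by (rule rtranclp_flip) (simp_all add: off_sym)

lemma block_vertices_separated:
  assumes wf: "wf_mgraph G" and B: "block G B" and x: "x \<in> verts B" and y: "y \<in> verts B"
    and path: "(off G B)\<^sup>*\<^sup>* x y"
  shows "x = y"
proof (rule ccontr)
  assume xy: "x \<noteq> y"
  let ?P = "\<lambda>n. \<exists>x\<in>verts B. \<exists>y\<in>verts B. x \<noteq> y \<and> (off G B ^^ n) x y"
  have "\<exists>n. ?P n" using x y xy rtranclp_imp_relpowp[OF path] by blast
  hence P: "?P (LEAST n. ?P n)" and mn: "\<And>m. m < (LEAST n. ?P n) \<Longrightarrow> \<not> ?P m"
    by (rule LeastI_ex) (rule not_less_Least)
  define n where "n = (LEAST n. ?P n)"
  obtain x y where xy: "x \<in> verts B" "y \<in> verts B" "x \<noteq> y" "(off G B ^^ n) x y" using P unfolding n_def by blast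
  have min: False if "x \<in> verts B" "y \<in> verts B" "x \<noteq> y" "(off G B ^^ m) x y" "m < n" for x y m
    using mn[of m] that unfolding n_def by blast
  obtain w where w: "w 0 = x" "w n = y" "\<And>i. i < n \<Longrightarrow> off G B (w i) (w (Suc i))"
    using xy(4) by (auto simp: relpowp_fun_conv)
  have seg: "(off G B ^^ (j - i)) (w i) (w j)" if "i \<le> j" "j \<le> n" for i j
    unfolding relpowp_fun_conv using w(3) that by (intro exI[of _ "\<lambda>m. w (i + m)"]) auto
  have inj: "inj_on w {..n}"
  proof (rule linorder_inj_onI)
    fix i j assume ij: "i < j" "i \<in> {..n}" "j \<in> {..n}"
    show "w i \<noteq> w j"
    proof
      assume e: "w i = w j"
      have "(off G B ^^ (i - 0)) (w 0) (w i)" using seg[of 0 i] ij by simp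
      moreover have "(off G B ^^ (n - j)) (w i) (w n)" using seg[of j n] ij e by simp
      ultimately have "(off G B ^^ (i + (n - j))) x y" using w by (auto simp: relpowp_add)
      moreover have "i + (n - j) < n" using ij by auto
      ultimately show False using min[OF xy(1-3)] by blast
    qed
  qed auto
  obtain g where g: "\<And>i. i < n \<Longrightarrow> g i \<in> edges G - edges B \<and> ends G (g i) = {w i, w (Suc i)}"
    using w(3) unfolding off_def by metis
  note b = blockD[OF B]
  define B' where "B' = \<lparr>verts = verts B \<union> w ` {..n}, edges = edges B \<union> g ` {..<n}, ends = ends B\<rparr>"
  have B': "wf_mgraph B'" "two_connected B'"
    using two_connected_ear[OF b(1,2), of w n g] xy w inj g b(5) unfolding B'_def by auto
  have wV: "w i \<in> verts G" if "i \<le> n" for i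
  proof (cases i)
    case 0 thus ?thesis using w xy b by auto
  next
    case (Suc j)
    hence "g j \<in> edges G" "ends G (g j) = {w j, w (Suc j)}" using g[of j] that by auto
    thus ?thesis using wf Suc by (auto simp: wf_mgraph_def)
  qed
  have "card (ends G (g i)) = 2" if "i < n" for i
  proof -
    have "w i \<noteq> w (Suc i)" using inj_onD[OF inj, of i "Suc i"] that by auto
    thus ?thesis using g[OF that] by simp
  qed
  hence "B' = B"
    using wV g b by (intro block_maximal[OF B B'(2,1)]) (auto simp: B'_def)
  moreover have "n > 0" using w xy by (cases n) auto
  ultimately have "g 0 \<in> edges B" by (auto simp: B'_def) (metis B'_def UnI2 image_eqI lessThan_iff select_convs(2))
  thus False using g[OF \<open>n > 0\<close>] by auto
qed

definition gate_of :: "('v, 'e) mgraph \<Rightarrow> ('v, 'e) mgraph \<Rightarrow> 'v \<Rightarrow> 'v" where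
  "gate_of G B x = (SOME b. b \<in> verts B \<and> (off G B)\<^sup>*\<^sup>* x b)"

locale block_in = fixes G B :: "('v, 'e) mgraph"
  assumes wf: "wf_mgraph G" and conn: "connected_mgraph G" and blk: "block G B"
begin

abbreviation "\<pi> \<equiv> gate_of G B"
lemmas b = blockD[OF blk]

lemma gate_ex: assumes "x \<in> verts G" shows "\<exists>b. b \<in> verts B \<and> (off G B)\<^sup>*\<^sup>* x b"
proof -
  obtain b0 where b0: "b0 \<in> verts B" using b(1) by (auto simp: two_connected_def)
  hence "(adjacent G)\<^sup>*\<^sup>* x b0" using connectedD[OF conn assms] b(3) by auto
  thus ?thesis
  proof (induction rule: converse_rtranclp_induct)
    case (step x y)
    then obtain b' where b': "b' \<in> verts B" "(off G B)\<^sup>*\<^sup>* y b'" by auto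
    obtain e where e: "e \<in> edges G" "ends G e = {x, y}" using step(1) by (auto simp: adjacent_def)
    show ?case
    proof (cases "e \<in> edges B")
      case True
      hence "x \<in> verts B" using b(2,5) e by (auto simp: wf_mgraph_def)
      thus ?thesis by auto
    next
      case False
      hence "off G B x y" using e by (auto simp: off_def)
      thus ?thesis using b' by (meson converse_rtranclp_into_rtranclp)
    qed
  qed (use b0 in auto)
qed

lemma gate: "x \<in> verts G \<Longrightarrow> \<pi> x \<in> verts B" "x \<in> verts G \<Longrightarrow> (off G B)\<^sup>*\<^sup>* x (\<pi> x)"
  using someI_ex[OF gate_ex] unfolding gate_of_def by auto

lemma gate_unique:
  assumes "x \<in> verts G" "b' \<in> verts B" "(off G B)\<^sup>*\<^sup>* x b'" shows "\<pi> x = b'"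
proof -
  have "(off G B)\<^sup>*\<^sup>* (\<pi> x) b'"
    using off_rtranclp_sym[OF gate(2)[OF assms(1)]] assms(3) by (rule rtranclp_trans)
  thus ?thesis using block_vertices_separated[OF wf blk gate(1)[OF assms(1)] assms(2)] by simp
qed

lemma gate_block: "x \<in> verts B \<Longrightarrow> \<pi> x = x"
  using b(3) by (intro gate_unique) auto

lemma off_verts: "off G B x y \<Longrightarrow> x \<in> verts G \<and> y \<in> verts G"
  using wf by (auto simp: off_def wf_mgraph_def)

lemma gate_off: assumes "off G B x y" shows "\<pi> x = \<pi> y"
proof -
  have "x \<in> verts G" "y \<in> verts G" using off_verts assms by auto
  thus ?thesis using assms gate[of y] by (intro gate_unique) (auto intro: converse_rtranclp_into_rtranclp)
qed

lemma gate_cross: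
  assumes "e \<in> edges G" "ends G e = {x, y}" "\<pi> x \<noteq> \<pi> y"
  shows "e \<in> edges B" "x \<in> verts B" "y \<in> verts B" "\<pi> x = x" "\<pi> y = y"
proof -
  show e: "e \<in> edges B" using gate_off[of x y] assms by (auto simp: off_def)
  show "x \<in> verts B" "y \<in> verts B" using e b(2,5) assms by (auto simp: wf_mgraph_def)
  thus "\<pi> x = x" "\<pi> y = y" using gate_block by auto
qed

lemma adjacent_cross:
  assumes "adjacent G x y" "\<pi> x \<noteq> \<pi> y" shows "\<pi> x = x" "\<pi> y = y"
  using assms gate_cross unfolding adjacent_def by metis+

lemma gate_const_on_block:
  assumes B': "block G B'" "B' \<noteq> B" and xy: "x \<in> verts B'" "y \<in> verts B'"
  shows "\<pi> x = \<pi> y"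
proof -
  note b' = blockD[OF B'(1)]
  have "(adjacent B')\<^sup>*\<^sup>* x y" using b'(1) xy by (auto simp: two_connected_def intro: connectedD)
  thus ?thesis
  proof (induction rule: rtranclp_induct)
    case (step y z)
    have "\<pi> y = \<pi> z"
    proof (rule ccontr)
      assume ne: "\<pi> y \<noteq> \<pi> z"
      obtain e where e: "e \<in> edges B'" "ends B' e = {y, z}" using step(2) by (auto simp: adjacent_def)
      hence "y \<in> verts B" "z \<in> verts B" using gate_cross[of e y z] b' ne by auto
      moreover have "y \<in> verts B'" "z \<in> verts B'" using e b'(2) by (auto simp: wf_mgraph_def)
      ultimately show False using block_eqI[OF blk B'(1), of y z] B'(2) ne by auto
    qed
    thus ?case using step by simp
  qed simp
qed

end

section \<open>The infinite block-path\<close>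

locale spine =
  fixes \<Gamma> :: "('v, 'e) mgraph" and v :: 'v and C :: "nat \<Rightarrow> ('v, 'e) mgraph" and q :: "nat \<Rightarrow> 'v"
  assumes wf: "wf_mgraph \<Gamma>" and conn: "connected_mgraph \<Gamma>" and lf: "locally_finite \<Gamma>"
    and one_ended: "one_ended \<Gamma>" and v: "v \<in> verts \<Gamma>"
    and path: "infinite_block_path \<Gamma> v C"
    and cut_vertices: "\<And>i. i \<ge> 1 \<Longrightarrow> verts (C i) \<inter> verts (C (Suc i)) = {q i}"
begin

abbreviation "P i \<equiv> gate_of \<Gamma> (C i)"

definition D :: "nat \<Rightarrow> 'v set" where "D j = {x \<in> verts \<Gamma>. P (Suc j) x = q j}"

lemma blk: "i \<ge> 1 \<Longrightarrow> block_in \<Gamma> (C i)"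
  using path wf conn by unfold_locales (auto simp: infinite_block_path_def)

lemma C_ne: "i \<ge> 1 \<Longrightarrow> j \<ge> 1 \<Longrightarrow> i \<noteq> j \<Longrightarrow> C i \<noteq> C j"
  using path by (auto simp: infinite_block_path_def inj_on_def)

lemma q_in: "i \<ge> 1 \<Longrightarrow> q i \<in> verts (C i)" "i \<ge> 1 \<Longrightarrow> q i \<in> verts (C (Suc i))"
  using cut_vertices[of i] by auto

lemma C_V: "i \<ge> 1 \<Longrightarrow> verts (C i) \<subseteq> verts \<Gamma>"
  using block_in.b(3)[OF blk] by simp

lemma q_V: "i \<ge> 1 \<Longrightarrow> q i \<in> verts \<Gamma>" using q_in C_V by blast

lemma q_Suc_ne: assumes "i \<ge> 1" shows "q i \<noteq> q (Suc i)"
proof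
  assume e: "q i = q (Suc i)"
  have "block_path_joining \<Gamma> v (q i) (map C [1..<Suc i])"
    using path q_in assms unfolding infinite_block_path_def by blast
  moreover have "block_path_joining \<Gamma> v (q (Suc i)) (map C [1..<Suc (Suc i)])"
    using path q_in[of "Suc i"] unfolding infinite_block_path_def by (meson IntI le_SucI assms)
  ultimately have "length (map C [1..<Suc (Suc i)]) \<le> length (map C [1..<Suc i])"
    unfolding block_path_joining_def e by blast
  thus False by simp
qed

lemma P_const: "i \<ge> 1 \<Longrightarrow> j \<ge> 1 \<Longrightarrow> i \<noteq> j \<Longrightarrow> x \<in> verts (C j) \<Longrightarrow> y \<in> verts (C j) \<Longrightarrow> P i x = P i y"
  using block_in.gate_const_on_block[OF blk] C_ne blk block_in.blk by metis

lemma P_block: "i \<ge> 1 \<Longrightarrow> x \<in> verts (C i) \<Longrightarrow> P i x = x"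
  using block_in.gate_block[OF blk] .

lemma P_before: "j \<le> m \<Longrightarrow> 1 \<le> j \<Longrightarrow> x \<in> verts (C j) \<Longrightarrow> P (Suc m) x = q m"
proof (induction j arbitrary: x rule: inc_induct)
  case base
  hence "P (Suc m) x = P (Suc m) (q m)" using q_in(1)[of m] by (intro P_const) auto
  thus ?case using P_block[of "Suc m" "q m"] q_in(2)[of m] base by simp
next
  case (step j)
  hence "P (Suc m) x = P (Suc m) (q j)" using q_in(1)[of j] by (intro P_const) auto
  thus ?case using step.IH[of "q j"] q_in(2)[of j] step.prems by simp
qed

lemma P_after:
  assumes "i < j" "1 \<le> i" "x \<in> verts (C j)" shows "P i x = q i"
proof -
  have "P i y = q i" if "Suc i \<le> m" "y \<in> verts (C m)" for m y
    using that
  proof (induction m arbitrary: y rule: dec_induct)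
    case base
    hence "P i y = P i (q i)" using q_in(2)[of i] assms(2) by (intro P_const) auto
    thus ?case using P_block[of i "q i"] q_in(1)[of i] assms(2) by simp
  next
    case (step m)
    have "P i y = P i (q m)" using q_in(2)[of m] step assms(2) by (intro P_const[where j = "Suc m"]) auto
    thus ?case using step.IH[of "q m"] q_in(1)[of m] step assms(2) by simp
  qed
  from this[of j x] show ?thesis using assms by simp
qed

lemma P_q_before: "1 \<le> i \<Longrightarrow> i \<le> m \<Longrightarrow> P (Suc m) (q i) = q m"
  using P_before[of i m "q i"] q_in by simp

lemma P_q_after: "1 \<le> i \<Longrightarrow> i \<le> j \<Longrightarrow> P i (q j) = q i"
  using P_after[of i j "q j"] P_block[of i "q i"] q_in[of j] by (cases "i = j") auto

lemma q_inj: "inj_on q {1..}"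
proof (rule linorder_inj_onI)
  fix i j :: nat assume ij: "i < j" "i \<in> {1..}" "j \<in> {1..}"
  then obtain m where m: "j = Suc m" "i \<le> m" "1 \<le> i" by (cases j) auto
  have "P j (q i) = q m" "P j (q j) = q j" using P_q_before[of i m] P_q_after[of j j] m by auto
  thus "q i \<noteq> q j" using q_Suc_ne[of m] m by auto
qed auto

lemma nested: assumes j: "j \<ge> 1" and x: "x \<in> verts \<Gamma>" and Px: "P j x \<noteq> q j"
  shows "x \<in> D j"
proof -
  interpret B: block_in \<Gamma> "C j" using blk j .
  interpret B': block_in \<Gamma> "C (Suc j)" using blk by simp
  define b where "b = P j x"
  have b: "b \<in> verts (C j)" using B.gate(1)[OF x] by (simp add: b_def)
  have "(off \<Gamma> (C j))\<^sup>*\<^sup>* x b" using B.gate(2)[OF x] by (simp add: b_def)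
  hence "P j x \<noteq> q j \<longrightarrow> P (Suc j) x = P (Suc j) b"
  proof (induction rule: converse_rtranclp_induct)
    case (step y z)
    have e: "P j y = P j z" using B.gate_off step(1) .
    show ?case
    proof
      assume ne: "P j y \<noteq> q j"
      have "P (Suc j) y = P (Suc j) z"
      proof (rule ccontr)
        assume c: "P (Suc j) y \<noteq> P (Suc j) z"
        obtain e where "e \<in> edges \<Gamma>" "ends \<Gamma> e = {y, z}" using step(1) by (auto simp: off_def)
        hence "y \<in> verts (C (Suc j))" using B'.gate_cross(2) c by blast
        hence "P j y = q j" using P_after[of j "Suc j" y] j by simp
        thus False using ne by simp
      qed
      thus "P (Suc j) y = P (Suc j) b" using step.IH e ne by simp
    qed
  qed simp
  hence "P (Suc j) x = P (Suc j) b" using Px by simp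
  also have "\<dots> = q j" using P_before[of j j b] b j by simp
  finally show ?thesis using x by (simp add: D_def)
qed

lemma nested_ne: assumes "j \<ge> 1" "x \<in> verts \<Gamma>" "P j x \<noteq> q j" shows "x \<noteq> q j"
  using assms P_q_after[of j j] by auto

lemma D_step: assumes "j \<ge> 1" "x \<in> D j" shows "x \<in> D (Suc j) - {q (Suc j)}"
proof -
  have "P (Suc j) x \<noteq> q (Suc j)" using assms q_Suc_ne by (auto simp: D_def)
  thus ?thesis using nested[of "Suc j" x] nested_ne[of "Suc j" x] assms by (auto simp: D_def)
qed

lemma D_mono: "j \<le> m \<Longrightarrow> j \<ge> 1 \<Longrightarrow> D j \<subseteq> D m"
  by (induction m rule: dec_induct) (use D_step in auto)

lemma q_D: "j \<ge> 1 \<Longrightarrow> q j \<in> D j"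
  using P_q_before[of j j] q_V by (auto simp: D_def)

lemma C_D: "j \<ge> 1 \<Longrightarrow> verts (C j) \<subseteq> D j"
  using P_before[of j j] C_V by (auto simp: D_def)

lemma v_C1: "v \<in> verts (C 1)" "v \<notin> verts (C 2)"
  using path by (auto simp: infinite_block_path_def)

lemma v_D: "j \<ge> 1 \<Longrightarrow> v \<in> D j"
  using P_before[of 1 j v] v_C1 v by (auto simp: D_def)

lemma v_ne_q: assumes "j \<ge> 1" shows "v \<noteq> q j"
proof (cases "j = 1")
  case True thus ?thesis using v_C1(2) q_in(2)[of 1] by (auto simp: numeral_2_eq_2)
next
  case False
  hence "P 2 (q j) = q 2" using P_q_after[of 2 j] assms by simp
  moreover have "P 2 v = q 1" using v_D[of 1] by (simp add: D_def numeral_2_eq_2)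
  ultimately show ?thesis using q_Suc_ne[of 1] by (auto simp: numeral_2_eq_2)
qed

lemma D_cut: assumes j: "j \<ge> 1" and "x \<in> D j" "x \<noteq> q j" "adjacent \<Gamma> x y" shows "y \<in> D j"
proof -
  interpret B: block_in \<Gamma> "C (Suc j)" using blk by simp
  have y: "y \<in> verts \<Gamma>" using adjacent_verts[OF wf assms(4)] by simp
  show ?thesis
  proof (rule ccontr)
    assume "y \<notin> D j"
    hence "P (Suc j) x \<noteq> P (Suc j) y" using assms y by (auto simp: D_def)
    hence "P (Suc j) x = x" using B.adjacent_cross assms(4) by blast
    thus False using assms by (auto simp: D_def)
  qed
qed

lemma finite_neighbours: "finite {y. adjacent \<Gamma> x y}"
proof (cases "x \<in> verts \<Gamma>")
  case True
  let ?E = "{e \<in> edges \<Gamma>. x \<in> ends \<Gamma> e}"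
  have "finite ?E" using lf True by (auto simp: locally_finite_def)
  moreover have "finite (ends \<Gamma> e)" if "e \<in> ?E" for e
  proof -
    have "card (ends \<Gamma> e) \<in> {1, 2}" using wf that unfolding wf_mgraph_def by blast
    thus ?thesis by (intro card_ge_0_finite) auto
  qed
  ultimately have "finite (\<Union> (ends \<Gamma> ` ?E))" by blast
  moreover have "{y. adjacent \<Gamma> x y} \<subseteq> \<Union> (ends \<Gamma> ` ?E)" by (auto simp: adjacent_def)
  ultimately show ?thesis using finite_subset by blast
next
  case False
  hence "{y. adjacent \<Gamma> x y} = {}" using adjacent_verts[OF wf] by auto
  thus ?thesis by simp
qed

lemma finite_part: assumes j: "j \<ge> 1"
  shows "verts (finite_part \<Gamma> (q j)) = D j" "finite (D j)"
    "adjacent (finite_part \<Gamma> (q j)) x y \<longleftrightarrow> adjacent \<Gamma> x y \<and> x \<in> D j \<and> y \<in> D j"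
proof -
  interpret B: block_in \<Gamma> "C (Suc j)" using blk by simp
  let ?G = "delete_verts \<Gamma> {q j}"
  have adj: "adjacent ?G x y \<longleftrightarrow> adjacent \<Gamma> x y \<and> x \<noteq> q j \<and> y \<noteq> q j" for x y
    by (rule adjacent_delete[OF wf])
  have vG: "verts ?G = verts \<Gamma> - {q j}" by (rule verts_delete)
  define comp where "comp x = {y \<in> verts ?G. (adjacent ?G)\<^sup>*\<^sup>* x y}" for x
  have comps: "conn_components ?G = comp ` verts ?G"
    unfolding conn_components_def comp_def ..
  have comp_self: "x \<in> comp x" if "x \<in> verts ?G" for x using that by (simp add: comp_def)
  define K where "K = {x \<in> verts \<Gamma>. P (Suc j) x \<noteq> q j}"
  have KG: "K \<subseteq> verts ?G" using P_q_before[of j j] j by (auto simp: K_def vG)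
  have toB: "(adjacent ?G)\<^sup>*\<^sup>* x (P (Suc j) x)" if x: "x \<in> K" for x
  proof -
    define b where "b = P (Suc j) x"
    have b: "P (Suc j) b = b" "b \<noteq> q j" using B.gate_block[OF B.gate(1)] x by (auto simp: K_def b_def)
    have "(off \<Gamma> (C (Suc j)))\<^sup>*\<^sup>* x b" using B.gate(2) x by (auto simp: K_def b_def)
    hence "P (Suc j) x = b \<and> (adjacent ?G)\<^sup>*\<^sup>* x b"
    proof (induction rule: converse_rtranclp_induct)
      case (step y z)
      have yz: "P (Suc j) y = b" "P (Suc j) z = b" using B.gate_off[OF step(1)] step.IH by auto
      have "y \<noteq> q j" "z \<noteq> q j" using yz P_q_before[of j j] j b by auto
      moreover have "adjacent \<Gamma> y z" using step(1) by (auto simp: off_def adjacent_def)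
      ultimately have "adjacent ?G y z" by (simp add: adj)
      thus ?case using step.IH yz by (meson converse_rtranclp_into_rtranclp)
    qed (use b in simp)
    thus ?thesis by (simp add: b_def)
  qed
  have Kconn: "(adjacent ?G)\<^sup>*\<^sup>* x y" if x: "x \<in> K" and y: "y \<in> K" for x y
  proof -
    have "P (Suc j) x \<in> verts (C (Suc j)) - {q j}" "P (Suc j) y \<in> verts (C (Suc j)) - {q j}"
      using x y B.gate(1) by (auto simp: K_def)
    hence "(adjacent (delete_verts (C (Suc j)) {q j}))\<^sup>*\<^sup>* (P (Suc j) x) (P (Suc j) y)"
      using two_connected_delete[OF B.b(1,2)] by blast
    moreover have "adjacent ?G s t" if "adjacent (delete_verts (C (Suc j)) {q j}) s t" for s t
      using that adjacent_mono[OF B.b(4,5), of s t] by (simp add: adj adjacent_delete[OF B.b(2)])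
    ultimately have "(adjacent ?G)\<^sup>*\<^sup>* (P (Suc j) x) (P (Suc j) y)"
      using adjacent_rtranclp_mono by metis
    thus ?thesis using toB[OF x] adjacent_rtranclp_sym[OF toB[OF y]] by (meson rtranclp_trans)
  qed
  have Kq: "q l \<in> K" if "l \<ge> Suc j" for l
    using P_q_after[of "Suc j" l] that q_Suc_ne[OF j] q_V[of l] j by (auto simp: K_def)
  have Kinf: "infinite K"
  proof
    assume "finite K"
    hence "finite (q ` {Suc j..})" using Kq by (auto intro: finite_subset)
    moreover have "inj_on q {Suc j..}" using q_inj by (rule inj_on_subset) auto
    ultimately have "finite {Suc j..}" using finite_imageD by blast
    thus False using infinite_Ici by blast
  qed
  define k0 where "k0 = q (Suc j)"
  have k0: "k0 \<in> K" using Kq by (simp add: k0_def)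
  have "K \<subseteq> comp k0" using Kconn[OF k0] KG by (auto simp: comp_def)
  hence inf0: "infinite (comp k0)" "comp k0 \<in> conn_components ?G"
    using Kinf finite_subset k0 KG by (auto simp: comps)
  have "\<exists>!A. A \<in> conn_components ?G \<and> infinite A"
    using one_ended q_V[OF j] unfolding one_ended_def by simp
  hence fin: "finite A" if "A \<in> conn_components ?G" "A \<noteq> comp k0" for A
    using inf0 that by blast
  have closed: "comp x \<subseteq> D j - {q j}" if x: "x \<in> D j - {q j}" for x
  proof
    fix y assume "y \<in> comp x"
    hence "(adjacent ?G)\<^sup>*\<^sup>* x y" by (simp add: comp_def)
    thus "y \<in> D j - {q j}"
    proof (induction rule: rtranclp_induct)
      case (step y z) thus ?case using D_cut[OF j, of y z] by (auto simp: adj)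
    qed (use x in simp)
  qed
  have DK: "D j \<inter> K = {}" by (auto simp: D_def K_def)
  have DV: "D j \<subseteq> verts \<Gamma>" by (auto simp: D_def)
  have compfin: "finite (comp x)" if x: "x \<in> D j - {q j}" for x
  proof (rule fin)
    show "comp x \<in> conn_components ?G" using x DV by (auto simp: comps vG)
    show "comp x \<noteq> comp k0" using closed[OF x] comp_self[of k0] k0 KG DK by blast
  qed
  have U: "\<Union>{A \<in> conn_components ?G. finite A} = D j - {q j}"
  proof
    show "D j - {q j} \<subseteq> \<Union>{A \<in> conn_components ?G. finite A}"
    proof
      fix x assume x: "x \<in> D j - {q j}"
      hence "x \<in> verts ?G" using DV by (auto simp: vG)
      thus "x \<in> \<Union>{A \<in> conn_components ?G. finite A}" using compfin[OF x] comp_self[of x] by (auto simp: comps)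
    qed
    show "\<Union>{A \<in> conn_components ?G. finite A} \<subseteq> D j - {q j}"
    proof
      fix y assume "y \<in> \<Union>{A \<in> conn_components ?G. finite A}"
      then obtain x where x: "x \<in> verts ?G" "finite (comp x)" "y \<in> comp x" by (auto simp: comps)
      have "x \<notin> K"
      proof
        assume "x \<in> K"
        hence "K \<subseteq> comp x" using Kconn KG by (auto simp: comp_def)
        thus False using x(2) Kinf finite_subset by blast
      qed
      hence "x \<in> D j - {q j}" using x(1) by (auto simp: vG K_def D_def)
      thus "y \<in> D j - {q j}" using closed x(3) by blast
    qed
  qed
  have ins: "insert (q j) (D j - {q j}) = D j" using q_D[OF j] by auto
  have fp: "finite_part \<Gamma> (q j) = induced \<Gamma> (D j)" unfolding finite_part_def U ins ..
  show "verts (finite_part \<Gamma> (q j)) = D j" using DV by (auto simp: fp induced_def)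
  show "adjacent (finite_part \<Gamma> (q j)) x y \<longleftrightarrow> adjacent \<Gamma> x y \<and> x \<in> D j \<and> y \<in> D j"
    by (auto simp: fp induced_def adjacent_def)
  have "D j - {q j} \<subseteq> (\<Union>y\<in>{y \<in> D j - {q j}. adjacent \<Gamma> (q j) y}. comp y)"
  proof
    fix x assume x: "x \<in> D j - {q j}"
    have "(adjacent \<Gamma>)\<^sup>*\<^sup>* x (q j)" using connectedD[OF conn] x DV q_V[OF j] by blast
    hence "x \<in> D j - {q j} \<longrightarrow> (\<exists>y\<in>D j - {q j}. adjacent \<Gamma> (q j) y \<and> (adjacent ?G)\<^sup>*\<^sup>* x y)"
    proof (induction rule: converse_rtranclp_induct)
      case (step x z)
      show ?case
      proof
        assume x: "x \<in> D j - {q j}"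
        show "\<exists>y\<in>D j - {q j}. adjacent \<Gamma> (q j) y \<and> (adjacent ?G)\<^sup>*\<^sup>* x y"
        proof (cases "z = q j")
          case True thus ?thesis using x step(1) adjacent_sym[of \<Gamma> x z] by blast
        next
          case False
          hence "z \<in> D j - {q j}" using D_cut[OF j, of x z] x step(1) by auto
          moreover have "adjacent ?G x z" using adj step(1) x False by auto
          ultimately show ?thesis using step.IH by (meson converse_rtranclp_into_rtranclp)
        qed
      qed
    qed simp
    then obtain y where y: "y \<in> D j - {q j}" "adjacent \<Gamma> (q j) y" "(adjacent ?G)\<^sup>*\<^sup>* x y" using x by blast
    have "x \<in> comp y" using adjacent_rtranclp_sym[OF y(3)] x DV by (auto simp: comp_def vG)
    thus "x \<in> (\<Union>y\<in>{y \<in> D j - {q j}. adjacent \<Gamma> (q j) y}. comp y)" using y by blast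
  qed
  moreover have "finite (\<Union>y\<in>{y \<in> D j - {q j}. adjacent \<Gamma> (q j) y}. comp y)"
    using finite_neighbours[of "q j"] compfin by (intro finite_UN_I) (auto intro: finite_subset)
  ultimately have "finite (D j - {q j})" using finite_subset by blast
  thus "finite (D j)" by simp
qed

lemma finite_part_path:
  assumes j: "j \<ge> 1" and x: "x \<in> D j" and y: "y \<in> D j"
  shows "\<exists>n\<le>gdiam (finite_part \<Gamma> (q j)). (adjacent \<Gamma> ^^ n) x y"
proof -
  let ?F = "finite_part \<Gamma> (q j)"
  note fp = finite_part[OF j]
  have toq: "(adjacent ?F)\<^sup>*\<^sup>* x (q j)" if "x \<in> D j" for x
  proof -
    have "(adjacent \<Gamma>)\<^sup>*\<^sup>* x (q j)" using connectedD[OF conn] that q_V[OF j] by (auto simp: D_def)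
    hence "x \<in> D j \<longrightarrow> (adjacent ?F)\<^sup>*\<^sup>* x (q j)"
    proof (induction rule: converse_rtranclp_induct)
      case (step x z)
      show ?case
      proof
        assume x: "x \<in> D j"
        show "(adjacent ?F)\<^sup>*\<^sup>* x (q j)"
        proof (cases "x = q j")
          case False
          hence "z \<in> D j" using D_cut[OF j x _ step(1)] by simp
          hence "adjacent ?F x z" using fp(3) step(1) x by simp
          thus ?thesis using step.IH \<open>z \<in> D j\<close> by (meson converse_rtranclp_into_rtranclp)
        qed simp
      qed
    qed simp
    thus ?thesis using that by simp
  qed
  have "(adjacent ?F)\<^sup>*\<^sup>* x y" using toq[OF x] adjacent_rtranclp_sym[OF toq[OF y]] by (rule rtranclp_trans)
  hence "\<exists>n. (adjacent ?F ^^ n) x y" by (rule rtranclp_imp_relpowp)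
  hence d: "(adjacent ?F ^^ gdist ?F x y) x y" unfolding gdist_def by (rule LeastI_ex)
  have "gdist ?F x y \<le> gdiam ?F"
    unfolding gdiam_def fp(1) using x y fp(2) by (intro Max_ge) (auto intro!: image_eqI[of _ _ "(x, y)"])
  moreover have "(adjacent \<Gamma> ^^ gdist ?F x y) x y"
    using d by (rule relpowp_mono[rotated]) (simp add: fp(3))
  ultimately show ?thesis by blast
qed

lemma finite_reach: "finite {y. (adjacent \<Gamma> ^^ n) x y}"
proof (induction n)
  case (Suc n)
  have "{y. (adjacent \<Gamma> ^^ Suc n) x y} \<subseteq> (\<Union>z\<in>{z. (adjacent \<Gamma> ^^ n) x z}. {y. adjacent \<Gamma> z y})"
    by auto
  thus ?case using Suc finite_neighbours finite_subset by (metis (no_types, lifting) finite_UN_I)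
qed simp

lemma diam_tendsto: "\<forall>\<^sub>F j in sequentially. gdiam (finite_part \<Gamma> (q j)) > m"
proof -
  let ?J = "{j. j \<ge> 1 \<and> gdiam (finite_part \<Gamma> (q j)) \<le> m}"
  have "q ` ?J \<subseteq> (\<Union>n\<in>{..m}. {y. (adjacent \<Gamma> ^^ n) v y})"
    using finite_part_path[OF _ v_D q_D] by fastforce
  hence "finite (q ` ?J)" by (rule finite_subset) (use finite_reach in auto)
  moreover have "inj_on q ?J" using q_inj by (rule inj_on_subset) auto
  ultimately have "finite ?J" by (rule finite_imageD)
  then obtain b where b: "\<forall>j\<in>?J. j \<le> b" unfolding finite_nat_set_iff_bounded_le by blast
  have "gdiam (finite_part \<Gamma> (q j)) > m" if "j \<ge> Suc b" for j
  proof (rule ccontr)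
    assume "\<not> ?thesis"
    hence "j \<in> ?J" using that by simp
    hence "j \<le> b" using b by blast
    thus False using that by simp
  qed
  thus ?thesis unfolding eventually_sequentially by blast
qed

end

section \<open>Cycles on the block-path\<close>

lemma gated_cycle_restrict:
  assumes "gated_cycle A V k f pos" "V' \<subseteq> V" "\<And>t. t < k \<Longrightarrow> f t \<in> V'"
    "\<And>x y. x \<in> V' \<Longrightarrow> y \<in> V' \<Longrightarrow> pos x \<noteq> pos y \<Longrightarrow> A' x y = A x y"
  shows "gated_cycle A' V' k f pos"
  using assms unfolding gated_cycle_def by (auto simp: subset_iff)

lemma cycle_rotation:
  assumes cyc: "is_cycle B" and x: "x \<in> verts B"
  obtains f g where "f 0 = x" "bij_betw f {..<card (verts B)} (verts B)"
    "bij_betw g {..<card (verts B)} (edges B)"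
    "\<And>i. i < card (verts B) \<Longrightarrow> ends B (g i) = {f i, f (nxt (card (verts B)) i)}"
proof -
  obtain k f g where k: "k \<ge> 2" and f: "bij_betw f {..<k} (verts B)" and g: "bij_betw g {..<k} (edges B)"
    and e: "\<And>i. i < k \<Longrightarrow> ends B (g i) = {f i, f (Suc i mod k)}"
    using cyc unfolding is_cycle_def by blast
  have kc: "card (verts B) = k" using bij_betw_same_card[OF f] by simp
  have "x \<in> f ` {..<k}" using f x by (simp add: bij_betw_def)
  then obtain s where "s \<in> {..<k}" "x = f s" by blast
  hence s: "s < k" "f s = x" by auto
  define r where "r i = (i + s) mod k" for i
  have surj: "r ` {..<k} = {..<k}"
  proof
    show "{..<k} \<subseteq> r ` {..<k}"
    proof
      fix j assume j: "j \<in> {..<k}"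
      have "r ((j + (k - s)) mod k) = (j + (k - s) + s) mod k" unfolding r_def by (rule mod_add_left_eq)
      also have "\<dots> = j" using j s by simp
      finally show "j \<in> r ` {..<k}" using k by (intro image_eqI[of _ _ "(j + (k - s)) mod k"]) auto
    qed
  qed (use k in \<open>auto simp: r_def\<close>)
  have "inj_on r {..<k}" using surj by (intro eq_card_imp_inj_on) auto
  hence r: "bij_betw r {..<k} {..<k}" using surj by (simp add: bij_betw_def)
  show thesis
  proof (rule that[of "f \<circ> r" "g \<circ> r"]; (unfold kc)?)
    show "(f \<circ> r) 0 = x" using s by (simp add: r_def)
    show "bij_betw (f \<circ> r) {..<k} (verts B)" "bij_betw (g \<circ> r) {..<k} (edges B)"
      using bij_betw_trans[OF r f] bij_betw_trans[OF r g] by auto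
    fix i assume i: "i < k"
    have "nxt k i = Suc i mod k" using i by (auto simp: nxt_def)
    hence "r (nxt k i) = (Suc i + s) mod k" by (simp add: r_def mod_add_left_eq)
    also have "\<dots> = Suc (r i) mod k" by (simp add: r_def mod_Suc_eq)
    finally show "ends B ((g \<circ> r) i) = {(f \<circ> r) i, (f \<circ> r) (nxt k i)}"
      using e[of "r i"] k by (simp add: r_def)
  qed
qed

context spine begin

lemma gated_cycle_ex:
  assumes j: "j \<ge> 2" and cyc: "is_cycle (C j)" and k3: "card (verts (C j)) \<ge> 3"
  shows "\<exists>f pos a. gated_cycle (chips \<Gamma>) (verts \<Gamma>) (card (verts (C j))) f pos \<and>
    f ` {..<card (verts (C j))} = verts (C j) \<and> f 0 = q j \<and> 0 < a \<and> a < card (verts (C j)) \<and> f a = q (j - 1) \<and>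
    (\<forall>x\<in>verts \<Gamma>. (pos x = 0 \<longleftrightarrow> P j x = q j) \<and> (pos x = a \<longleftrightarrow> P j x = q (j - 1))) \<and>
    (\<forall>x y. adjacent \<Gamma> x y \<longrightarrow> pos x = pos y \<or> pos y = nxt (card (verts (C j))) (pos x) \<or> pos x = nxt (card (verts (C j))) (pos y))"
proof -
  define k where "k = card (verts (C j))"
  have j1: "j \<ge> 1" using j by simp
  interpret B: block_in \<Gamma> "C j" using blk[OF j1] .
  obtain f g where f0: "f 0 = q j" and f: "bij_betw f {..<k} (verts (C j))" and g: "bij_betw g {..<k} (edges (C j))"
    and e: "\<And>i. i < k \<Longrightarrow> ends (C j) (g i) = {f i, f (nxt k i)}"
    using cycle_rotation[OF cyc q_in(1)[OF j1]] unfolding k_def by metis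
  define pos where "pos x = the_inv_into {..<k} f (P j x)" for x
  have inj: "inj_on f {..<k}" and im: "f ` {..<k} = verts (C j)" using f by (auto simp: bij_betw_def)
  have pos: "pos x < k" "f (pos x) = P j x" if "x \<in> verts \<Gamma>" for x
    using the_inv_into_into[OF inj, of "P j x" "{..<k}"] f_the_inv_into_f[OF inj, of "P j x"] B.gate(1)[OF that] im
    by (auto simp: pos_def)
  have posf: "pos (f t) = t" if "t < k" for t
  proof -
    have "f t \<in> verts (C j)" using im that by auto
    hence "P j (f t) = f t" by (rule B.gate_block)
    thus ?thesis using the_inv_into_f_f[OF inj] that by (simp add: pos_def)
  qed
  have pos_eq: "pos x = t \<longleftrightarrow> P j x = f t" if "x \<in> verts \<Gamma>" "t < k" for x t
    using pos[OF that(1)] that(2) inj_onD[OF inj, of "pos x" t] by auto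
  have kk: "3 \<le> k" using k3 by (simp add: k_def)
  have nxt_lt: "nxt k t < k" if "t < k" for t using that kk by (auto simp: nxt_def)
  have edge: "\<exists>i<k. e' = g i \<and> (x = f i \<and> y = f (nxt k i) \<or> y = f i \<and> x = f (nxt k i))"
    if e': "e' \<in> edges \<Gamma>" "ends \<Gamma> e' = {x, y}" and ne: "pos x \<noteq> pos y" for e' x y
  proof -
    have "P j x \<noteq> P j y" using ne by (auto simp: pos_def)
    hence "e' \<in> edges (C j)" using B.gate_cross(1) e' by blast
    then obtain i where i: "i < k" "e' = g i" using g by (auto simp: bij_betw_def)
    hence "{x, y} = {f i, f (nxt k i)}" using e[OF i(1)] e' B.b(5) by simp
    thus ?thesis using i by (auto simp: doubleton_eq_iff)
  qed
  have edge1: "{e' \<in> edges \<Gamma>. ends \<Gamma> e' = {f t, f (nxt k t)}} = {g t}" if t: "t < k" for t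
  proof
    have "t \<noteq> nxt k t" using t kk by (auto simp: nxt_def)
    hence ne: "pos (f t) \<noteq> pos (f (nxt k t))" using posf t nxt_lt by simp
    show "{e' \<in> edges \<Gamma>. ends \<Gamma> e' = {f t, f (nxt k t)}} \<subseteq> {g t}"
    proof
      fix e' assume "e' \<in> {e' \<in> edges \<Gamma>. ends \<Gamma> e' = {f t, f (nxt k t)}}"
      then obtain i where i: "i < k" "e' = g i"
        "f t = f i \<and> f (nxt k t) = f (nxt k i) \<or> f (nxt k t) = f i \<and> f t = f (nxt k i)"
        using edge[OF _ _ ne] by blast
      have "t = i \<or> (nxt k t = i \<and> t = nxt k i)"
        using i posf t nxt_lt by metis
      hence "t = i" using t i(1) kk by (auto simp: nxt_def split: if_splits)
      thus "e' \<in> {g t}" using i by simp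
    qed
    have "g t \<in> edges (C j)" using g t by (auto simp: bij_betw_def)
    thus "{g t} \<subseteq> {e' \<in> edges \<Gamma>. ends \<Gamma> e' = {f t, f (nxt k t)}}" using e[OF t] B.b(4,5) by auto
  qed
  have chips1: "chips \<Gamma> (f t) (f (nxt k t)) = 1" if t: "t < k" for t
  proof -
    have "t \<noteq> nxt k t" using t kk by (auto simp: nxt_def)
    hence "f t \<noteq> f (nxt k t)" using inj_onD[OF inj, of t "nxt k t"] t nxt_lt by auto
    thus ?thesis by (simp add: chips_def edge1[OF t])
  qed
  have gc: "gated_cycle (chips \<Gamma>) (verts \<Gamma>) k f pos"
    unfolding gated_cycle_def
  proof (intro conjI allI ballI impI)
    show "3 \<le> k" by (rule kk)
    show "f t \<in> verts \<Gamma>" if "t < k" for t using im that B.b(3) by auto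
    show "pos (f t) = t" if "t < k" for t using posf that .
    show "pos x < k" if "x \<in> verts \<Gamma>" for x using pos(1)[OF that] .
    fix x y assume x: "x \<in> verts \<Gamma>" and y: "y \<in> verts \<Gamma>" and ne: "pos x \<noteq> pos y"
    let ?c = "x = f (pos x) \<and> y = f (pos y) \<and> (pos y = nxt k (pos x) \<or> pos x = nxt k (pos y))"
    show "chips \<Gamma> x y = (if ?c then 1 else 0)"
    proof (cases ?c)
      case True
      thus ?thesis
        using chips1[OF pos(1)[OF x]] chips1[OF pos(1)[OF y]] chips_sym[of \<Gamma> x y] by metis
    next
      case False
      have none: "{e' \<in> edges \<Gamma>. ends \<Gamma> e' = {x, y}} = {}"
      proof (rule ccontr)
        assume "\<not> ?thesis"
        then obtain i where i: "i < k" "x = f i \<and> y = f (nxt k i) \<or> y = f i \<and> x = f (nxt k i)"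
          using edge[OF _ _ ne] by blast
        thus False using False posf[OF i(1)] posf[OF nxt_lt[OF i(1)]] by auto
      qed
      show ?thesis unfolding chips_def none using False by simp
    qed
  qed
  obtain m where m: "j = Suc m" "m \<ge> 1" using j by (cases j) auto
  have "q m \<in> f ` {..<k}" using q_in(2)[OF m(2)] m im by simp
  then obtain a where "a \<in> {..<k}" "q m = f a" by blast
  hence a: "a < k" "f a = q m" by auto
  have a0: "a \<noteq> 0"
  proof
    assume "a = 0"
    hence "q m = q (Suc m)" using a f0 m by simp
    thus False using q_Suc_ne[OF m(2)] by simp
  qed
  have adj: "pos x = pos y \<or> pos y = nxt k (pos x) \<or> pos x = nxt k (pos y)" if xy: "adjacent \<Gamma> x y" for x y
  proof (rule ccontr)
    assume n: "\<not> ?thesis"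
    obtain e' where "e' \<in> edges \<Gamma>" "ends \<Gamma> e' = {x, y}" using xy by (auto simp: adjacent_def)
    then obtain i where "i < k" "x = f i \<and> y = f (nxt k i) \<or> y = f i \<and> x = f (nxt k i)"
      using edge n by blast
    thus False using n posf nxt_lt by auto
  qed
  have "(pos x = 0 \<longleftrightarrow> P j x = q j) \<and> (pos x = a \<longleftrightarrow> P j x = q (j - 1))" if "x \<in> verts \<Gamma>" for x
    using pos_eq[OF that, of 0] pos_eq[OF that, of a] a f0 kk m by simp
  thus ?thesis unfolding k_def[symmetric]
    using gc im f0 a a0 m adj by (intro exI[of _ f] exI[of _ pos] exI[of _ a]) auto
qed

end

locale spine_cycles = spine \<Gamma> v C q for \<Gamma> :: "('v, 'e) mgraph" and v C q +
  fixes J :: nat and f :: "nat \<Rightarrow> nat \<Rightarrow> 'v" and pos :: "nat \<Rightarrow> 'v \<Rightarrow> nat" and a :: "nat \<Rightarrow> nat"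
  assumes J: "J \<ge> 2"
    and gc: "\<And>j. j \<ge> J \<Longrightarrow> gated_cycle (chips \<Gamma>) (verts \<Gamma>) (card (verts (C j))) (f j) (pos j)"
    and fC: "\<And>j. j \<ge> J \<Longrightarrow> f j ` {..<card (verts (C j))} = verts (C j)"
    and f0: "\<And>j. j \<ge> J \<Longrightarrow> f j 0 = q j"
    and a: "\<And>j. j \<ge> J \<Longrightarrow> 0 < a j \<and> a j < card (verts (C j)) \<and> f j (a j) = q (j - 1)"
    and pos: "\<And>j x. j \<ge> J \<Longrightarrow> x \<in> verts \<Gamma> \<Longrightarrow> (pos j x = 0 \<longleftrightarrow> P j x = q j) \<and> (pos j x = a j \<longleftrightarrow> P j x = q (j - 1))"
    and adj: "\<And>j x y. j \<ge> J \<Longrightarrow> adjacent \<Gamma> x y \<Longrightarrow>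
      pos j x = pos j y \<or> pos j y = nxt (card (verts (C j))) (pos j x) \<or> pos j x = nxt (card (verts (C j))) (pos j y)"
begin

definition T :: "nat \<Rightarrow> 'v set" where "T j = D j - {q j}"

abbreviation "k j \<equiv> card (verts (C j))"

lemma T_mono: assumes "j \<le> m" "j \<ge> 1" shows "T j \<subseteq> T m"
proof (cases "j = m")
  case False
  then obtain l where l: "m = Suc l" "j \<le> l" using assms by (cases m) auto
  thus ?thesis using D_mono[OF l(2) assms(2)] D_step[of l] assms unfolding T_def by fastforce
qed simp

lemma nested_T: "j \<ge> 1 \<Longrightarrow> x \<in> verts \<Gamma> \<Longrightarrow> P j x \<noteq> q j \<Longrightarrow> x \<in> T j"
  using nested nested_ne by (auto simp: T_def)

lemma pos_T: "J \<le> j \<Longrightarrow> j \<le> N \<Longrightarrow> x \<in> verts \<Gamma> \<Longrightarrow> pos j x \<noteq> 0 \<Longrightarrow> x \<in> T N"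
  using nested_T[of j x] pos[of j x] T_mono[of j N] J by auto

lemma pos_eq_a: "J \<le> Suc j \<Longrightarrow> x \<in> verts \<Gamma> \<Longrightarrow> pos (Suc j) x = a (Suc j) \<longleftrightarrow> x \<in> D j"
  using pos[of "Suc j" x] by (simp add: D_def)

lemma k_ge_3: "j \<ge> J \<Longrightarrow> k j \<ge> 3" using gc[of j] by (simp add: gated_cycle_def)

lemma diam_ge: assumes j: "j \<ge> J" shows "k j div 2 \<le> gdiam (finite_part \<Gamma> (q j))"
proof -
  define \<phi> where "\<phi> x = min (pos j x) (k j - pos j x)" for x
  have j1: "j \<ge> 1" using j J by simp
  note k3 = k_ge_3[OF j]
  have posf: "pos j (f j t) = t" "f j t \<in> verts \<Gamma>" if "t < k j" for t
    using gc[OF j] that by (auto simp: gated_cycle_def)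
  have posk: "pos j x < k j" if "x \<in> verts \<Gamma>" for x using gc[OF j] that by (simp add: gated_cycle_def)
  have step: "\<phi> y \<le> Suc (\<phi> x)" if "adjacent \<Gamma> x y" for x y
    using adj[OF j that] posk[of x] posk[of y] adjacent_verts[OF wf that]
    unfolding \<phi>_def nxt_def by (auto split: if_splits)
  have path: "(adjacent \<Gamma> ^^ n) x y \<Longrightarrow> \<phi> y \<le> \<phi> x + n" for n x y
  proof (induction n arbitrary: y)
    case (Suc n)
    then obtain z where "(adjacent \<Gamma> ^^ n) x z" "adjacent \<Gamma> z y" by auto
    thus ?case using Suc.IH[of z] step[of z y] by simp
  qed simp
  have h: "k j div 2 < k j" using k3 by simp
  have "f j (k j div 2) \<in> D j" "q j \<in> D j" using C_D[OF j1] fC[OF j] h q_D[OF j1] by auto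
  then obtain n where n: "n \<le> gdiam (finite_part \<Gamma> (q j))" "(adjacent \<Gamma> ^^ n) (q j) (f j (k j div 2))"
    using finite_part_path[OF j1] by blast
  have "\<phi> (q j) = 0" using posf(1)[of 0] f0[OF j] k3 by (simp add: \<phi>_def)
  moreover have "\<phi> (f j (k j div 2)) = k j div 2" using posf(1)[OF h] by (simp add: \<phi>_def)
  ultimately show ?thesis using path[OF n(2)] n(1) by simp
qed

definition good :: "('v, 'e) mgraph \<Rightarrow> 'v \<Rightarrow> nat \<Rightarrow> bool" where
  "good H p N \<longleftrightarrow> sandpile H p \<and> subgraph H \<Gamma> \<and> D N \<subseteq> verts H \<and>
     (\<forall>e\<in>edges \<Gamma>. ends \<Gamma> e \<inter> T N \<noteq> {} \<longrightarrow> e \<in> edges H) \<and> p \<notin> T N"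

lemma good_chips:
  assumes g: "good H p N" and xy: "x \<in> T N \<or> y \<in> T N" shows "chips H x y = chips \<Gamma> x y"
proof -
  have "ends H = ends \<Gamma>" "edges H \<subseteq> edges \<Gamma>" using g by (auto simp: good_def subgraph_def)
  moreover have "e \<in> edges H" if "e \<in> edges \<Gamma>" "ends \<Gamma> e = {x, y}" for e
    using g xy that unfolding good_def by blast
  ultimately have "{e \<in> edges H. ends H e = {x, y}} = {e \<in> edges \<Gamma>. ends \<Gamma> e = {x, y}}" by auto
  thus ?thesis by (simp add: chips_def)
qed

lemma good_degree: assumes g: "good H p N" and x: "x \<in> T N" shows "degree H x = degree \<Gamma> x"
proof -
  have *: "ends H = ends \<Gamma>" "edges H \<subseteq> edges \<Gamma>" using g by (auto simp: good_def subgraph_def)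
  have **: "e \<in> edges H" if "e \<in> edges \<Gamma>" "x \<in> ends \<Gamma> e" for e
    using g x that unfolding good_def by blast
  have "{e \<in> edges H. x \<in> ends H e} = {e \<in> edges \<Gamma>. x \<in> ends \<Gamma> e}" using * ** by auto
  moreover have "{e \<in> edges H. ends H e = {x}} = {e \<in> edges \<Gamma>. ends \<Gamma> e = {x}}" using * ** by auto
  ultimately show ?thesis by (simp add: degree_def)
qed

lemma good_chain: assumes g: "good H p N" shows "cycle_chain H p k f pos a v J N"
proof -
  interpret sandpile H p using g by (simp add: good_def)
  have HV: "verts H \<subseteq> verts \<Gamma>" and DH: "D N \<subseteq> verts H" and pT: "p \<notin> T N"
    using g by (auto simp: good_def subgraph_def)
  have fD: "f j t \<in> verts H" if "J \<le> j" "j \<le> N" "t < k j" for j t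
  proof -
    have "f j t \<in> verts (C j)" using fC[OF that(1)] that(3) by auto
    thus ?thesis using C_D[of j] D_mono[of j N] DH that J by auto
  qed
  show ?thesis
  proof
    fix j assume j: "J \<le> j" "j \<le> N"
    have "chips H x y = chips \<Gamma> x y" if "x \<in> verts H" "y \<in> verts H" "pos j x \<noteq> pos j y" for x y
    proof (rule good_chips[OF g])
      have "pos j x \<noteq> 0 \<or> pos j y \<noteq> 0" using that by auto
      thus "x \<in> T N \<or> y \<in> T N" using pos_T[OF j] that HV by blast
    qed
    thus "gated_cycle (chips H) (verts H) (k j) (f j) (pos j)"
      using fD[OF j] HV by (intro gated_cycle_restrict[OF gc[OF j(1)]])
    show "pos j p = 0" using pos_T[OF j, of p] pT p HV by blast
    show "0 < a j \<and> a j < k j" using a[OF j(1)] by simp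
    have m: "Suc (j - 1) = j" "j - 1 \<ge> 1" using j J by auto
    have "v \<in> D (j - 1)" using v_D[OF m(2)] .
    hence "pos j v = a j" using pos_eq_a[of "j - 1" v] m j v by simp
    moreover have "v \<noteq> f j (a j)" using v_ne_q[OF m(2)] a[OF j(1)] by simp
    moreover have "v \<in> verts H" using v_D[of N] DH j J by auto
    ultimately show "v \<in> verts H \<and> pos j v = a j \<and> v \<noteq> f j (a j)" by simp
  next
    fix j assume j: "J \<le> j" "j < N"
    show "f j 0 = f (Suc j) (a (Suc j))" using f0[OF j(1)] a[of "Suc j"] j by simp
    fix x assume x: "x \<in> verts H" "pos j x \<noteq> 0"
    have "P j x \<noteq> q j" using pos[OF j(1), of x] x HV by auto
    hence "x \<in> D j" using nested[of j x] x HV j J by auto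
    thus "pos (Suc j) x = a (Suc j)" using pos_eq_a[of j x] x HV j by auto
  qed
qed

lemma good_inner:
  assumes g: "good H p N" and j: "J \<le> Suc j" "Suc j \<le> N"
  shows "cycle_chain.inner H f pos a (Suc j) = T j" "insert (f (Suc j) (a (Suc j))) (T j) = D j"
    "f (Suc j) (a (Suc j)) = q j"
proof -
  interpret cycle_chain H p k f pos a v J N using good_chain[OF g] .
  have HV: "verts H \<subseteq> verts \<Gamma>" and DH: "D N \<subseteq> verts H" using g by (auto simp: good_def subgraph_def)
  have j1: "j \<ge> 1" using j J by simp
  show fa: "f (Suc j) (a (Suc j)) = q j" using a[OF j(1)] by simp
  have "D j \<subseteq> verts H" using D_mono[of j N] j j1 DH by auto
  thus "inner (Suc j) = T j"
    unfolding inner_def fa T_def using pos_eq_a[OF j(1)] HV by auto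
  show "insert (f (Suc j) (a (Suc j))) (T j) = D j" unfolding fa T_def using q_D[OF j1] by auto
qed

end

context spine_cycles begin

definition escape :: "nat \<Rightarrow> ('v \<Rightarrow> nat) \<Rightarrow> ('v \<Rightarrow> int) \<Rightarrow> bool" where
  "escape j c h \<longleftrightarrow> c \<in> local_rec (chips \<Gamma>) (degree \<Gamma>) (T j) \<and>
     single_exit (chips \<Gamma>) (degree \<Gamma>) v (T j) (q j) c h"

lemma good_local_rec:
  assumes g: "good H p N" and j: "1 \<le> j" "j \<le> N"
  shows "local_rec (chips H) (degree H) (T j) = local_rec (chips \<Gamma>) (degree \<Gamma>) (T j)"
  using T_mono[OF j(2,1)] good_degree[OF g] good_chips[OF g] by (intro local_rec_cong) auto

lemma good_single_exit:
  assumes g: "good H p N" and j: "1 \<le> j" "j \<le> N"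
  shows "single_exit (chips H) (degree H) v (T j) (q j) c h \<longleftrightarrow>
    single_exit (chips \<Gamma>) (degree \<Gamma>) v (T j) (q j) c h"
  using T_mono[OF j(2,1)] good_degree[OF g] good_chips[OF g] by (intro single_exit_cong) auto

lemma good_arc:
  assumes g: "good H p N" and j: "J \<le> j" "j \<le> N"
  shows "{x \<in> verts H. pos j x \<in> ring_arc m b z} = {x \<in> verts \<Gamma>. pos j x \<in> ring_arc m b z}"
proof -
  have HV: "verts H \<subseteq> verts \<Gamma>" and DH: "D N \<subseteq> verts H" using g by (auto simp: good_def subgraph_def)
  have "x \<in> verts H" if "x \<in> verts \<Gamma>" "pos j x \<in> ring_arc m b z" for x
  proof -
    have "pos j x \<noteq> 0" using that(2) by (auto simp: ring_arc_def split: if_splits)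
    thus ?thesis using pos_T[OF j that(1)] DH by (auto simp: T_def)
  qed
  thus ?thesis using HV by blast
qed

lemma prob_le:
  assumes g: "good H p N" and i: "J \<le> Suc i" "Suc (Suc i) \<le> N"
    and M: "card (D i) \<le> M" "M < card (D (Suc i))"
  shows "avalanche_prob H {p} v M \<le> 2 / (k (Suc i) * k (Suc (Suc i)))"
proof -
  interpret cycle_chain H p k f pos a v J N using good_chain[OF g] .
  interpret tc: two_cycles H p "k (Suc i)" "f (Suc i)" "pos (Suc i)" "k (Suc (Suc i))" "f (Suc (Suc i))"
    "pos (Suc (Suc i))" "a (Suc i)" "a (Suc (Suc i))" v
    using two i by simp
  have g1: "tc.B1.gate (a (Suc i)) = T i" "tc.B2.gate (a (Suc (Suc i))) = T (Suc i)"
    using gate_eq[of "Suc i"] gate_eq[of "Suc (Suc i)"] good_inner(1)[OF g, of i] good_inner(1)[OF g, of "Suc i"] i by auto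
  have "insert (f (Suc i) 0) (T (Suc i)) = D (Suc i)"
    using good_inner(2)[OF g, of "Suc i"] joints[of "Suc i"] i by simp
  moreover have "insert (f (Suc i) (a (Suc i))) (T i) = D i" using good_inner(2)[OF g, of i] i by simp
  ultimately have "card {c \<in> recurrents. Mav H {p} c v = M} * (k (Suc i) * k (Suc (Suc i))) \<le> 2 * card recurrents"
    using tc.card_mass_le[of M] M unfolding g1 by simp
  hence "real (card {c \<in> recurrents. Mav H {p} c v = M} * (k (Suc i) * k (Suc (Suc i)))) \<le> real (2 * card recurrents)"
    by (rule of_nat_mono)
  hence "real (card {c \<in> recurrents. Mav H {p} c v = M}) * (real (k (Suc i)) * real (k (Suc (Suc i)))) \<le> 2 * real (card recurrents)"
    by simp
  moreover have "real (card recurrents) > 0" using rec_ne by (simp add: card_gt_0_iff)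
  moreover have "real (k (Suc i)) * real (k (Suc (Suc i))) > 0"
    using k_ge_3[of "Suc i"] k_ge_3[of "Suc (Suc i)"] i by (intro mult_pos_pos) auto
  ultimately show ?thesis unfolding avalanche_prob_eq by (simp add: field_simps)
qed

lemma realized:
  assumes g: "good H p N" and i: "J \<le> Suc i" "Suc i < N"
    and M: "card (D i) \<le> M" "M < card (D (Suc i))"
    and c: "c \<in> recurrent_configs H {p}" "Mav H {p} c v = M"
  shows "\<exists>c h. escape (Suc i) c h"
    and "\<exists>z. 0 < z \<and> z < k (Suc i) \<and> z \<noteq> a (Suc i) \<and>
      M = card {x \<in> verts \<Gamma>. pos (Suc i) x \<in> ring_arc (k (Suc i)) (a (Suc i)) z}"
proof -
  interpret cycle_chain H p k f pos a v J N using good_chain[OF g] .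
  have cr: "c \<in> recurrents" using c recurrent_configs_eq by simp
  have in1: "inner (Suc i) = T i" "insert (f (Suc i) (a (Suc i))) (T i) = D i"
    "inner (Suc (Suc i)) = T (Suc i)" "insert (q (Suc i)) (T (Suc i)) = D (Suc i)"
    "f (Suc (Suc i)) (a (Suc (Suc i))) = q (Suc i)"
    using good_inner[OF g, of i] good_inner[OF g, of "Suc i"] i by auto
  note me = mass_exits[OF i cr, unfolded in1 c(2), OF M]
  show "\<exists>z. 0 < z \<and> z < k (Suc i) \<and> z \<noteq> a (Suc i) \<and>
      M = card {x \<in> verts \<Gamma>. pos (Suc i) x \<in> ring_arc (k (Suc i)) (a (Suc i)) z}"
    using me(1) good_arc[OF g, of "Suc i"] i by simp
  obtain h where h: "single_exit (chips H) (degree H) v (T (Suc i)) (q (Suc i)) c h" using me(2) by blast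
  have iN: "1 \<le> Suc i" "Suc i \<le> N" using i by auto
  define c1 where "c1 x = (if x \<in> T (Suc i) then c x else 0)" for x
  interpret tc: two_cycles H p "k (Suc i)" "f (Suc i)" "pos (Suc i)" "k (Suc (Suc i))" "f (Suc (Suc i))"
    "pos (Suc (Suc i))" "a (Suc i)" "a (Suc (Suc i))" v
    using two i by simp
  have TV0: "T (Suc i) \<subseteq> V0"
    using tc.B2.gate_V0[of "a (Suc (Suc i))"] as[of "Suc (Suc i)"] gate_eq[of "Suc (Suc i)"] in1 i by simp
  have "allowed (chips H) (T (Suc i)) c1"
    using allowed_subset[OF recD(1)[OF cr] TV0] by (rule allowed_mono) (simp add: c1_def)
  hence "c1 \<in> local_rec (chips H) (degree H) (T (Suc i))"
    using recD(3)[OF cr] TV0 by (auto simp: local_rec_def c1_def)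
  moreover have "single_exit (chips H) (degree H) v (T (Suc i)) (q (Suc i)) c1 h"
    using h single_exit_cong[of "T (Suc i)" c c1 "degree H" "degree H" "q (Suc i)" "chips H" "chips H" h h v]
    by (simp add: c1_def)
  ultimately have "escape (Suc i) c1 h"
    unfolding escape_def good_local_rec[OF g iN, symmetric] good_single_exit[OF g iN, symmetric] by simp
  thus "\<exists>c h. escape (Suc i) c h" by blast
qed

lemma prob_ge:
  assumes g: "good H p N" and i: "J \<le> Suc i1" "i1 \<le> i" "Suc i < N"
    and e: "escape i1 c1 h1"
    and z: "0 < z" "z < k (Suc i)" "z \<noteq> a (Suc i)"
      "M = card {x \<in> verts \<Gamma>. pos (Suc i) x \<in> ring_arc (k (Suc i)) (a (Suc i)) z}"
  shows "(\<Prod>j=Suc i1..<Suc i. real (k j - 2) / real (k j)) / real (card (local_rec (chips \<Gamma>) (degree \<Gamma>) (T i1)))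
    / (k (Suc i) * k (Suc (Suc i))) \<le> avalanche_prob H {p} v M"
proof -
  interpret cycle_chain H p k f pos a v J N using good_chain[OF g] .
  have iN: "1 \<le> i1" "i1 \<le> N" using i J by auto
  have in1: "inner (Suc i1) = T i1" "f (Suc i1) (a (Suc i1)) = q i1" using good_inner[OF g, of i1] i by auto
  let ?R = "card (local_rec (chips \<Gamma>) (degree \<Gamma>) (T i1))"
  let ?B = "card {c \<in> recurrents. Mav H {p} c v = M}"
  have "card recurrents * (\<Prod>j=Suc i1..<Suc i. k j - 2) \<le> ?B * ?R * (\<Prod>j=Suc i1..<Suc i. k j) * (k (Suc i) * k (Suc (Suc i)))"
  proof -
    have c1: "c1 \<in> local_rec (chips H) (degree H) (inner (Suc i1))"
      using e unfolding in1 good_local_rec[OF g iN] escape_def by simp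
    have h1: "single_exit (chips H) (degree H) v (inner (Suc i1)) (f (Suc i1) (a (Suc i1))) c1 h1"
      using e unfolding in1 good_single_exit[OF g iN] escape_def by simp
    have M: "M = card {x \<in> verts H. pos (Suc i) x \<in> ring_arc (k (Suc i)) (a (Suc i)) z}"
      using z(4) good_arc[OF g, of "Suc i"] i by simp
    have ii: "Suc i1 \<le> Suc i" using i by simp
    show ?thesis
      using card_mass_ge[OF i(1) ii i(3) c1 h1 z(1-3) M] unfolding in1 good_local_rec[OF g iN] .
  qed
  hence "real (card recurrents * (\<Prod>j=Suc i1..<Suc i. k j - 2)) \<le>
    real (?B * ?R * (\<Prod>j=Suc i1..<Suc i. k j) * (k (Suc i) * k (Suc (Suc i))))" by (rule of_nat_mono)
  hence main: "real (card recurrents) * (\<Prod>j=Suc i1..<Suc i. real (k j - 2)) \<le>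
    real ?B * real ?R * (\<Prod>j=Suc i1..<Suc i. real (k j)) * (real (k (Suc i)) * real (k (Suc (Suc i))))"
    by (simp only: of_nat_mult of_nat_prod)
  have k0: "real (k j) > 0" if "j \<ge> J" for j using k_ge_3[OF that] by simp
  have pk: "(\<Prod>j=Suc i1..<Suc i. real (k j)) > 0" using k0 i by (intro prod_pos) auto
  have kk: "real (k (Suc i)) * real (k (Suc (Suc i))) > 0" using k0 i by (intro mult_pos_pos) auto
  have rec0: "real (card recurrents) > 0" using rec_ne by (simp add: card_gt_0_iff)
  show ?thesis
  proof (cases "?R = 0")
    case True
    thus ?thesis by (simp add: avalanche_prob_eq)
  next
    case False
    hence R: "real ?R > 0" by simp
    have "(\<Prod>j=Suc i1..<Suc i. real (k j - 2) / real (k j)) =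
      (\<Prod>j=Suc i1..<Suc i. real (k j - 2)) / (\<Prod>j=Suc i1..<Suc i. real (k j))" by (rule prod_dividef)
    moreover have "X / Y / r / w \<le> b / n"
      if "n * X \<le> b * r * Y * w" "Y > 0" "r > 0" "w > 0" "n > 0" for X Y r w b n :: real
      using that by (simp add: field_simps)
    ultimately show ?thesis unfolding avalanche_prob_eq using main pk R kk rec0 by simp
  qed
qed

lemma prob_const:
  assumes g: "good H p N" and i: "J \<le> Suc i" "Suc (Suc i) < N"
    and M: "card (D i) \<le> M" "M < card (D (Suc i))"
  shows "avalanche_prob H {p} v M =
    card {c \<in> local_rec (chips \<Gamma>) (degree \<Gamma>) (T (Suc (Suc i))). c (q (Suc i)) + 2 = degree \<Gamma> (q (Suc i)) \<and>
      (\<exists>h. single_exit (chips \<Gamma>) (degree \<Gamma>) v (T (Suc i)) (q (Suc i)) c h \<and> card {x \<in> T (Suc i). h x > 0} = M)}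
    / card (local_rec (chips \<Gamma>) (degree \<Gamma>) (T (Suc (Suc i))))"
proof -
  interpret cycle_chain H p k f pos a v J N using good_chain[OF g] .
  have in1: "inner (Suc i) = T i" "insert (f (Suc i) (a (Suc i))) (T i) = D i"
    "inner (Suc (Suc i)) = T (Suc i)" "insert (q (Suc i)) (T (Suc i)) = D (Suc i)"
    "f (Suc (Suc i)) (a (Suc (Suc i))) = q (Suc i)" "inner (Suc (Suc (Suc i))) = T (Suc (Suc i))"
    using good_inner[OF g, of i] good_inner[OF g, of "Suc i"] good_inner[OF g, of "Suc (Suc i)"] i by auto
  have f: "f (Suc i) 0 = q (Suc i)" using f0 i by simp
  have iN: "1 \<le> Suc i" "Suc i \<le> N" "1 \<le> Suc (Suc i)" "Suc (Suc i) \<le> N" using i by auto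
  have "q (Suc i) \<in> T N"
    using q_D[of "Suc i"] D_step[of "Suc i" "q (Suc i)"] T_mono[of "Suc (Suc i)" N] i unfolding T_def by auto
  hence dg: "degree H (q (Suc i)) = degree \<Gamma> (q (Suc i))" by (rule good_degree[OF g])
  show ?thesis
    using avalanche_prob_local[OF i, of M, unfolded in1 f dg good_local_rec[OF g iN(3,4)] good_single_exit[OF g iN(1,2)], OF M] .
qed

lemma card_D_less: assumes "j \<ge> 1" shows "card (D j) < card (D (Suc j))"
proof -
  have "q (Suc j) \<in> D (Suc j)" "q (Suc j) \<notin> D j" using q_D[of "Suc j"] D_step[of j] assms by auto
  thus ?thesis using D_mono[of j "Suc j"] finite_part(2)[of "Suc j"] assms by (intro psubset_card_mono) auto
qed

lemma card_D_ge: "card (D (Suc n)) \<ge> n"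
proof (induction n)
  case (Suc n) thus ?case using card_D_less[of "Suc n"] by simp
qed simp

lemma locate_mass:
  assumes "card (D i0) \<le> M" shows "\<exists>i\<ge>i0. card (D i) \<le> M \<and> M < card (D (Suc i))"
proof -
  let ?Q = "\<lambda>i. i \<ge> i0 \<and> M < card (D (Suc i))"
  have "?Q (Suc M + i0)" using card_D_ge[of "Suc M + i0"] by simp
  hence Q: "?Q (LEAST i. ?Q i)" by (rule LeastI[of ?Q])
  have mn: "\<not> ?Q i" if "i < (LEAST i. ?Q i)" for i using not_less_Least[OF that] .
  define i where "i = (LEAST i. ?Q i)"
  have "card (D i) \<le> M"
  proof (cases "i = i0")
    case False
    hence "i - 1 < i" "i - 1 \<ge> i0" "Suc (i - 1) = i" using Q by (auto simp: i_def)
    thus ?thesis using mn[of "i - 1"] unfolding i_def[symmetric] by auto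
  qed (use assms in simp)
  thus ?thesis using Q unfolding i_def[symmetric] by blast
qed

end

lemma eventually_subset_of_chain:
  fixes S :: "nat \<Rightarrow> 'a set"
  assumes mono: "\<And>n. S n \<subseteq> S (Suc n)" and F: "finite F" "F \<subseteq> (\<Union>n. S n)"
  shows "\<forall>\<^sub>F n in sequentially. F \<subseteq> S n"
proof -
  have "\<forall>\<^sub>F n in sequentially. x \<in> S n" if x: "x \<in> F" for x
  proof -
    obtain m where "x \<in> S m" using F(2) x by blast
    hence "x \<in> S n" if "n \<ge> m" for n using lift_Suc_mono_le[of S, OF mono that] by blast
    thus ?thesis unfolding eventually_sequentially by blast
  qed
  hence "\<forall>\<^sub>F n in sequentially. \<forall>x\<in>F. x \<in> S n" using F(1) by (simp add: eventually_ball_finite_distrib)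
  thus ?thesis by (simp add: subset_eq)
qed

context spine_cycles begin

lemma eventually_good:
  assumes ex: "exhaustion \<Gamma> H" and vH: "\<And>n. v \<in> verts (H n)"
    and bd: "\<And>n. internal_boundary \<Gamma> (H n) = {p n}" and N: "N \<ge> 1"
  shows "\<forall>\<^sub>F n in sequentially. good (H n) (p n) N"
proof -
  have sub: "subgraph (H n) \<Gamma>" "finite_mgraph (H n)" "connected_mgraph (H n)" "subgraph (H n) (H (Suc n))" for n
    using ex by (auto simp: exhaustion_def)
  have U: "(\<Union>n. verts (H n)) = verts \<Gamma>" "(\<Union>n. edges (H n)) = edges \<Gamma>" using ex by (auto simp: exhaustion_def)
  let ?E = "{e \<in> edges \<Gamma>. ends \<Gamma> e \<inter> T N \<noteq> {}}"
  have fD: "finite (D N)" by (rule finite_part(2)[OF N])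
  have DV: "D N \<subseteq> verts \<Gamma>" by (auto simp: D_def)
  have "?E \<subseteq> (\<Union>x\<in>D N. {e \<in> edges \<Gamma>. x \<in> ends \<Gamma> e})" by (auto simp: T_def)
  moreover have "finite (\<Union>x\<in>D N. {e \<in> edges \<Gamma>. x \<in> ends \<Gamma> e})"
    using fD lf DV by (intro finite_UN_I) (auto simp: locally_finite_def)
  ultimately have fE: "finite ?E" by (rule finite_subset)
  have "\<forall>\<^sub>F n in sequentially. D N \<subseteq> verts (H n)"
    using sub(4) U(1) DV by (intro eventually_subset_of_chain fD) (auto simp: subgraph_def)
  moreover have "\<forall>\<^sub>F n in sequentially. ?E \<subseteq> edges (H n)"
    using sub(4) U(2) by (intro eventually_subset_of_chain fE) (auto simp: subgraph_def)
  ultimately show ?thesis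
  proof eventually_elim
    case (elim n)
    have pb: "p n \<in> internal_boundary \<Gamma> (H n)" using bd by simp
    then obtain y where y: "y \<in> verts \<Gamma> - verts (H n)" "adjacent \<Gamma> (p n) y" by (auto simp: internal_boundary_def)
    have pT: "p n \<notin> T N"
      using D_cut[OF N, of "p n" y] y elim(1) by (auto simp: T_def)
    have "v \<noteq> p n" using pT v_D[OF N] v_ne_q[OF N] by (auto simp: T_def)
    hence "\<exists>x\<in>verts (H n). x \<noteq> p n" using vH by blast
    moreover have "p n \<in> verts (H n)" using pb by (simp add: internal_boundary_def)
    moreover have "wf_mgraph (H n)" using sub(1)[of n] by (simp add: subgraph_def)
    ultimately have "sandpile (H n) (p n)" using sub by unfold_locales auto
    thus ?case unfolding good_def using sub(1) elim pT by auto
  qed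
qed

lemma path_length:
  assumes g: "good H p N" and N: "N \<ge> 2"
    and path: "p \<noteq> v \<Longrightarrow> block_path_joining H v p (map C [1..<Suc r])"
  shows "r \<ge> N"
proof (rule ccontr)
  assume r: "\<not> r \<ge> N"
  have pT: "p \<notin> T N" using g by (simp add: good_def)
  have "p \<noteq> v" using pT v_D[of N] v_ne_q[of N] N by (auto simp: T_def)
  hence c: "connects H v p (map C [1..<Suc r])" using path by (simp add: block_path_joining_def)
  hence "r \<ge> 1" by (cases r) (auto simp: connects_def)
  hence "last (map C [1..<Suc r]) = C r" by simp
  hence "p \<in> verts (C r)" using c by (simp add: connects_def)
  hence "p \<in> D r" using C_D[OF \<open>r \<ge> 1\<close>] by auto
  hence "p \<in> T (Suc r)" using D_step[OF \<open>r \<ge> 1\<close>] by (auto simp: T_def)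
  thus False using T_mono[of "Suc r" N] r pT by auto
qed

end

section \<open>Asymptotics\<close>

lemma one_minus_two_over_ge:
  fixes m :: nat assumes "m \<ge> 3" shows "exp (- 6 / real m) \<le> real (m - 2) / real m"
proof -
  have m: "real (m - 2) > 0" "real (m - 2) = real m - 2" using assms by (auto simp: of_nat_diff)
  have "real m / real (m - 2) = 1 + 2 / real (m - 2)" using m by (simp add: field_simps)
  also have "\<dots> \<le> exp (2 / real (m - 2))" by (rule exp_ge_add_one_self)
  also have "\<dots> \<le> exp (6 / real m)"
    using assms m by (simp add: field_simps)
  finally have "inverse (exp (6 / real m)) \<le> inverse (real m / real (m - 2))"
    using m assms by (intro le_imp_inverse_le divide_pos_pos) auto
  thus ?thesis by (simp add: exp_minus)
qed

lemma log_ratio_limits: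
  fixes d k D :: "nat \<Rightarrow> real"
  assumes c: "c > 0"
    and kD: "\<forall>\<^sub>F i in sequentially. k i / 3 \<le> D i" and Dk: "\<forall>\<^sub>F i in sequentially. D i \<le> c * k i"
    and kd: "\<forall>\<^sub>F i in sequentially. k i \<le> d i"
    and D: "filterlim D at_top sequentially"
    and ratio: "(\<lambda>i. ln (d (i - 1)) / ln (d i)) \<longlonglongrightarrow> 1"
    and \<alpha>: "(\<lambda>i. ln (d i) / ln (D i)) \<longlonglongrightarrow> \<alpha>"
  shows "\<alpha> > 0"
    and "(\<lambda>i. (ln (k (Suc i)) + ln (k (Suc (Suc i)))) / ln (d i)) \<longlonglongrightarrow> 2 / \<alpha>"
    and "(\<lambda>i. (ln (k (Suc i)) + ln (k (Suc (Suc i)))) / ln (d (Suc i))) \<longlonglongrightarrow> 2 / \<alpha>"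
proof -
  have lnD: "filterlim (\<lambda>i. ln (D i)) at_top sequentially" by (rule filterlim_compose[OF ln_at_top D])
  have Dpos: "\<forall>\<^sub>F i in sequentially. D i > 1" using D by (rule filterlim_at_top_dense[THEN iffD1, rule_format])
  have kpos: "\<forall>\<^sub>F i in sequentially. k i > 0"
    using Dk Dpos
  proof eventually_elim
    case (elim i)
    hence "0 < c * k i" by simp
    thus ?case using c by (simp add: zero_less_mult_iff)
  qed
  have low: "\<forall>\<^sub>F i in sequentially. ln (D i) - ln c \<le> ln (k i)"
    using Dk Dpos kpos
  proof eventually_elim
    case (elim i)
    have "ln (D i) \<le> ln (c * k i)" using elim by (intro ln_mono) auto
    also have "\<dots> = ln c + ln (k i)" using c elim by (simp add: ln_mult)
    finally show ?case by simp
  qed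
  have high: "\<forall>\<^sub>F i in sequentially. ln (k i) \<le> ln (D i) + ln 3"
    using kD Dpos kpos
  proof eventually_elim
    case (elim i)
    have "ln (k i) \<le> ln (D i * 3)" using elim by (intro ln_mono) auto
    also have "\<dots> = ln (D i) + ln 3" using elim by (simp add: ln_mult)
    finally show ?case .
  qed
  have lnkd: "\<forall>\<^sub>F i in sequentially. ln (k i) \<le> ln (d i)"
    using kd kpos by eventually_elim (auto intro: ln_mono)
  have "1 \<le> \<alpha>"
  proof (rule tendsto_le[OF sequentially_bot \<alpha>])
    show "(\<lambda>i. 1 - ln c * inverse (ln (D i))) \<longlonglongrightarrow> 1"
      using tendsto_diff[OF tendsto_const tendsto_mult_right_zero[OF tendsto_inverse_0_at_top[OF lnD]], of 1 "ln c"] by simp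
    show "\<forall>\<^sub>F i in sequentially. 1 - ln c * inverse (ln (D i)) \<le> ln (d i) / ln (D i)"
      using low lnkd Dpos
    proof eventually_elim
      case (elim i)
      have p: "ln (D i) > 0" using elim by simp
      have "(ln (D i) - ln c) / ln (D i) \<le> ln (d i) / ln (D i)" using elim p by (intro divide_right_mono) auto
      thus ?case using p by (simp add: field_simps)
    qed
  qed
  thus \<alpha>0: "\<alpha> > 0" by simp
  have lnd: "filterlim (\<lambda>i. ln (d i)) at_top sequentially"
  proof (rule filterlim_at_top_mono)
    show "filterlim (\<lambda>i. - ln c + ln (D i)) at_top sequentially"
      by (rule filterlim_tendsto_add_at_top[OF tendsto_const lnD])
    show "\<forall>\<^sub>F i in sequentially. - ln c + ln (D i) \<le> ln (d i)" using low lnkd by eventually_elim simp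
  qed
  have dpos: "\<forall>\<^sub>F i in sequentially. ln (d i) > 0" using lnd by (rule filterlim_at_top_dense[THEN iffD1, rule_format])
  have Dd: "(\<lambda>i. ln (D i) / ln (d i)) \<longlonglongrightarrow> 1 / \<alpha>"
    using tendsto_inverse[OF \<alpha>] \<alpha>0 by (simp add: inverse_eq_divide)
  have inv: "(\<lambda>i. inverse (ln (d i))) \<longlonglongrightarrow> 0" by (rule tendsto_inverse_0_at_top[OF lnd])
  have kd1: "(\<lambda>i. ln (k i) / ln (d i)) \<longlonglongrightarrow> 1 / \<alpha>"
  proof (rule tendsto_sandwich)
    show "(\<lambda>i. ln (D i) / ln (d i) + - ln c * inverse (ln (d i))) \<longlonglongrightarrow> 1 / \<alpha>"
      using tendsto_add[OF Dd tendsto_mult_right_zero[OF inv, of "- ln c"]] by simp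
    show "(\<lambda>i. ln (D i) / ln (d i) + ln 3 * inverse (ln (d i))) \<longlonglongrightarrow> 1 / \<alpha>"
      using tendsto_add[OF Dd tendsto_mult_right_zero[OF inv, of "ln 3"]] by simp
    show "\<forall>\<^sub>F i in sequentially. ln (D i) / ln (d i) + - ln c * inverse (ln (d i)) \<le> ln (k i) / ln (d i)"
      using low dpos
    proof eventually_elim
      case (elim i)
      have "(ln (D i) - ln c) / ln (d i) \<le> ln (k i) / ln (d i)" using elim by (intro divide_right_mono) auto
      thus ?case by (simp add: divide_inverse left_diff_distrib)
    qed
    show "\<forall>\<^sub>F i in sequentially. ln (k i) / ln (d i) \<le> ln (D i) / ln (d i) + ln 3 * inverse (ln (d i))"
      using high dpos
    proof eventually_elim
      case (elim i)
      have "ln (k i) / ln (d i) \<le> (ln (D i) + ln 3) / ln (d i)" using elim by (intro divide_right_mono) auto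
      thus ?case by (simp add: divide_inverse distrib_right)
    qed
  qed
  have r1: "(\<lambda>i. ln (d i) / ln (d (Suc i))) \<longlonglongrightarrow> 1"
    using LIMSEQ_Suc[OF ratio] by simp
  have r2: "(\<lambda>i. ln (d (Suc i)) / ln (d i)) \<longlonglongrightarrow> 1"
    using tendsto_inverse[OF r1] by (simp add: inverse_eq_divide)
  have dS: "\<forall>\<^sub>F i in sequentially. ln (d (Suc i)) > 0" "\<forall>\<^sub>F i in sequentially. ln (d (Suc (Suc i))) > 0"
    using dpos by (auto simp: eventually_sequentially_Suc[of "\<lambda>i. ln (d i) > 0"] eventually_sequentially_Suc[of "\<lambda>i. ln (d (Suc i)) > 0"])
  have k1: "(\<lambda>i. ln (k (Suc i)) / ln (d (Suc i))) \<longlonglongrightarrow> 1 / \<alpha>" using LIMSEQ_Suc[OF kd1] .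
  have k2: "(\<lambda>i. ln (k (Suc (Suc i))) / ln (d (Suc i))) \<longlonglongrightarrow> 1 / \<alpha>"
  proof -
    have "(\<lambda>i. ln (k (Suc (Suc i))) / ln (d (Suc (Suc i))) * (ln (d (Suc (Suc i))) / ln (d (Suc i)))) \<longlonglongrightarrow> 1 / \<alpha> * 1"
      by (intro tendsto_mult LIMSEQ_Suc[OF k1] LIMSEQ_Suc[OF r2])
    moreover have "\<forall>\<^sub>F i in sequentially. ln (k (Suc (Suc i))) / ln (d (Suc (Suc i))) * (ln (d (Suc (Suc i))) / ln (d (Suc i))) =
      ln (k (Suc (Suc i))) / ln (d (Suc i))"
      using dS(2) by eventually_elim simp
    ultimately have "(\<lambda>i. ln (k (Suc (Suc i))) / ln (d (Suc i))) \<longlonglongrightarrow> 1 / \<alpha> * 1"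
      by (rule Lim_transform_eventually)
    thus ?thesis by simp
  qed
  show s: "(\<lambda>i. (ln (k (Suc i)) + ln (k (Suc (Suc i)))) / ln (d (Suc i))) \<longlonglongrightarrow> 2 / \<alpha>"
    using tendsto_add[OF k1 k2] by (simp add: add_divide_distrib)
  have "(\<lambda>i. (ln (k (Suc i)) + ln (k (Suc (Suc i)))) / ln (d (Suc i)) * (ln (d (Suc i)) / ln (d i))) \<longlonglongrightarrow> 2 / \<alpha> * 1"
    by (intro tendsto_mult s r2)
  moreover have "\<forall>\<^sub>F i in sequentially. (ln (k (Suc i)) + ln (k (Suc (Suc i)))) / ln (d (Suc i)) * (ln (d (Suc i)) / ln (d i)) =
      (ln (k (Suc i)) + ln (k (Suc (Suc i)))) / ln (d i)"
    using dS(1) by eventually_elim simp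
  ultimately have "(\<lambda>i. (ln (k (Suc i)) + ln (k (Suc (Suc i)))) / ln (d i)) \<longlonglongrightarrow> 2 / \<alpha> * 1"
    by (rule Lim_transform_eventually)
  thus "(\<lambda>i. (ln (k (Suc i)) + ln (k (Suc (Suc i)))) / ln (d i)) \<longlonglongrightarrow> 2 / \<alpha>" by simp
qed

lemma power_law_bounds:
  fixes M d d' K K' \<delta> \<epsilon> :: real
  assumes M: "1 < d" "d \<le> M" "M \<le> d'" and K: "1 \<le> K" "1 \<le> K'"
    and lo: "(ln K + ln K') / ln d < \<delta> + \<epsilon>" and hi: "\<delta> - \<epsilon> < (ln K + ln K') / ln d'" and \<delta>: "\<delta> > 0" "\<epsilon> > 0"
  shows "M powr (- \<delta> - \<epsilon>) \<le> 1 / (K * K')" "1 / (K * K') \<le> M powr (- \<delta> + \<epsilon>)"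
proof -
  have l: "ln d > 0" "ln d \<le> ln M" "ln M \<le> ln d'" "ln d' > 0" using M by auto
  have e: "1 / (K * K') = exp (- (ln K + ln K'))" unfolding exp_minus using K by (simp add: exp_add inverse_eq_divide)
  have "ln K + ln K' \<le> (\<delta> + \<epsilon>) * ln d" using lo l by (simp add: field_simps)
  also have "\<dots> \<le> (\<delta> + \<epsilon>) * ln M" using l \<delta> by (intro mult_left_mono) auto
  finally have "(- \<delta> - \<epsilon>) * ln M \<le> - (ln K + ln K')" by (simp add: algebra_simps)
  thus "M powr (- \<delta> - \<epsilon>) \<le> 1 / (K * K')" unfolding e using M by (simp add: powr_def)
  have "(\<delta> - \<epsilon>) * ln M \<le> ln K + ln K'"
  proof (cases "\<delta> - \<epsilon> \<ge> 0")
    case True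
    hence "(\<delta> - \<epsilon>) * ln M \<le> (\<delta> - \<epsilon>) * ln d'" using l by (intro mult_left_mono) auto
    also have "\<dots> \<le> ln K + ln K'" using hi l by (simp add: field_simps)
    finally show ?thesis .
  next
    case False
    hence "(\<delta> - \<epsilon>) * ln M \<le> 0" using l by (intro mult_nonpos_nonneg) auto
    moreover have "0 \<le> ln K + ln K'" using K by simp
    ultimately show ?thesis by linarith
  qed
  thus "1 / (K * K') \<le> M powr (- \<delta> + \<epsilon>)" unfolding e using M by (simp add: powr_def algebra_simps)
qed

lemma critical_with_exponentI:
  assumes "\<delta> > 0" "C1 > 0" "C2 > 0"
    and "\<And>\<epsilon>. \<epsilon> > 0 \<Longrightarrow> \<exists>M\<epsilon>\<ge>1. \<forall>M. M\<epsilon> < real M \<and> realizable H P v M \<longrightarrow>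
        (\<exists>L. (\<lambda>n. avalanche_prob (H n) (P n) v M) \<longlonglongrightarrow> L \<and>
          C1 * real M powr (- \<delta> - \<epsilon>) \<le> L \<and> L \<le> C2 * real M powr (- \<delta> + \<epsilon>))"
  shows "critical_with_exponent H P v \<delta>"
  unfolding critical_with_exponent_def
  by (intro conjI assms(1), rule exI[of _ C1], intro conjI assms(2), rule exI[of _ C2], intro conjI assms(3),
      intro allI impI, rule assms(4))

context spine_cycles begin

lemma product_lower_bound:
  assumes B: "\<And>N. (\<Sum>j\<in>{j\<in>{1..N}. k j > 2}. 1 / real (k j)) \<le> B" and m: "m \<ge> J"
  shows "exp (- 6 * B) \<le> (\<Prod>j=m..<n. real (k j - 2) / real (k j))"
proof -
  have "{m..<n} \<subseteq> {j\<in>{1..n}. k j > 2}"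
  proof
    fix j assume "j \<in> {m..<n}"
    thus "j \<in> {j\<in>{1..n}. k j > 2}" using k_ge_3[of j] m J by auto
  qed
  hence "(\<Sum>j=m..<n. 1 / real (k j)) \<le> (\<Sum>j\<in>{j\<in>{1..n}. k j > 2}. 1 / real (k j))"
    by (intro sum_mono2) auto
  also have "\<dots> \<le> B" by (rule B)
  finally have "- 6 * B \<le> - 6 * (\<Sum>j=m..<n. 1 / real (k j))" by simp
  also have "\<dots> = (\<Sum>j=m..<n. - 6 / real (k j))" unfolding sum_distrib_left by simp
  finally have "exp (- 6 * B) \<le> exp (\<Sum>j=m..<n. - 6 / real (k j))" by simp
  also have "\<dots> = (\<Prod>j=m..<n. exp (- 6 / real (k j)))" by (rule exp_sum) simp
  also have "\<dots> \<le> (\<Prod>j=m..<n. real (k j - 2) / real (k j))"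
  proof (rule prod_mono)
    fix j assume "j \<in> {m..<n}"
    hence "3 \<le> k j" using k_ge_3 m by simp
    thus "0 \<le> exp (- 6 / real (k j)) \<and> exp (- 6 / real (k j)) \<le> real (k j - 2) / real (k j)"
      using one_minus_two_over_ge by simp
  qed
  finally show ?thesis .
qed

lemma critical_exponent:
  assumes ex: "exhaustion \<Gamma> H" and vH: "\<And>n. v \<in> verts (H n)"
    and bd: "\<And>n. internal_boundary \<Gamma> (H n) = {p n}"
    and path: "\<And>n. p n \<noteq> v \<Longrightarrow> block_path_joining (H n) v (p n) (map C [1..<Suc (r n)])"
    and conv: "convergent (\<lambda>n. \<Sum>j \<in> {j \<in> {1..r n}. card (verts (C j)) > 2}. 1 / real (card (verts (C j))))"
    and c: "c > 0" "\<forall>\<^sub>F i in sequentially. real (gdiam (finite_part \<Gamma> (q i))) \<le> c * real (k i)"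
    and ratio: "(\<lambda>i. ln (real (card (verts (finite_part \<Gamma> (q (i - 1)))))) /
              ln (real (card (verts (finite_part \<Gamma> (q i)))))) \<longlonglongrightarrow> 1"
    and \<alpha>: "(\<lambda>i. ln (real (card (verts (finite_part \<Gamma> (q i))))) /
              ln (real (gdiam (finite_part \<Gamma> (q i))))) \<longlonglongrightarrow> \<alpha>"
  shows "critical_with_exponent H (\<lambda>n. {p n}) v (2 / \<alpha>)"
proof -
  note good = eventually_good[of H p, OF ex vH bd]
  let ?S = "\<lambda>m. \<Sum>j\<in>{j\<in>{1..m}. k j > 2}. 1 / real (k j)"
  obtain B where B: "\<And>n. norm (?S (r n)) \<le> B"
    using convergent_imp_Bseq[OF conv] unfolding Bseq_def by blast
  have SB: "?S N \<le> B" for N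
  proof -
    obtain n where n: "good (H n) (p n) (N + 2)"
      using eventually_happens'[OF sequentially_bot good[of "N + 2"]] by auto
    have "r n \<ge> N" using path_length[OF n _ path[of n]] by simp
    hence "?S N \<le> ?S (r n)" by (intro sum_mono2) auto
    thus ?thesis using B[of n] by simp
  qed
  have dD: "\<forall>\<^sub>F i in sequentially. real (card (verts (finite_part \<Gamma> (q i)))) = real (card (D i))"
    using eventually_ge_at_top[of 1] by eventually_elim (simp add: finite_part(1))
  have diam: "filterlim (\<lambda>i. real (gdiam (finite_part \<Gamma> (q i)))) at_top sequentially"
    unfolding filterlim_at_top
  proof
    fix Z :: real
    show "\<forall>\<^sub>F i in sequentially. Z \<le> real (gdiam (finite_part \<Gamma> (q i)))"
      using diam_tendsto[of "nat \<lceil>Z\<rceil>"] by eventually_elim linarith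
  qed
  have lo: "\<forall>\<^sub>F i in sequentially. real (k i) / 3 \<le> real (gdiam (finite_part \<Gamma> (q i)))"
    using eventually_ge_at_top[of J]
  proof eventually_elim
    case (elim i)
    have "k i \<le> 3 * (k i div 2)" using k_ge_3[OF elim] by presburger
    also have "\<dots> \<le> 3 * gdiam (finite_part \<Gamma> (q i))" using diam_ge[OF elim] by simp
    finally have "real (k i) \<le> real (3 * gdiam (finite_part \<Gamma> (q i)))" by (rule of_nat_mono)
    thus ?case by simp
  qed
  have kd: "\<forall>\<^sub>F i in sequentially. real (k i) \<le> real (card (verts (finite_part \<Gamma> (q i))))"
    using eventually_ge_at_top[of 1]
  proof eventually_elim
    case (elim i)
    thus ?case using card_mono[OF finite_part(2)[OF elim] C_D[OF elim]] finite_part(1)[OF elim] by simp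
  qed
  note lim = log_ratio_limits[OF c(1) lo c(2) kd diam ratio \<alpha>]
  define \<delta> where "\<delta> = 2 / \<alpha>"
  have \<delta>: "\<delta> > 0" using lim(1) by (simp add: \<delta>_def)
  have range: "\<exists>i0\<ge>J. \<forall>i\<ge>i0. (ln (real (k (Suc i))) + ln (real (k (Suc (Suc i))))) / ln (real (card (D i))) < \<delta> + \<epsilon> \<and>
      \<delta> - \<epsilon> < (ln (real (k (Suc i))) + ln (real (k (Suc (Suc i))))) / ln (real (card (D (Suc i))))" if "\<epsilon> > 0" for \<epsilon>
  proof -
    have "\<forall>\<^sub>F i in sequentially. (ln (real (k (Suc i))) + ln (real (k (Suc (Suc i))))) / ln (real (card (verts (finite_part \<Gamma> (q i))))) < \<delta> + \<epsilon>"
      using order_tendstoD(2)[OF lim(2), of "\<delta> + \<epsilon>"] that by (simp add: \<delta>_def)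
    moreover have "\<forall>\<^sub>F i in sequentially. \<delta> - \<epsilon> < (ln (real (k (Suc i))) + ln (real (k (Suc (Suc i))))) / ln (real (card (verts (finite_part \<Gamma> (q (Suc i))))))"
      using order_tendstoD(1)[OF lim(3), of "\<delta> - \<epsilon>"] that by (simp add: \<delta>_def)
    ultimately have "\<forall>\<^sub>F i in sequentially. (ln (real (k (Suc i))) + ln (real (k (Suc (Suc i))))) / ln (real (card (D i))) < \<delta> + \<epsilon> \<and>
      \<delta> - \<epsilon> < (ln (real (k (Suc i))) + ln (real (k (Suc (Suc i))))) / ln (real (card (D (Suc i))))"
      using eventually_ge_at_top[of 1] by eventually_elim (simp add: finite_part(1))
    then obtain i0 where "\<forall>i\<ge>i0. (ln (real (k (Suc i))) + ln (real (k (Suc (Suc i))))) / ln (real (card (D i))) < \<delta> + \<epsilon> \<and>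
      \<delta> - \<epsilon> < (ln (real (k (Suc i))) + ln (real (k (Suc (Suc i))))) / ln (real (card (D (Suc i))))"
      unfolding eventually_sequentially by blast
    thus ?thesis by (intro exI[of _ "max i0 J"]) auto
  qed
  have witness: "\<exists>n. good (H n) (p n) N \<and> (\<exists>c\<in>recurrent_configs (H n) {p n}. Mav (H n) {p n} c v = M)"
    if "realizable H (\<lambda>n. {p n}) v M" "N \<ge> 1" for M N
  proof -
    have "\<exists>\<^sub>F n in sequentially. (\<exists>c\<in>recurrent_configs (H n) {p n}. Mav (H n) {p n} c v = M) \<and> good (H n) (p n) N"
      using that(1) good[OF that(2)] unfolding realizable_def by (auto dest: frequently_eventually_frequently)
    thus ?thesis using frequently_ex by fastforce
  qed
  \<comment> \<open>The chip added at \<open>v\<close> may be unable to make a single chip leave \<open>D i\<close> for any large \<open>i\<close>: a double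
    edge at the beginning of the block-path lets only even numbers of chips pass, and two chips remain two
    if all later cycles are divided evenly. Then no large mass is realizable.\<close>
  show ?thesis
  proof (cases "\<exists>i1\<ge>J. \<exists>c h. escape i1 c h")
    case False
    have none: "\<not> (realizable H (\<lambda>n. {p n}) v M \<and> real M > real (card (D J)) + 1)" for M
    proof
      assume A: "realizable H (\<lambda>n. {p n}) v M \<and> real M > real (card (D J)) + 1"
      hence "card (D J) \<le> M" by linarith
      then obtain i where i: "i \<ge> J" "card (D i) \<le> M" "M < card (D (Suc i))" using locate_mass by blast
      obtain n c where n: "good (H n) (p n) (Suc (Suc i))" "c \<in> recurrent_configs (H n) {p n}" "Mav (H n) {p n} c v = M"
        using witness[of M "Suc (Suc i)"] A by auto
      have "\<exists>c h. escape (Suc i) c h" using realized(1)[OF n(1) _ _ i(2,3) n(2,3)] i(1) by simp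
      thus False using False i(1) by (meson le_SucI)
    qed
    show ?thesis unfolding \<delta>_def[symmetric]
    proof (rule critical_with_exponentI[OF \<delta>, of 1 1])
      fix \<epsilon> :: real
      show "\<exists>M\<epsilon>\<ge>1. \<forall>M. M\<epsilon> < real M \<and> realizable H (\<lambda>n. {p n}) v M \<longrightarrow>
        (\<exists>L. (\<lambda>n. avalanche_prob (H n) {p n} v M) \<longlonglongrightarrow> L \<and>
          1 * real M powr (- \<delta> - \<epsilon>) \<le> L \<and> L \<le> 1 * real M powr (- \<delta> + \<epsilon>))"
        using none by (intro exI[of _ "real (card (D J)) + 1"]) auto
    qed auto
  next
    case True
    then obtain i1 c1 h1 where e: "i1 \<ge> J" "escape i1 c1 h1" by blast
    define R where "R = real (card (local_rec (chips \<Gamma>) (degree \<Gamma>) (T i1)))"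
    have R: "R > 0"
    proof -
      obtain n where n: "good (H n) (p n) (Suc i1)"
        using eventually_happens'[OF sequentially_bot good[of "Suc i1"]] by auto
      interpret cycle_chain "H n" "p n" k f pos a v J "Suc i1" using good_chain[OF n] .
      interpret B: sandpile_cycle "H n" "p n" "k (Suc i1)" "f (Suc i1)" "pos (Suc i1)" using cycle e by simp
      have "B.gate (a (Suc i1)) = T i1" using gate_eq[of "Suc i1"] good_inner(1)[OF n, of i1] e by simp
      hence "finite (local_rec (chips (H n)) (degree (H n)) (T i1))"
        using B.card_gate(2)[of "a (Suc i1)" "\<lambda>_. True"] as[of "Suc i1"] e by (simp add: depends_on_def)
      hence "finite (local_rec (chips \<Gamma>) (degree \<Gamma>) (T i1))"
        using good_local_rec[OF n, of i1] e J by simp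
      thus ?thesis using e(2) unfolding R_def escape_def by (auto simp: card_gt_0_iff)
    qed
    define C1 where "C1 = exp (- 6 * B) / R"
    have C1: "C1 > 0" using R by (simp add: C1_def)
    have "\<exists>M\<epsilon>\<ge>1. \<forall>M. M\<epsilon> < real M \<and> realizable H (\<lambda>n. {p n}) v M \<longrightarrow>
        (\<exists>L. (\<lambda>n. avalanche_prob (H n) {p n} v M) \<longlonglongrightarrow> L \<and>
          C1 * real M powr (- \<delta> - \<epsilon>) \<le> L \<and> L \<le> 2 * real M powr (- \<delta> + \<epsilon>))" if \<epsilon>: "\<epsilon> > 0" for \<epsilon>
    proof -
      obtain i0 where i0: "i0 \<ge> J" "\<And>i. i \<ge> i0 \<Longrightarrow>
        (ln (real (k (Suc i))) + ln (real (k (Suc (Suc i))))) / ln (real (card (D i))) < \<delta> + \<epsilon> \<and>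
        \<delta> - \<epsilon> < (ln (real (k (Suc i))) + ln (real (k (Suc (Suc i))))) / ln (real (card (D (Suc i))))"
        using range[OF \<epsilon>] by blast
      define i2 where "i2 = max (max i0 i1) 3"
      show ?thesis
      proof (rule exI[of _ "real (card (D i2)) + 1"], intro conjI allI impI)
        fix M assume M: "real (card (D i2)) + 1 < real M \<and> realizable H (\<lambda>n. {p n}) v M"
        hence "card (D i2) \<le> M" by linarith
        then obtain i where i: "i \<ge> i2" "card (D i) \<le> M" "M < card (D (Suc i))" using locate_mass by blast
        have ii: "i \<ge> i0" "i \<ge> i1" "i \<ge> 3" "i \<ge> J" using i(1) e(1) by (auto simp: i2_def)
        let ?N = "Suc (Suc (Suc i))"
        obtain n c where n: "good (H n) (p n) ?N" "c \<in> recurrent_configs (H n) {p n}" "Mav (H n) {p n} c v = M"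
          using witness[of M ?N] M by auto
        obtain z where z: "0 < z" "z < k (Suc i)" "z \<noteq> a (Suc i)"
          "M = card {x \<in> verts \<Gamma>. pos (Suc i) x \<in> ring_arc (k (Suc i)) (a (Suc i)) z}"
          using realized(2)[OF n(1) _ _ i(2,3) n(2,3)] ii by auto
        define L where "L = avalanche_prob (H n) {p n} v M"
        let ?K = "real (k (Suc i))" and ?K' = "real (k (Suc (Suc i)))"
        have K: "1 \<le> ?K" "1 \<le> ?K'" using k_ge_3[of "Suc i"] k_ge_3[of "Suc (Suc i)"] ii by auto
        have "avalanche_prob (H m) {p m} v M = L" if "good (H m) (p m) ?N" for m
          unfolding L_def using prob_const[OF that _ _ i(2,3)] prob_const[OF n(1) _ _ i(2,3)] ii by simp
        hence "\<forall>\<^sub>F m in sequentially. avalanche_prob (H m) {p m} v M = L"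
          using good[of ?N] by (auto elim: eventually_mono)
        hence lim: "(\<lambda>m. avalanche_prob (H m) {p m} v M) \<longlonglongrightarrow> L" by (rule tendsto_eventually)
        have up: "L \<le> 2 * (1 / (?K * ?K'))"
          unfolding L_def using prob_le[OF n(1) _ _ i(2,3)] ii by simp
        have "C1 * (1 / (?K * ?K')) \<le> (\<Prod>j=Suc i1..<Suc i. real (k j - 2) / real (k j)) / R / (?K * ?K')"
          using product_lower_bound[of B "Suc i1" "Suc i", OF SB] e(1) R K unfolding C1_def
          by (simp only: mult_1_right times_divide_eq_right) (intro divide_right_mono, auto)
        also have "\<dots> \<le> L"
          unfolding L_def R_def using prob_ge[OF n(1) _ _ _ e(2) z] ii e(1) by simp
        finally have low: "C1 * (1 / (?K * ?K')) \<le> L" .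
        have cD: "real (card (D i)) > 1" using card_D_ge[of "i - 1"] ii by simp
        note pl = power_law_bounds[OF cD, of "real M" "real (card (D (Suc i)))" ?K ?K' \<delta> \<epsilon>]
        have p: "real M powr (- \<delta> - \<epsilon>) \<le> 1 / (?K * ?K')" "1 / (?K * ?K') \<le> real M powr (- \<delta> + \<epsilon>)"
          using pl i(2,3) K i0(2)[OF ii(1)] \<delta> \<epsilon> by auto
        have "C1 * real M powr (- \<delta> - \<epsilon>) \<le> L"
          using mult_left_mono[OF p(1), of C1] C1 low by linarith
        moreover have "L \<le> 2 * real M powr (- \<delta> + \<epsilon>)" using p(2) up by linarith
        ultimately show "\<exists>L. (\<lambda>n. avalanche_prob (H n) {p n} v M) \<longlonglongrightarrow> L \<and>
          C1 * real M powr (- \<delta> - \<epsilon>) \<le> L \<and> L \<le> 2 * real M powr (- \<delta> + \<epsilon>)" using lim by blast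
      qed simp
    qed
    thus ?thesis unfolding \<delta>_def[symmetric] using C1 by (intro critical_with_exponentI[OF \<delta>, of C1 2]) auto
  qed
qed

end

theorem corollary8p1p2:
  fixes \<Gamma> :: "('v, 'e) mgraph" and v :: 'v
    and H :: "nat \<Rightarrow> ('v, 'e) mgraph" and p :: "nat \<Rightarrow> 'v"
    and C :: "nat \<Rightarrow> ('v, 'e) mgraph" and q :: "nat \<Rightarrow> 'v"
    and r :: "nat \<Rightarrow> nat" and \<alpha> :: real
  assumes "wf_mgraph \<Gamma>" and "connected_mgraph \<Gamma>" and "locally_finite \<Gamma>"
    and "infinite (verts \<Gamma>)" and "one_ended \<Gamma>" and "cactus \<Gamma>" and "v \<in> verts \<Gamma>"
    and "exhaustion \<Gamma> H" and "\<And>n. v \<in> verts (H n)"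
    and "\<And>n. internal_boundary \<Gamma> (H n) = {p n}"
    and "infinite_block_path \<Gamma> v C"
    and "\<And>i. i \<ge> 1 \<Longrightarrow> verts (C i) \<inter> verts (C (Suc i)) = {q i}"
    and "\<And>n. p n \<noteq> v \<Longrightarrow> block_path_joining (H n) v (p n) (map C [1..<Suc (r n)])"
    and "convergent (\<lambda>n. \<Sum>j \<in> {j \<in> {1..r n}. card (verts (C j)) > 2}. 1 / real (card (verts (C j))))"
    and "\<exists>c>0. \<forall>\<^sub>F i in sequentially.
           real (gdiam (finite_part \<Gamma> (q i))) \<le> c * real (card (verts (C i)))"
    and "(\<lambda>i. ln (real (card (verts (finite_part \<Gamma> (q (i - 1)))))) /
              ln (real (card (verts (finite_part \<Gamma> (q i)))))) \<longlonglongrightarrow> 1"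
    and "growth_degree \<Gamma> v = ereal \<alpha>"
    and "(\<lambda>i. ln (real (card (verts (finite_part \<Gamma> (q i))))) /
              ln (real (gdiam (finite_part \<Gamma> (q i))))) \<longlonglongrightarrow> \<alpha>"
  shows "critical_with_exponent H (\<lambda>n. {p n}) v (2 / \<alpha>)"
proof -
  interpret spine \<Gamma> v C q using assms(1-3,5,7,11,12) by unfold_locales auto
  obtain c where c: "c > 0" "\<forall>\<^sub>F i in sequentially. real (gdiam (finite_part \<Gamma> (q i))) \<le> c * real (card (verts (C i)))"
    using assms(15) by blast
  have "\<forall>\<^sub>F i in sequentially. i \<ge> 2 \<and> is_cycle (C i) \<and> card (verts (C i)) \<ge> 3"
    using c(2) diam_tendsto[of "nat \<lceil>2 * c\<rceil>"] eventually_ge_at_top[of 2]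
  proof eventually_elim
    case (elim i)
    have "2 * c < real (gdiam (finite_part \<Gamma> (q i)))" using elim(2) by linarith
    also have "\<dots> \<le> c * real (card (verts (C i)))" by (rule elim(1))
    finally have card: "card (verts (C i)) \<ge> 3" using c(1) by simp
    have "\<not> is_single_edge (C i)"
    proof
      assume "is_single_edge (C i)"
      then obtain x y where "verts (C i) = {x, y}" "x \<noteq> y" by (auto simp: is_single_edge_def)
      thus False using card by simp
    qed
    moreover have "block \<Gamma> (C i)" using block_in.blk[OF blk[of i]] elim(3) by simp
    ultimately show ?case using assms(6) card elim(3) by (auto simp: cactus_def)
  qed
  then obtain J0 where J0: "\<And>i. i \<ge> J0 \<Longrightarrow> i \<ge> 2 \<and> is_cycle (C i) \<and> card (verts (C i)) \<ge> 3"
    unfolding eventually_sequentially by blast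
  define J where "J = max J0 2"
  define Q where "Q j f pos a \<longleftrightarrow> gated_cycle (chips \<Gamma>) (verts \<Gamma>) (card (verts (C j))) f pos \<and>
    f ` {..<card (verts (C j))} = verts (C j) \<and> f 0 = q j \<and> 0 < a \<and> a < card (verts (C j)) \<and> f a = q (j - 1) \<and>
    (\<forall>x\<in>verts \<Gamma>. (pos x = 0 \<longleftrightarrow> P j x = q j) \<and> (pos x = a \<longleftrightarrow> P j x = q (j - 1))) \<and>
    (\<forall>x y. adjacent \<Gamma> x y \<longrightarrow> pos x = pos y \<or> pos y = nxt (card (verts (C j))) (pos x) \<or> pos x = nxt (card (verts (C j))) (pos y))"
    for j f pos a
  have "\<exists>f pos a. Q j f pos a" if "j \<ge> J" for j
    unfolding Q_def using J0[of j] that by (intro gated_cycle_ex) (auto simp: J_def)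
  then obtain f pos a where fpa: "\<And>j. j \<ge> J \<Longrightarrow> Q j (f j) (pos j) (a j)" by metis
  interpret spine_cycles \<Gamma> v C q J f pos a
    by unfold_locales (use fpa in \<open>simp_all add: J_def Q_def\<close>)
  show ?thesis by (rule critical_exponent[OF assms(8-10) assms(13,14) c assms(16,18)])
qed

end
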